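(* Let $\beta,n\in\mathbb{N}$. The Riemann hypothesis is true if and only if for every $s\in\mathbb{C}$ with $\operatorname{Re}(s)>\tfrac12$ the series $\sum_{q=1}^\infty c_q^{(\beta)}(n)q^{-s}$ converges and its sum equals $\sigma^{(\beta)}_{1-s/\beta}(n)/\zeta(s)$.
   Context: For $\beta,q,n\in\mathbb{N}$, $c_q^{(\beta)}(n)=\sum e^{2\pi i nh/q^\beta}$, the sum over integers $0\le h<q^\beta$ such that $h$ and $q^\beta$ have no common divisor of the form $d^\beta$ with $d>1$. For $z\in\mathbb{C}$, $\sigma_z^{(\beta)}(n)=\sum_{d\in\mathbb{N},\ d^\beta\mid n}d^{\beta z}$. *)

theory Defs
  imports "HOL-Analysis.Analysis"
begin

text \<open>Riemann zeta function on the half-plane Re s > 0 (s \<noteq> 1), via the classical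
  formula zeta(s) = s/(s-1) - s * int_1^infty frac(x) x^(-s-1) dx, which is the analytic
  continuation of sum_{n>=1} n^(-s) to Re s > 0. Only used for Re s > 0.\<close>
definition zeta :: "complex \<Rightarrow> complex" where
  "zeta s = s / (s - 1)
     - s * integral {1..} (\<lambda>x::real. of_real (frac x) * (of_real x :: complex) powr (- s - 1))"

definition riemann_hypothesis :: bool where
  "riemann_hypothesis \<longleftrightarrow>
     (\<forall>s. 0 < Re s \<and> Re s < 1 \<and> zeta s = 0 \<longrightarrow> Re s = 1/2)"

definition gen_ramanujan_sum :: "nat \<Rightarrow> nat \<Rightarrow> nat \<Rightarrow> complex" where
  "gen_ramanujan_sum \<beta> q n =
     (\<Sum>h \<in> {h. h < q ^ \<beta> \<and> \<not> (\<exists>d>1. d ^ \<beta> dvd h \<and> d ^ \<beta> dvd q ^ \<beta>)}.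
        cis (2 * pi * real n * real h / real (q ^ \<beta>)))"

definition gen_sigma :: "nat \<Rightarrow> complex \<Rightarrow> nat \<Rightarrow> complex" where
  "gen_sigma \<beta> z n = (\<Sum>d \<in> {d. 0 < d \<and> d ^ \<beta> dvd n}. (of_nat d :: complex) powr (of_nat \<beta> * z))"

end

theory Submission
  imports Defs "HOL-Complex_Analysis.Complex_Analysis" "HOL-Number_Theory.Number_Theory"
    "HOL-Computational_Algebra.Squarefree"
begin

text \<open>
  Moebius inversion over the divisors of \<open>q\<close> turns the Dirichlet series of the generalised Ramanujan sums
  into the product of the finite sum \<open>\<sigma>\<close> and the Dirichlet series of the Moebius function.

  If the Riemann hypothesis holds, then Littlewood's theorem gives the convergence of the latter for
  \<open>Re s > 1/2\<close>: the Borel--Caratheodory inequality for \<open>log \<zeta>\<close> on discs around \<open>2 + it\<close>, combined with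
  the bound on a small disc, yields \<open>1/\<zeta>(s) = O(\<bar>t\<bar>\<^sup>\<epsilon>)\<close>. The summatory function of \<open>\<mu>\<close> at an integer \<open>N\<close> is
  the difference of its first Riesz means at \<open>N + 1\<close> and \<open>N\<close>, hence an absolutely convergent
  Perron integral; moving the line of integration to \<open>Re s = 1/2 + \<epsilon>\<close> gives the bound \<open>O(N powr (1/2 + \<epsilon>))\<close>.

  Conversely, convergence for \<open>Re s > 1/2\<close> makes the sum \<open>G\<close> of the series holomorphic with \<open>G \<zeta> = \<sigma>\<close>, and \<open>\<sigma>\<close>
  has no zeros with \<open>Re s < 1\<close>, so neither has \<open>\<zeta>\<close> for \<open>1/2 < Re s < 1\<close>. The functional equation excludes
  the zeros with \<open>0 < Re s < 1/2\<close>. It is obtained by evaluating the Mellin transform of \<open>1/(exp x - 1)\<close>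
  for \<open>Re s > 1\<close> by a geometric series and for \<open>-1 < Re s < 0\<close> by partial fractions.
\<close>

section \<open>Mellin transforms\<close>

text \<open>The discs of radius 3/2 about 2 + it touch the line Re s = 1/2 and, for small t, contain
  the pole of zeta. Hence the argument runs with \<open>zeta_reg\<close>, and zeros must be excluded
  in all of Re s > 1/2. As \<open>riemann_hypothesis\<close> speaks only of Re s < 1, the line Re s
  = 1 is settled by the Euler product and 3 + 4 cos x + cos 2x \<ge> 0. The Riesz mean supplies the
  kernel 1/(s (s + 1)). Differencing at N + 1 and N wins back the factor N that the mean costs,
  while an interpolated estimate keeps slightly more decay than 1/|s|. For Re s \<le> 1 absolute
  convergence fails, so the product with \<open>gen_sigma\<close> is set up as an exact identity
  between finite partial sums. Convergence for Re s > 1/2 says nothing about zeros with Re s < 1/2.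
  Reflecting them needs the functional equation only for 0 < Re s < 1, where both sides lie in the
  range of \<open>zeta\<close>. Its trigonometric factor stays an integral: the equation is read at
  1 - s, where a zero at s annihilates the side with this factor, and the other side is
  \<open>zeta_reg (1 - s)\<close> times factors without zeros.\<close>

lemma norm_powr_of_nat: "norm (of_nat n powr (s :: complex)) = real n powr Re s"
  using norm_powr_real_powr[of "of_nat n" s] by simp

lemma tendsto_Suc_powr_neg: "e < 0 \<Longrightarrow> (\<lambda>N. real (Suc N) powr e) \<longlonglongrightarrow> 0"
  by (intro tendsto_neg_powr filterlim_compose[OF filterlim_real_sequentially] filterlim_Suc)

lemma has_vector_derivative_powr_complex:
  fixes w :: complex
  assumes "w \<noteq> -1" "x > 0"
  shows "((\<lambda>x::real. of_real x powr (w + 1) / (w + 1)) has_vector_derivative of_real x powr w) (at x within A)"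
proof -
  have w: "w + 1 \<noteq> 0" using assms(1) by (simp add: add_eq_0_iff2)
  have "((\<lambda>z. z powr (w + 1)) has_field_derivative (w + 1) * of_real x powr (w + 1 - 1)) (at (of_real x))"
    using assms(2) by (intro has_field_derivative_powr) (auto simp: complex_nonpos_Reals_iff)
  then have "((\<lambda>z. z powr (w + 1) / (w + 1)) has_field_derivative (w + 1) * of_real x powr (w + 1 - 1) / (w + 1)) (at (of_real x))"
    by (intro DERIV_cdivide)
  then have "((\<lambda>z. z powr (w + 1) / (w + 1)) has_field_derivative of_real x powr w) (at (of_real x))"
    using w by simp
  then show ?thesis by (rule has_vector_derivative_real_field)
qed

lemma tendsto_integral_from_1:
  fixes f :: "real \<Rightarrow> complex"
  assumes abs: "f absolutely_integrable_on {1..}"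
  shows "(\<lambda>N. integral {1..real (Suc N)} f) \<longlonglongrightarrow> integral {1..} f"
proof -
  have int: "{1..real (Suc N)} \<inter> {1..} = {1..real (Suc N)}" for N by auto
  have f_int: "f integrable_on {1..real (Suc N)}" for N
    using set_integrable_subset[OF abs, of "{1..real (Suc N)}"] by (auto simp: absolutely_integrable_on_def)
  have "(\<lambda>N. integral {1..} (\<lambda>x. if x \<in> {1..real (Suc N)} then f x else 0)) \<longlonglongrightarrow> integral {1..} f"
  proof (rule dominated_convergence(2)[where f = "\<lambda>N x. if x \<in> {1..real (Suc N)} then f x else 0" and h = "\<lambda>x. norm (f x)"])
    show "(\<lambda>x. norm (f x)) integrable_on {1..}"
      using abs by (simp add: absolutely_integrable_on_def)
    show "(\<lambda>x. if x \<in> {1..real (Suc N)} then f x else 0) integrable_on {1..}" for N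
      unfolding integrable_restrict_Int int by (rule f_int)
    fix x :: real assume x: "x \<in> {1..}"
    obtain N0 where "x < real N0" using reals_Archimedean2 by blast
    then have "\<forall>\<^sub>F N in sequentially. (if x \<in> {1..real (Suc N)} then f x else 0) = f x"
      using x by (intro eventually_sequentiallyI[of N0]) auto
    then show "(\<lambda>N. if x \<in> {1..real (Suc N)} then f x else 0) \<longlonglongrightarrow> f x"
      by (rule tendsto_eventually)
  qed auto
  then show ?thesis unfolding Henstock_Kurzweil_Integration.integral_restrict_Int int .
qed

section \<open>Mellin transforms: holomorphy, dilation and absolute integrability\<close>

lemma norm_exp_minus_one_le:
  fixes z :: complex
  shows "norm (exp z - 1) \<le> norm z * exp (norm z)"
proof -
  have "norm (exp z - exp 0) \<le> exp (norm z) * norm (z - 0)"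
  proof (rule field_differentiable_bound[where S = "cball 0 (norm z)" and f' = exp])
    fix w :: complex assume "w \<in> cball 0 (norm z)"
    then have "Re w \<le> norm z" using complex_Re_le_cmod[of w] by simp
    then show "norm (exp w) \<le> exp (norm z)" by simp
  qed (auto intro!: derivative_eq_intros)
  then show ?thesis by (simp add: mult.commute)
qed

text \<open>Differentiation under the integral sign by dominated convergence. Openness of
  \<open>I\<close> leaves room to move the exponent both ways, and the integrands at the two shifted
  exponents dominate the difference quotients.\<close>

lemma mellin_holomorphic:
  fixes f :: "real \<Rightarrow> complex"
  assumes int: "\<And>s. Re s \<in> I \<Longrightarrow> (\<lambda>x. f x * of_real x powr s) absolutely_integrable_on {0<..}"
    and "open I"
  shows "(\<lambda>s. integral {0<..} (\<lambda>x. f x * of_real x powr s)) holomorphic_on {s. Re s \<in> I}"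
proof -
  define F where "F = (\<lambda>s. integral {0<..} (\<lambda>x. f x * of_real x powr s))"
  have "F field_differentiable (at s)" if s: "Re s \<in> I" for s
  proof -
    obtain e where e: "e > 0" "ball (Re s) e \<subseteq> I"
      using assms(2) s by (auto simp: open_contains_ball)
    \<comment> \<open>A third, because the majorant \<open>w\<close> uses exponents at distance
      \<open>2 * r\<close> from \<open>s\<close>.\<close>
    define r where "r = e / 3"
    have r: "r > 0" using e by (simp add: r_def)
    have I: "x \<in> I" if "\<bar>x - Re s\<bar> \<le> 2 * r" for x
    proof -
      have "x \<in> ball (Re s) e" using that e abs_minus_commute[of x "Re s"] by (simp add: r_def dist_real_def)
      then show ?thesis using e by blast
    qed
    define w where "w = (\<lambda>x. (norm (f x * of_real x powr (s + 2*r)) + norm (f x * of_real x powr (s - 2*r))) / r)"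
    define D where "D = integral {0<..} (\<lambda>x. f x * (of_real (ln x) * of_real x powr s))"
    have w_int: "w integrable_on {0<..}"
      unfolding w_def
      by (intro integrable_on_divide integrable_add)
         (use I[of "Re s + 2 * r"] I[of "Re s - 2 * r"] r int[of "s + 2*r"] int[of "s - 2*r"] in \<open>auto simp: absolutely_integrable_on_def\<close>)
    have bound: "norm (f x * ((of_real x powr (s + h) - of_real x powr s) / h)) \<le> w x"
      if x: "x > 0" and h: "norm h < r" "h \<noteq> 0" for x :: real and h :: complex
    proof -
      define L where "L = ln x"
      have e: "of_real x powr z = exp (z * of_real L)" for z :: complex
        using x by (simp add: powr_def L_def Ln_of_real)
      have "norm ((of_real x powr (s + h) - of_real x powr s) / h)
          = exp (Re s * L) * (norm (exp (h*L) - 1) / norm h)"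
      proof -
        have "of_real x powr (s + h) - of_real x powr s = exp (s * L) * (exp (h * L) - 1)"
          unfolding e by (simp add: ring_distribs exp_add)
        then show ?thesis by (simp add: norm_divide norm_mult)
      qed
      also have "norm (exp (h*L) - 1) / norm h \<le> \<bar>L\<bar> * exp (norm (h * L))"
        using norm_exp_minus_one_le[of "h*L"] h by (simp add: norm_mult field_simps)
      also have "\<dots> \<le> \<bar>L\<bar> * exp (r * \<bar>L\<bar>)"
        using h by (intro mult_left_mono) (auto simp: norm_mult intro!: mult_right_mono)
      \<comment> \<open>The logarithm produced by differentiation is absorbed by a second factor
        \<open>exp (r * \<bar>L\<bar>)\<close>, which doubles the shift.\<close>
      also have "\<dots> \<le> (exp (r * \<bar>L\<bar>) / r) * exp (r * \<bar>L\<bar>)"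
      proof (rule mult_right_mono)
        have "r * \<bar>L\<bar> \<le> exp (r * \<bar>L\<bar>)" using exp_ge_add_one_self[of "r * \<bar>L\<bar>"] by linarith
        then show "\<bar>L\<bar> \<le> exp (r * \<bar>L\<bar>) / r" using r(1) by (simp add: field_simps)
      qed simp
      also have "\<dots> = exp (2 * r * \<bar>L\<bar>) / r"
        by (simp flip: exp_add)
      \<comment> \<open>Adding both exponentials avoids a case split at x = 1.\<close>
      also have "\<dots> \<le> (exp (2 * r * L) + exp (-(2 * r * L))) / r"
        using r by (intro divide_right_mono) (auto simp: abs_if)
      finally have *: "norm ((of_real x powr (s + h) - of_real x powr s) / h) \<le>
          exp (Re s * L) * ((exp (2 * r * L) + exp (-(2 * r * L))) / r)" by simp
      have "norm (f x * ((of_real x powr (s + h) - of_real x powr s) / h)) \<le>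
          norm (f x) * (exp (Re s * L) * ((exp (2 * r * L) + exp (-(2 * r * L))) / r))"
        using * unfolding norm_mult[of "f x"] by (intro mult_left_mono) auto
      also have "\<dots> = w x"
        unfolding w_def e by (simp add: norm_mult ring_distribs add_divide_distrib flip: exp_add)
      finally show ?thesis .
    qed
    have "(F has_field_derivative D) (at s)"
      unfolding has_field_derivative_iff tendsto_at_iff_sequentially
    proof (intro allI impI)
      fix X assume X: "\<forall>i. X i \<in> UNIV - {s}" "X \<longlonglongrightarrow> s"
      obtain N where N: "\<And>i. i \<ge> N \<Longrightarrow> dist (X i) s < r"
        using X(2) r(1) unfolding lim_sequentially by blast
      define h where "h = (\<lambda>i. X (i + N) - s)"
      have h: "norm (h i) < r" "h i \<noteq> 0" for i
        using X(1) N[of "i + N"] by (auto simp: h_def dist_norm)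
      have h0: "h \<longlonglongrightarrow> 0"
        unfolding h_def using LIMSEQ_ignore_initial_segment[OF X(2), of N] by (simp add: LIM_zero)
      have Reh: "Re (s + h i) \<in> I" for i
        using h(1)[of i] abs_Re_le_cmod[of "h i"] r by (intro I) auto
      define q where "q = (\<lambda>i x. f x * ((of_real x powr (s + h i) - of_real x powr s) / h i))"
      have i1: "(\<lambda>x. f x * of_real x powr (s + h i)) integrable_on {0<..}"
        and i2: "(\<lambda>x. f x * of_real x powr s) integrable_on {0<..}" for i
        using int[of "s + h i"] int[of s] Reh[of i] s
        by (auto simp: absolutely_integrable_on_def)
      have q_eq: "q i = (\<lambda>x. (f x * of_real x powr (s + h i) - f x * of_real x powr s) / h i)" for i
        by (auto simp: q_def fun_eq_iff diff_divide_distrib ring_distribs)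
      have q_int: "q i integrable_on {0<..}" for i
        unfolding q_eq by (intro integrable_on_divide integrable_diff i1 i2)
      have lim: "(\<lambda>i. integral {0<..} (q i)) \<longlonglongrightarrow> D"
        unfolding D_def
      proof (rule dominated_convergence(2)[where f = q and h = w, OF q_int w_int])
        fix x :: real and i assume "x \<in> {0<..}"
        then show "norm (q i x) \<le> w x" unfolding q_def using bound[of x "h i"] h by auto
      next
        fix x :: real assume "x \<in> {0<..}"
        then have "((\<lambda>z. of_real x powr z) has_field_derivative (of_real (ln x) * of_real x powr s)) (at s)"
          by (auto intro!: derivative_eq_intros simp: Ln_of_real)
        then have "((\<lambda>y. (of_real x powr y - of_real x powr s) / (y - s)) \<longlongrightarrow> of_real (ln x) * of_real x powr s) (at s)"
          by (simp add: has_field_derivative_iff)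
        then have "((\<lambda>y. (of_real x powr y - of_real x powr s) / (y - s)) \<circ> (\<lambda>i. s + h i)) \<longlonglongrightarrow> of_real (ln x) * of_real x powr s"
          unfolding tendsto_at_iff_sequentially
          using h tendsto_add[OF tendsto_const h0, of s] by (auto dest!: spec[of _ "\<lambda>i. s + h i"])
        then show "(\<lambda>i. q i x) \<longlonglongrightarrow> f x * (of_real (ln x) * of_real x powr s)"
          unfolding q_def o_def by (intro tendsto_mult tendsto_const) simp
      qed
      have "integral {0<..} (q i) = (F (X (i + N)) - F s) / (X (i + N) - s)" for i
        unfolding q_eq F_def using integral_diff[OF i1[of i] i2]
        by (simp add: integral_divide h_def)
      then have "(\<lambda>i. (F (X (i + N)) - F s) / (X (i + N) - s)) \<longlonglongrightarrow> D"
        using lim by simp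
      then show "((\<lambda>y. (F y - F s) / (y - s)) \<circ> X) \<longlonglongrightarrow> D"
        unfolding o_def by (rule LIMSEQ_offset)
    qed
    then show ?thesis by (auto simp: field_differentiable_def)
  qed
  then show ?thesis unfolding F_def
    by (auto simp: holomorphic_on_def intro: field_differentiable_at_within)
qed

text \<open>Measurability of \<open>of_real x powr s\<close> comes from
  \<open>exp (s * of_real (ln x))\<close>, with which it agrees for x > 0; the rest is comparison
  with \<open>g\<close>.\<close>

lemma powr_absolutely_integrableI:
  fixes f :: "real \<Rightarrow> complex"
  assumes "f \<in> borel_measurable borel" "S \<in> sets borel" "S \<subseteq> {0<..}" "g integrable_on S"
    and "\<And>x. x \<in> S \<Longrightarrow> norm (f x) * x powr Re s \<le> g x"
  shows "(\<lambda>x. f x * of_real x powr s) absolutely_integrable_on S"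
proof (rule measurable_bounded_by_integrable_imp_absolutely_integrable[OF _ _ assms(4)])
  have "(\<lambda>x. f x * exp (s * of_real (ln x))) \<in> borel_measurable borel"
    using assms(1) by measurable
  then have "(\<lambda>x. f x * exp (s * of_real (ln x))) \<in> borel_measurable (lebesgue_on S)"
    by (intro measurable_restrict_space1 measurable_completion) simp
  also have "?this \<longleftrightarrow> (\<lambda>x. f x * of_real x powr s) \<in> borel_measurable (lebesgue_on S)"
    by (rule measurable_cong) (use assms(3) in \<open>auto simp: powr_def Ln_of_real\<close>)
  finally show "(\<lambda>x. f x * of_real x powr s) \<in> borel_measurable (lebesgue_on S)" .
  show "norm (f x * of_real x powr s) \<le> g x" if "x \<in> S" for x
    using assms(3,5) that by (force simp: norm_mult norm_powr_real_powr)
qed (use assms(2) in auto)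

text \<open>Substituting x / c for x turns the transform of \<open>h (c * x)\<close> into
  \<open>c powr (- w - 1)\<close> times that of \<open>h\<close>, and summability of the integrals
  of the norms permits termwise integration. One instance, h = exp(-x), produces zeta(s); the other,
  h = 2x/(x^2 + 1), produces zeta(1 - s).\<close>

lemma mellin_dilation_series:
  fixes h H :: "real \<Rightarrow> complex" and b :: "nat \<Rightarrow> complex" and c :: "nat \<Rightarrow> real"
  assumes h [measurable]: "h \<in> borel_measurable borel"
    and int: "(\<lambda>x. h x * of_real x powr w) absolutely_integrable_on {0<..}"
    and c: "\<And>n. c n > 0"
    and summ: "summable (\<lambda>n. norm (b n) * c n powr (- Re w - 1))"
    and abs: "\<And>x. x > 0 \<Longrightarrow> summable (\<lambda>n. norm (b n * h (c n * x)))"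
    and sums: "\<And>x. x > 0 \<Longrightarrow> (\<lambda>n. b n * h (c n * x)) sums H x"
  shows "(\<lambda>n. b n * of_real (c n) powr (- w - 1) * integral {0<..} (\<lambda>x. h x * of_real x powr w)) sums
           integral {0<..} (\<lambda>x. H x * of_real x powr w)"
proof -
  \<comment> \<open>Extended by 0 and written with \<open>exp\<close>, the integrand is Borel
    measurable, so that affine substitution for \<open>lborel\<close> applies.\<close>
  define g where "g = (\<lambda>x. indicator {0<..} x *\<^sub>R (h x * exp (w * of_real (ln x))))"
  have g_eq: "g = (\<lambda>x. indicator {0<..} x *\<^sub>R (h x * of_real x powr w))"
    by (auto simp: g_def fun_eq_iff indicator_def powr_def Ln_of_real)
  have g_meas: "g \<in> borel_measurable lborel" unfolding g_def by measurable
  have g_int: "integrable lborel g"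
    using int integrable_completion[OF g_meas] unfolding set_integrable_def g_eq by simp
  have transfer: "integral {0<..} F = integral\<^sup>L lborel (\<lambda>x. indicator {0<..} x *\<^sub>R F x)"
    if "integrable lborel (\<lambda>x. indicator {0<..} x *\<^sub>R F x)" for F :: "real \<Rightarrow> complex"
    using set_borel_integral_eq_integral(2)[of "{0<..}" F] that
    by (simp add: set_integrable_def set_lebesgue_integral_def)
  define k where "k = (\<lambda>n. b n * of_real (c n) powr (- w))"
  define f where "f = (\<lambda>n x. k n * g (0 + c n * x))"
  have f_eq: "f n x = indicator {0<..} x *\<^sub>R (b n * h (c n * x) * of_real x powr w)" for n x
  proof (cases "x > 0")
    case True
    have "complex_of_real (c n * x) powr w = of_real (c n) powr w * of_real x powr w"
      using c[of n] True by (simp add: powr_times_real)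
    moreover have "complex_of_real (c n) powr (-w) * of_real (c n) powr w = 1"
      using c[of n] by (simp add: powr_minus)
    ultimately show ?thesis using True c[of n] by (simp add: f_def k_def g_eq)
  next
    case False
    then have "\<not> c n * x > 0" using c[of n] by (simp add: zero_less_mult_iff)
    then show ?thesis using False by (simp add: f_def g_eq)
  qed
  have f_int: "integrable lborel (f n)" for n
    unfolding f_def using lborel_integrable_real_affine[OF g_int, of "c n" 0] c[of n]
    by (intro integrable_mult_right) auto
  have scale: "(\<integral>x. G (0 + c n * x) \<partial>lborel) = integral\<^sup>L lborel G /\<^sub>R c n" for n and G :: "real \<Rightarrow> 'b :: {banach, second_countable_topology}"
    using lborel_integral_real_affine[of "c n" G 0] c[of n] by simp
  have norm_k: "norm (k n) = norm (b n) * c n powr (- Re w)" for n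
    using c[of n] by (simp add: k_def norm_mult norm_powr_real_powr)
  have norm_int: "(\<integral>x. norm (f n x) \<partial>lborel) = norm (b n) * c n powr (- Re w - 1) * (\<integral>x. norm (g x) \<partial>lborel)" for n
  proof -
    have "(\<integral>x. norm (f n x) \<partial>lborel) = norm (k n) * ((\<integral>x. norm (g x) \<partial>lborel) / c n)"
      unfolding f_def norm_mult using scale[of "\<lambda>x. norm (g x)" n] by (simp add: divide_inverse mult.commute)
    also have "\<dots> = norm (b n) * c n powr (- Re w - 1) * (\<integral>x. norm (g x) \<partial>lborel)"
      using c[of n] by (simp add: norm_k powr_diff)
    finally show ?thesis .
  qed
  have s1: "AE x in lborel. summable (\<lambda>n. norm (f n x))"
  proof (intro AE_I2)
    fix x :: real
    show "summable (\<lambda>n. norm (f n x))"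
      using summable_mult2[OF abs[of x], of "norm (complex_of_real x powr w)"]
      by (cases "x > 0") (auto simp: f_eq norm_mult)
  qed
  have s2: "summable (\<lambda>n. \<integral>x. norm (f n x) \<partial>lborel)"
    unfolding norm_int by (intro summable_mult2 summ)
  have H_eq: "(\<Sum>n. f n x) = indicator {0<..} x *\<^sub>R (H x * of_real x powr w)" for x
  proof (cases "x > 0")
    case True
    then show ?thesis using sums_mult2[OF sums[OF True], of "of_real x powr w"] by (simp add: f_eq sums_iff)
  qed (simp add: f_eq)
  have H_int: "integrable lborel (\<lambda>x. indicator {0<..} x *\<^sub>R (H x * of_real x powr w))"
    using integrable_suminf[OF f_int s1 s2] unfolding H_eq .
  have "(\<lambda>n. integral\<^sup>L lborel (f n)) sums (\<integral>x. (\<Sum>n. f n x) \<partial>lborel)"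
    by (rule sums_integral[OF f_int s1 s2])
  also have "(\<integral>x. (\<Sum>n. f n x) \<partial>lborel) = integral {0<..} (\<lambda>x. H x * of_real x powr w)"
    unfolding H_eq transfer[OF H_int] ..
  also have "(\<lambda>n. integral\<^sup>L lborel (f n)) =
      (\<lambda>n. b n * of_real (c n) powr (- w - 1) * integral {0<..} (\<lambda>x. h x * of_real x powr w))"
  proof
    fix n
    have "integral\<^sup>L lborel (f n) = k n * (integral\<^sup>L lborel g / of_real (c n))"
      unfolding f_def using scale[of g n] by (simp add: scaleR_conv_of_real divide_inverse mult.commute)
    also have "integral\<^sup>L lborel g = integral {0<..} (\<lambda>x. h x * of_real x powr w)"
      using transfer g_int unfolding g_eq by metis
    also have "k n * (I / of_real (c n)) = b n * of_real (c n) powr (- w - 1) * I" for I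
      using c[of n] by (simp add: k_def powr_diff)
    finally show "integral\<^sup>L lborel (f n) = b n * of_real (c n) powr (- w - 1) * integral {0<..} (\<lambda>x. h x * of_real x powr w)" .
  qed
  finally show "(\<lambda>n. b n * of_real (c n) powr (- w - 1) * integral {0<..} (\<lambda>x. h x * of_real x powr w)) sums
           integral {0<..} (\<lambda>x. H x * of_real x powr w)" .
qed

text \<open>The exponent \<open>a\<close> governs the behaviour at 0 and \<open>b\<close> that at
  infinity; both bounds cover the point 1.\<close>

lemma mellin_absolutely_integrableI:
  fixes f :: "real \<Rightarrow> complex"
  assumes "f \<in> borel_measurable borel"
    and "\<And>x. 0 < x \<Longrightarrow> x \<le> 1 \<Longrightarrow> norm (f x) \<le> C * x powr a" "a + Re s > -1"
    and "\<And>x. 1 \<le> x \<Longrightarrow> norm (f x) \<le> D * x powr b" "b + Re s < -1"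
  shows "(\<lambda>x. f x * of_real x powr s) absolutely_integrable_on {0<..}"
proof -
  have "(\<lambda>x. f x * of_real x powr s) absolutely_integrable_on {0<..1}"
  proof (rule powr_absolutely_integrableI)
    show "(\<lambda>x. C * x powr (a + Re s)) integrable_on {0<..1}"
      using integrable_on_powr_from_0'[of "a + Re s" 1] assms(3) by (intro integrable_on_mult_right) auto
    show "norm (f x) * x powr Re s \<le> C * x powr (a + Re s)" if "x \<in> {0<..1}" for x
      using mult_right_mono[OF assms(2)[of x], of "x powr Re s"] that by (simp add: powr_add mult.assoc)
  qed (use assms(1) in auto)
  moreover have "(\<lambda>x. f x * of_real x powr s) absolutely_integrable_on {1..}"
  proof (rule powr_absolutely_integrableI)
    show "(\<lambda>x. D * x powr (b + Re s)) integrable_on {1..}"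
      using has_integral_powr_to_inf[of "b + Re s" 1] assms(5) by (intro integrable_on_mult_right) auto
    show "norm (f x) * x powr Re s \<le> D * x powr (b + Re s)" if "x \<in> {1..}" for x
      using mult_right_mono[OF assms(4)[of x], of "x powr Re s"] that by (simp add: powr_add mult.assoc)
  qed (use assms(1) in auto)
  ultimately have "(\<lambda>x. f x * of_real x powr s) absolutely_integrable_on ({0<..1} \<union> {1..})"
    by (intro set_integrable_Un) auto
  also have "{0<..1} \<union> {1..} = {0::real<..}" by auto
  finally show ?thesis .
qed

lemma has_integral_powr_0_1:
  fixes w :: complex
  assumes "Re w > -1"
  shows "((\<lambda>x. of_real x powr w) has_integral 1 / (w + 1)) {0<..1::real}"
proof -
  have w: "w + 1 \<noteq> 0" using assms by (auto simp: complex_eq_iff)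
  have "((\<lambda>x. complex_of_real x powr w) has_integral
          (of_real 1 powr (w + 1) / (w + 1) - of_real 0 powr (w + 1) / (w + 1))) {0..1::real}"
  proof (rule fundamental_theorem_of_calculus_interior)
    show "continuous_on {0..1::real} (\<lambda>x. complex_of_real x powr (w + 1) / (w + 1))"
      using assms w by (auto intro!: continuous_intros)
    fix x :: real assume "x \<in> {0<..<1}"
    then show "((\<lambda>x. complex_of_real x powr (w + 1) / (w + 1)) has_vector_derivative of_real x powr w) (at x)"
      using w by (intro has_vector_derivative_powr_complex) auto
  qed simp
  then have "((\<lambda>x. complex_of_real x powr w) has_integral 1 / (w + 1)) {0..1::real}" using w by simp
  then have "((\<lambda>x. if x \<in> {0<..1} then complex_of_real x powr w else 0) has_integral 1 / (w + 1)) {0..1::real}"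
    by (rule has_integral_spike_finite[of "{0}", rotated 2]) auto
  then show ?thesis by (subst (asm) has_integral_restrict) auto
qed

text \<open>The interval is open at 1 because it is the range where \<open>planck_reg\<close> and
  \<open>planck_cut\<close> will differ.\<close>

lemma has_integral_powr_1_inf:
  fixes w :: complex
  assumes "Re w < -1"
  shows "((\<lambda>x. of_real x powr w) has_integral - 1 / (w + 1)) {1::real<..}"
proof -
  have w: "w + 1 \<noteq> 0" using assms by (auto simp: complex_eq_iff)
  let ?f = "\<lambda>x::real. complex_of_real x powr w"
  have abs: "?f absolutely_integrable_on {1..}"
  proof -
    have "(\<lambda>x. x powr Re w) integrable_on {1..}"
      using has_integral_powr_to_inf[of "Re w" 1] assms by auto
    then have "(\<lambda>x. 1 * complex_of_real x powr w) absolutely_integrable_on {1..}"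
      by (intro powr_absolutely_integrableI[where g = "\<lambda>x. x powr Re w"]) auto
    then show ?thesis by simp
  qed
  have fin: "(?f has_integral (of_nat (Suc N) powr (w + 1) - 1) / (w + 1)) {1..real (Suc N)}" for N
  proof -
    have "(?f has_integral (of_real (real (Suc N)) powr (w + 1) / (w + 1) - of_real 1 powr (w + 1) / (w + 1))) {1..real (Suc N)}"
    proof (rule fundamental_theorem_of_calculus)
      fix x assume "x \<in> {1..real (Suc N)}"
      then show "((\<lambda>x. complex_of_real x powr (w + 1) / (w + 1)) has_vector_derivative ?f x) (at x within {1..real (Suc N)})"
        using w by (intro has_vector_derivative_powr_complex) auto
    qed simp
    then show ?thesis by (simp add: diff_divide_distrib)
  qed
  have "(\<lambda>N. (of_nat (Suc N) powr (w + 1) - 1) / (w + 1)) \<longlonglongrightarrow> integral {1..} ?f"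
    using tendsto_integral_from_1[OF abs] unfolding integral_unique[OF fin] .
  moreover have "(\<lambda>N. (of_nat (Suc N) powr (w + 1) - 1) / (w + 1)) \<longlonglongrightarrow> (0 - 1) / (w + 1)"
  proof (intro tendsto_divide tendsto_diff tendsto_const w)
    show "(\<lambda>N. complex_of_nat (Suc N) powr (w + 1)) \<longlonglongrightarrow> 0"
    proof (rule Lim_null_comparison)
      show "(\<lambda>N. real (Suc N) powr (Re w + 1)) \<longlonglongrightarrow> 0"
        using assms by (intro tendsto_Suc_powr_neg) auto
      show "\<forall>\<^sub>F N in sequentially. norm (complex_of_nat (Suc N) powr (w + 1)) \<le> real (Suc N) powr (Re w + 1)"
        by (intro always_eventually) (simp only: norm_powr_of_nat, simp)
    qed
  qed
  ultimately have "integral {1..} ?f = (0 - 1) / (w + 1)" by (rule LIMSEQ_unique)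
  then have "(?f has_integral - 1 / (w + 1)) {1..}"
    using abs by (simp add: has_integral_integrable_integral absolutely_integrable_on_def)
  then have "((\<lambda>x. if x \<in> {1<..} then ?f x else 0) has_integral - 1 / (w + 1)) {1..}"
    by (rule has_integral_spike_finite[of "{1}", rotated 2]) auto
  then show ?thesis by (subst (asm) has_integral_restrict) auto
qed

section \<open>The zeta function for \<open>Re s > 0\<close>\<close>

lemma borel_measurable_frac [measurable]: "(frac :: real \<Rightarrow> real) \<in> borel_measurable borel"
  unfolding frac_def[abs_def] by measurable

definition zeta_integral :: "complex \<Rightarrow> complex" where
  "zeta_integral s = integral {1..} (\<lambda>x::real. of_real (frac x) * (of_real x :: complex) powr (- s - 1))"

text \<open>\<open>zeta_reg s = (s - 1) * zeta s\<close>, extended to the removable singularity at \<open>s = 1\<close>.\<close>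
definition zeta_reg :: "complex \<Rightarrow> complex" where
  "zeta_reg s = s - s * (s - 1) * zeta_integral s"

lemma zeta_reg_1 [simp]: "zeta_reg 1 = 1"
  by (simp add: zeta_reg_def)

lemma zeta_eq_zeta_reg: "s \<noteq> 1 \<Longrightarrow> zeta s = zeta_reg s / (s - 1)"
  by (simp add: zeta_def zeta_reg_def zeta_integral_def field_simps)

lemma zeta_integral_integrable:
  assumes "Re s > 0"
  shows "(\<lambda>x::real. of_real (frac x) * (of_real x :: complex) powr (- s - 1)) absolutely_integrable_on {1..}"
proof (rule powr_absolutely_integrableI)
  show "(\<lambda>x. x powr (- Re s - 1)) integrable_on {1..}"
    using assms has_integral_powr_to_inf[of "- Re s - 1" 1] by auto
  show "norm (complex_of_real (frac x)) * x powr Re (- s - 1) \<le> x powr (- Re s - 1)" if "x \<in> {1..}" for x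
    using frac_lt_1[of x] frac_ge_0[of x] by (auto intro!: mult_left_le_one_le)
qed auto

lemma norm_zeta_integral_le:
  assumes "Re s > 0"
  shows "norm (zeta_integral s) \<le> 1 / Re s"
proof -
  have i: "((\<lambda>x. x powr (- Re s - 1)) has_integral 1 / Re s) {1..}"
    using assms has_integral_powr_to_inf[of "- Re s - 1" 1] by simp
  have "norm (zeta_integral s) \<le> integral {1..} (\<lambda>x. x powr (- Re s - 1))"
    unfolding zeta_integral_def
  proof (rule integral_norm_bound_integral)
    show "(\<lambda>x. x powr (- Re s - 1)) integrable_on {1..}" using i by blast
    show "(\<lambda>x::real. of_real (frac x) * (of_real x :: complex) powr (- s - 1)) integrable_on {1..}"
      using zeta_integral_integrable[OF assms] by (simp add: absolutely_integrable_on_def)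
    show "norm (of_real (frac x) * (of_real x :: complex) powr (- s - 1)) \<le> x powr (- Re s - 1)"
      if "x \<in> {1..}" for x
      using that frac_lt_1[of x] frac_ge_0[of x]
      by (auto simp: norm_mult norm_powr_real_powr intro!: mult_left_le_one_le)
  qed
  then show ?thesis using i by (simp add: integral_unique)
qed

text \<open>Cutting \<open>frac\<close> off below 1 makes the integral a Mellin transform over the
  positive axis with exponent \<open>w = - s - 1\<close>, so that Re s > 0 becomes Re w <
  -1.\<close>

lemma zeta_integral_holomorphic: "zeta_integral holomorphic_on {s. Re s > 0}"
proof -
  define f where "f = (\<lambda>x::real. if x \<in> {1..} then complex_of_real (frac x) else 0)"
  have eq: "(\<lambda>x. f x * of_real x powr w) = (\<lambda>x. if x \<in> {1..} then of_real (frac x) * of_real x powr w else 0)" for w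
    by (auto simp: f_def)
  have sub: "{1..} \<inter> {0<..} = {1::real..}" by auto
  have "(\<lambda>w. integral {0<..} (\<lambda>x. f x * of_real x powr w)) holomorphic_on {w. Re w \<in> {..<-1}}"
  proof (rule mellin_holomorphic)
    fix w assume "Re w \<in> {..<-1}"
    then have *: "(\<lambda>x::real. of_real (frac x) * (of_real x :: complex) powr w) absolutely_integrable_on {1..}"
      using zeta_integral_integrable[of "-w-1"] by simp
    show "(\<lambda>x. f x * of_real x powr w) absolutely_integrable_on {0<..}"
    proof -
      have "(\<lambda>x. indicat_real {0<..} x *\<^sub>R (f x * of_real x powr w)) =
          (\<lambda>x. indicat_real {1..} x *\<^sub>R (of_real (frac x) * of_real x powr w))"
        by (auto simp: fun_eq_iff indicator_def f_def)
      then show ?thesis using * unfolding set_integrable_def by simp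
    qed
  qed auto
  moreover have "integral {0<..} (\<lambda>x. f x * of_real x powr w) = zeta_integral (-w-1)" for w
    unfolding eq zeta_integral_def Henstock_Kurzweil_Integration.integral_restrict_Int sub by simp
  ultimately have *: "(\<lambda>w. zeta_integral (-w-1)) holomorphic_on {w. Re w < -1}" by simp
  have "((\<lambda>w. zeta_integral (-w-1)) \<circ> (\<lambda>s. -s-1)) holomorphic_on {s. Re s > 0}"
    by (intro holomorphic_on_compose_gen[OF _ *] holomorphic_intros) auto
  then show ?thesis by (simp add: o_def)
qed

lemma zeta_reg_holomorphic: "zeta_reg holomorphic_on {s. Re s > 0}"
  unfolding zeta_reg_def[abs_def] by (intro holomorphic_intros zeta_integral_holomorphic)

text \<open>Polynomial growth in vertical strips; this is the upper bound used on the large disc in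
  \<open>inverse_zeta_growth_RH\<close>.\<close>

lemma norm_zeta_reg_le:
  assumes "Re s > 0"
  shows "norm (zeta_reg s) \<le> norm s + norm s * norm (s - 1) / Re s"
proof -
  have "norm (zeta_reg s) \<le> norm s + norm (s * (s - 1) * zeta_integral s)"
    unfolding zeta_reg_def by (rule norm_triangle_ineq4)
  also have "norm (s * (s - 1) * zeta_integral s) \<le> norm s * norm (s - 1) * (1 / Re s)"
    unfolding norm_mult by (intro mult_left_mono norm_zeta_integral_le assms) auto
  finally show ?thesis by simp
qed

text \<open>On [n, n + 1) the fractional part is x - n, so the integral over each piece is
  elementary. Summation by parts collects the pieces into a partial sum of the series and two
  boundary terms that vanish in the limit for Re s > 1.\<close>

lemma zeta_sums:
  assumes s: "Re s > 1"
  shows "(\<lambda>n. 1 / of_nat (Suc n) powr s) sums zeta s"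
proof -
  define f where "f = (\<lambda>x::real. of_real (frac x) * (of_real x :: complex) powr (- s - 1))"
  have s0: "s \<noteq> 0" "s \<noteq> 1" using s by auto
  define G where "G = (\<lambda>n. (of_nat (Suc (Suc n)) powr (1 - s) - of_nat (Suc n) powr (1 - s)) / (1 - s)
      + of_nat (Suc n) * (of_nat (Suc (Suc n)) powr (-s) - of_nat (Suc n) powr (-s)) / s)"
  have piece: "(f has_integral G n) {real (Suc n)..real (Suc (Suc n))}" for n
  proof -
    define H where "H = (\<lambda>x::real. complex_of_real x powr (1 - s) / (1 - s) + of_nat (Suc n) * of_real x powr (-s) / s)"
    have "((\<lambda>x. of_real x powr (-s) - of_nat (Suc n) * of_real x powr (-s-1)) has_integral
        (H (real (Suc (Suc n))) - H (real (Suc n)))) {real (Suc n)..real (Suc (Suc n))}"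
    proof (rule fundamental_theorem_of_calculus)
      fix x assume "x \<in> {real (Suc n)..real (Suc (Suc n))}"
      then have x: "x > 0" by auto
      have "((\<lambda>x. of_real x powr (-s + 1) / (-s + 1) - of_nat (Suc n) * (of_real x powr (-s-1 + 1) / (-s-1 + 1)))
          has_vector_derivative (of_real x powr (-s) - of_nat (Suc n) * of_real x powr (-s-1)))
         (at x within {real (Suc n)..real (Suc (Suc n))})"
        using s0 x
        by (intro has_vector_derivative_diff has_vector_derivative_mult_right has_vector_derivative_powr_complex)
           (auto simp: minus_equation_iff)
      also have "(\<lambda>x. of_real x powr (-s + 1) / (-s + 1) - of_nat (Suc n) * (of_real x powr (-s-1 + 1) / (-s-1 + 1))) = H"
        by (simp add: H_def fun_eq_iff)
      finally show "(H has_vector_derivative (of_real x powr (-s) - of_nat (Suc n) * of_real x powr (-s-1)))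
         (at x within {real (Suc n)..real (Suc (Suc n))})" .
    qed simp
    also have "H (real (Suc (Suc n))) - H (real (Suc n)) = G n"
      by (simp add: H_def G_def diff_divide_distrib right_diff_distrib)
    finally show ?thesis
    \<comment> \<open>At the right end point \<open>frac\<close> jumps back to 0, so this one point
      is discarded.\<close>
    proof (rule has_integral_spike_finite[of "{real (Suc (Suc n))}", rotated 2])
      fix x assume "x \<in> {real (Suc n)..real (Suc (Suc n))} - {real (Suc (Suc n))}"
      then have x: "real (Suc n) \<le> x" "x < real (Suc n) + 1" by auto
      then have "\<lfloor>x\<rfloor> = int (Suc n)" by (simp add: floor_eq_iff)
      then have "frac x = x - real (Suc n)" by (simp add: frac_def)
      moreover have "complex_of_real x * of_real x powr (-s-1) = of_real x powr (-s)"
        using x by (simp add: powr_diff powr_minus field_simps)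
      ultimately show "f x = of_real x powr (-s) - of_nat (Suc n) * of_real x powr (-s-1)"
        by (simp add: f_def left_diff_distrib)
    qed simp
  qed
  have "(f has_integral (\<Sum>n<N. G n)) {1..real (Suc N)}" for N
  proof (induction N)
    case (Suc N)
    show ?case
      using has_integral_combine[OF _ _ Suc piece[of N]] by simp
  qed (simp add: has_integral_refl)
  then have intN: "f integrable_on {1..real (Suc N)}" "integral {1..real (Suc N)} f = (\<Sum>n<N. G n)" for N
    by (auto simp: integral_unique)
  have sG: "s * (\<Sum>n<N. G n) = s / (1 - s) * (of_nat (Suc N) powr (1 - s) - 1)
      + of_nat N * of_nat (Suc N) powr (-s) - (\<Sum>n<N. 1 / of_nat (Suc n) powr s)" for N
  proof (induction N)
    case (Suc N)
    have "s * G N = s / (1 - s) * (of_nat (Suc (Suc N)) powr (1 - s) - of_nat (Suc N) powr (1 - s))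
       + of_nat (Suc N) * (of_nat (Suc (Suc N)) powr (-s) - of_nat (Suc N) powr (-s))"
    proof -
      have "s * (A / (1 - s) + c * B / s) = s / (1 - s) * A + c * B" for A B c
        using s0 by (simp add: distrib_left)
      then show ?thesis unfolding G_def .
    qed
    moreover have "1 / of_nat (Suc N) powr s = of_nat (Suc N) powr (-s)" by (rule powr_minus_divide[symmetric])
    ultimately show ?case using Suc by (simp add: ring_distribs)
  qed simp
  have l1: "(\<lambda>N. of_nat (Suc N) powr (1 - s)) \<longlonglongrightarrow> 0"
  proof (rule Lim_null_comparison[OF _ tendsto_Suc_powr_neg])
    show "\<forall>\<^sub>F N in sequentially. norm (complex_of_nat (Suc N) powr (1 - s)) \<le> real (Suc N) powr (- (Re s - 1))"
      by (intro always_eventually) (simp only: norm_powr_of_nat, simp)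
  qed (use s in auto)
  have l2: "(\<lambda>N. of_nat N * of_nat (Suc N) powr (- s)) \<longlonglongrightarrow> 0"
  proof (rule Lim_null_comparison[OF _ tendsto_Suc_powr_neg])
    show "\<forall>\<^sub>F N in sequentially. norm (of_nat N * complex_of_nat (Suc N) powr (- s)) \<le> real (Suc N) powr (- (Re s - 1))"
    proof (intro always_eventually allI)
      fix N
      have "norm (of_nat N * complex_of_nat (Suc N) powr (- s)) \<le> real (Suc N) * real (Suc N) powr (- Re s)"
        unfolding norm_mult norm_powr_of_nat by (intro mult_mono) auto
      also have "\<dots> = real (Suc N) powr (- (Re s - 1))"
        using powr_mult_base[of "real (Suc N)" "- Re s"] by (simp add: algebra_simps)
      finally show "norm (of_nat N * complex_of_nat (Suc N) powr (- s)) \<le> real (Suc N) powr (- (Re s - 1))" .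
    qed
  qed (use s in auto)
  have "(\<lambda>N. \<Sum>n<N. G n) \<longlonglongrightarrow> integral {1..} f"
  proof -
    have "f absolutely_integrable_on {1..}"
      unfolding f_def using s by (intro zeta_integral_integrable) auto
    from tendsto_integral_from_1[OF this] show ?thesis unfolding intN(2) .
  qed
  then have "(\<lambda>N. s / (1 - s) * (of_nat (Suc N) powr (1 - s) - 1) + of_nat N * of_nat (Suc N) powr (-s) - s * (\<Sum>n<N. G n))
     \<longlonglongrightarrow> s / (1 - s) * (0 - 1) + 0 - s * integral {1..} f"
    by (intro tendsto_intros l1 l2)
  also have "s / (1 - s) * (0 - 1) + 0 - s * integral {1..} f = zeta s"
    using s0 by (simp add: zeta_def f_def field_simps)
  finally show ?thesis unfolding sums_def sG by simp
qed

section \<open>The Moebius function and generalised Ramanujan sums\<close>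

definition moebius_mu :: "nat \<Rightarrow> int" where
  "moebius_mu n = (if squarefree n then (-1) ^ card (prime_factors n) else 0)"

lemma moebius_mu_1 [simp]: "moebius_mu 1 = 1" "moebius_mu (Suc 0) = 1"
  by (auto simp: moebius_mu_def)

lemma abs_moebius_mu_le: "\<bar>moebius_mu n\<bar> \<le> 1"
  by (auto simp: moebius_mu_def power_abs)

lemma norm_moebius_mu_le: "norm (of_int (moebius_mu n) :: complex) \<le> 1"
  using abs_moebius_mu_le[of n] by (auto simp: norm_of_int)

lemma moebius_mu_prime_mult:
  fixes p n :: nat
  assumes "prime p" "\<not> p dvd n" "n > 0"
  shows "moebius_mu (p * n) = - moebius_mu n"
proof -
  have cop: "coprime p n" using assms prime_imp_coprime by blast
  have "squarefree (p * n) \<longleftrightarrow> squarefree n"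
    using squarefree_mult_coprime[OF cop] squarefree_prime[OF assms(1)] squarefree_multD(2) by blast
  moreover have "prime_factors (p * n) = insert p (prime_factors n)"
    using assms by (simp add: prime_factors_product prime_factorization_prime)
  moreover have "p \<notin> prime_factors n" using assms by auto
  ultimately show ?thesis by (simp add: moebius_mu_def)
qed

lemma moebius_mu_prime_square_dvd:
  fixes p n :: nat
  assumes "prime p" "p ^ 2 dvd n"
  shows "moebius_mu n = 0"
  using assms by (auto simp: moebius_mu_def squarefree_def)

text \<open>For a prime p dividing n, the divisors d that p does not divide cancel against p d; the
  remaining multiples of p are divisible by p^2.\<close>

lemma sum_moebius_mu_divisors:
  assumes "n > 0"
  shows "(\<Sum>d | d dvd n. moebius_mu d) = (if n = 1 then 1 else 0)"
proof (cases "n = 1")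
  case False
  then obtain p where p: "prime p" "p dvd n"
    using prime_factor_nat by blast
  define A where "A = {d. d dvd n \<and> \<not> p dvd d}"
  define B where "B = {d. d dvd n \<and> p dvd d}"
  have fin: "finite {d. d dvd n}" using assms by auto
  have finA: "finite A" "finite B" unfolding A_def B_def by (auto intro: finite_subset[OF _ fin])
  have "(\<Sum>d | d dvd n. moebius_mu d) = sum moebius_mu A + sum moebius_mu B"
    using finA by (subst sum.union_disjoint[symmetric]) (auto simp: A_def B_def intro!: sum.cong)
  also have "sum moebius_mu B = sum moebius_mu ((\<lambda>d. p * d) ` {d\<in>A. p * d dvd n})"
  proof (rule sum.mono_neutral_right)
    show "(\<lambda>d. p * d) ` {d\<in>A. p * d dvd n} \<subseteq> B" by (auto simp: A_def B_def)
    show "\<forall>i\<in>B - (\<lambda>d. p * d) ` {d\<in>A. p * d dvd n}. moebius_mu i = 0"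
    proof
      fix i assume i: "i \<in> B - (\<lambda>d. p * d) ` {d\<in>A. p * d dvd n}"
      then obtain d where d: "i = p * d" by (auto simp: B_def)
      have "p * d dvd n" using i d by (auto simp: B_def)
      moreover have "d dvd n" using calculation dvd_mult_right by blast
      ultimately have "p dvd d" using i d by (auto simp: A_def)
      then show "moebius_mu i = 0"
        using p d by (intro moebius_mu_prime_square_dvd[of p]) (auto simp: power2_eq_square)
    qed
  qed (use finA in auto)
  also have "\<dots> = (\<Sum>d | d \<in> A \<and> p * d dvd n. moebius_mu (p * d))"
    using p by (subst sum.reindex) (auto simp: inj_on_def o_def)
  \<comment> \<open>\<open>p\<close> and \<open>d\<close> are coprime divisors of \<open>n\<close>,
    so \<open>p * d dvd n\<close> holds automatically.\<close>
  also have "\<dots> = (\<Sum>d\<in>A. moebius_mu (p * d))"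
  proof (rule sum.mono_neutral_left)
    show "\<forall>i\<in>A - {d \<in> A. p * d dvd n}. moebius_mu (p * i) = 0"
    proof
      fix i assume i: "i \<in> A - {d \<in> A. p * d dvd n}"
      then have "coprime p i" using p prime_imp_coprime by (auto simp: A_def)
      then have "p * i dvd n" using i p by (auto simp: A_def intro: divides_mult)
      then show "moebius_mu (p * i) = 0" using i by auto
    qed
  qed (use finA in auto)
  also have "\<dots> = (\<Sum>d\<in>A. - moebius_mu d)"
    using p assms by (intro sum.cong moebius_mu_prime_mult) (auto simp: A_def intro: Nat.gr0I)
  finally show ?thesis using False by (simp add: sum_negf)
qed (auto simp: )

text \<open>The set of these d is closed under divisors and least common multiples, hence consists
  of the divisors of its largest element. Conditions on b-th powers thus become ordinary divisor
  sums, both for the range of h in a Ramanujan sum and, with h = q = n, for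
  \<open>gen_sigma\<close>.\<close>

lemma power_dvd_set_eq_divisors:
  fixes q h :: nat
  assumes "q > 0"
  obtains m where "m > 0" "\<And>d. d dvd q \<and> d ^ b dvd h \<longleftrightarrow> d dvd m"
proof -
  define D where "D = {d. d dvd q \<and> d ^ b dvd h}"
  have fin: "finite D" unfolding D_def using assms by auto
  have one: "1 \<in> D" by (auto simp: D_def)
  define m where "m = Max D"
  have m: "m \<in> D" unfolding m_def using fin one by (intro Max_in) auto
  have mpos: "m > 0" using m assms by (auto simp: D_def intro: Nat.gr0I)
  have lcm: "lcm a c \<in> D" if "a \<in> D" "c \<in> D" for a c
  proof -
    have pos: "a > 0" "c > 0" using that assms by (auto simp: D_def intro: Nat.gr0I)
    \<comment> \<open>Powers commute with gcd, hence also with lcm, because gcd times lcm is the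
      product.\<close>
    have "lcm a c ^ b * gcd a c ^ b = a ^ b * c ^ b"
      by (metis power_mult_distrib lcm_mult_gcd mult.commute prod_gcd_lcm_nat)
    also have "\<dots> = lcm (a^b) (c^b) * gcd a c ^ b"
      by (metis gcd_exp lcm_mult_gcd mult.commute prod_gcd_lcm_nat)
    finally have "lcm a c ^ b = lcm (a^b) (c^b)" using pos by simp
    then show ?thesis using that by (auto simp: D_def)
  qed
  have "d \<in> D \<longleftrightarrow> d dvd m" for d
  proof
    assume "d \<in> D"
    then have "lcm d m \<in> D" using lcm m by blast
    then have "lcm d m \<le> m" unfolding m_def using fin by simp
    moreover have "lcm d m > 0" using \<open>lcm d m \<in> D\<close> assms by (simp add: D_def dvd_pos_nat)
    then have "m \<le> lcm d m" by (intro dvd_imp_le) auto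
    ultimately have "lcm d m = m" by (rule le_antisym)
    then show "d dvd m" by (metis dvd_lcm1)
  next
    assume "d dvd m"
    then show "d \<in> D" using m by (auto simp: D_def intro: dvd_trans dvd_power_same)
  qed
  with mpos that show ?thesis unfolding D_def by blast
qed

section \<open>Ramanujan sums as divisor sums\<close>

lemma sum_cis_multiples:
  fixes k n :: nat
  assumes "k > 0"
  shows "(\<Sum>m<k. cis (2 * pi * real n * real m / real k)) = (if k dvd n then of_nat k else 0)"
proof -
  define z where "z = cis (2 * pi * real n / real k)"
  have eq: "cis (2 * pi * real n * real m / real k) = z ^ m" for m
    unfolding z_def Complex.DeMoivre by (rule arg_cong[of _ _ cis]) simp
  show ?thesis
  proof (cases "k dvd n")
    case True
    then obtain j where "n = k * j" by auto
    then have "z = 1" using assms cis_multiple_2pi[of "real j"] by (simp add: z_def mult.assoc)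
    then show ?thesis using True unfolding eq by simp
  next
    case False
    have "z \<noteq> 1"
    proof
      assume "z = 1"
      then have "cos (2 * pi * real n / real k) = 1" by (simp add: z_def complex_eq_iff)
      then obtain j :: int where "2 * pi * real n / real k = of_int j * 2 * pi"
        by (auto simp: cos_one_2pi_int)
      then have "real n = of_int j * real k" using assms by (simp add: field_simps)
      then have "int n = j * int k"
        by (metis of_int_eq_iff of_int_mult of_int_of_nat_eq)
      then show False using False by (metis dvd_triv_right int_dvd_int_iff)
    qed
    moreover have "z ^ k = 1"
      using assms cis_multiple_2pi[of "real n"] unfolding z_def Complex.DeMoivre by simp
    ultimately show ?thesis using False unfolding eq by (simp add: sum_gp_strict)
  qed
qed

text \<open>Summing \<open>moebius_mu d\<close> over d | q with d^b | h detects the admissible h.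
  After exchanging the sums, h runs over the multiples of d^b, and what remains is a complete
  exponential sum modulo (q/d)^b.\<close>

lemma gen_ramanujan_sum_eq:
  assumes "q > 0" "b > 0"
  shows "gen_ramanujan_sum b q n =
    (\<Sum>d | d dvd q. of_int (moebius_mu d) * (if (q div d) ^ b dvd n then of_nat ((q div d) ^ b) else 0))"
proof -
  let ?e = "\<lambda>h. cis (2 * pi * real n * real h / real (q ^ b))"
  let ?t = "\<lambda>d h. if d ^ b dvd h then of_int (moebius_mu d) * ?e h else 0"
  have finq: "finite {d. d dvd q}" using assms by auto
  have "gen_ramanujan_sum b q n = (\<Sum>h<q^b. if \<exists>d>1. d ^ b dvd h \<and> d ^ b dvd q ^ b then 0 else ?e h)"
    unfolding gen_ramanujan_sum_def
    by (rule sum.mono_neutral_cong_left) auto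
  also have "\<dots> = (\<Sum>h<q^b. \<Sum>d | d dvd q \<and> d ^ b dvd h. of_int (moebius_mu d) * ?e h)"
  proof (rule sum.cong)
    fix h
    obtain m where m: "m > 0" "\<And>d. d dvd q \<and> d ^ b dvd h \<longleftrightarrow> d dvd m"
      using power_dvd_set_eq_divisors[OF assms(1)] by blast
    \<comment> \<open>\<open>d ^ b\<close> divides \<open>q ^ b\<close> exactly when
      \<open>d\<close> divides \<open>q\<close>, so the excluded \<open>h\<close> are those with
      \<open>m \<noteq> 1\<close>.\<close>
    have "(\<exists>d>1. d ^ b dvd h \<and> d ^ b dvd q ^ b) \<longleftrightarrow> (\<exists>d>1. d dvd m)"
      using m(2) assms(2) by (auto simp: pow_divides_pow_iff)
    also have "\<dots> \<longleftrightarrow> m \<noteq> 1"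
      using m(1) by (auto intro!: exI[of _ m])
    finally have 1: "(\<exists>d>1. d ^ b dvd h \<and> d ^ b dvd q ^ b) \<longleftrightarrow> m \<noteq> 1" .
    have "(\<Sum>d | d dvd q \<and> d ^ b dvd h. of_int (moebius_mu d) * ?e h) = of_int (\<Sum>d | d dvd m. moebius_mu d) * ?e h"
      unfolding m(2) by (simp add: sum_distrib_right)
    then show "(if \<exists>d>1. d ^ b dvd h \<and> d ^ b dvd q ^ b then 0 else ?e h) =
        (\<Sum>d | d dvd q \<and> d ^ b dvd h. of_int (moebius_mu d) * ?e h)"
      unfolding 1 using sum_moebius_mu_divisors[OF m(1)] by simp
  qed simp
  also have "\<dots> = (\<Sum>h<q^b. \<Sum>d | d dvd q. ?t d h)"
    using finq by (intro sum.cong refl sum.mono_neutral_cong_left) auto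
  also have "\<dots> = (\<Sum>d | d dvd q. \<Sum>h<q^b. ?t d h)"
    by (rule sum.swap)
  also have "\<dots> = (\<Sum>d | d dvd q. of_int (moebius_mu d) * (if (q div d) ^ b dvd n then of_nat ((q div d) ^ b) else 0))"
  proof (rule sum.cong)
    fix d assume "d \<in> {d. d dvd q}"
    then obtain r where r: "q = d * r" by auto
    then have pos: "d > 0" "r > 0" using assms by auto
    have "(\<Sum>h<q^b. ?t d h)
       = (\<Sum>h\<in>(\<lambda>m. d^b * m) ` {..<r^b}. of_int (moebius_mu d) * ?e h)"
    proof (rule sum.mono_neutral_cong_right)
      show "\<forall>i\<in>{..<q ^ b} - (*) (d ^ b) ` {..<r ^ b}.
       (?t d i) = 0"
      proof
        fix i assume i: "i \<in> {..<q ^ b} - (*) (d ^ b) ` {..<r ^ b}"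
        have "\<not> d ^ b dvd i"
        proof
          assume "d ^ b dvd i"
          then obtain m where "i = d ^ b * m" by auto
          then show False using i pos by (auto simp: r power_mult_distrib)
        qed
        then show "(?t d i) = 0" by simp
      qed
    qed (use pos in \<open>auto simp: r power_mult_distrib\<close>)
    also have "\<dots> = (\<Sum>m<r^b. of_int (moebius_mu d) * ?e (d^b * m))"
      using pos by (subst sum.reindex) (auto simp: inj_on_def)
    also have "\<dots> = of_int (moebius_mu d) * (\<Sum>m<r^b. cis (2 * pi * real n * real m / real (r^b)))"
      unfolding sum_distrib_left using pos by (intro sum.cong) (auto simp: r power_mult_distrib mult.assoc)
    also have "(\<Sum>m<r^b. cis (2 * pi * real n * real m / real (r^b))) = (if r^b dvd n then of_nat (r^b) else 0)"
      using pos by (intro sum_cis_multiples) auto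
    finally show "(\<Sum>h<q^b. ?t d h) =
      of_int (moebius_mu d) * (if (q div d) ^ b dvd n then of_nat ((q div d) ^ b) else 0)"
      using pos r by simp
  qed simp
  finally show ?thesis .
qed

text \<open>By multiplicativity the sum is a product, over the prime powers p^k exactly dividing m,
  of geometric sums in z = p^w. As |z| > 1, the numerator 1 - z^(k+1) is not 0. The induction splits
  off one prime at a time.\<close>

lemma sum_divisors_powr_nonzero:
  fixes w :: complex
  assumes "Re w > 0" "m > 0"
  shows "(\<Sum>d | d dvd m. of_nat d powr w) \<noteq> 0"
  using assms(2)
proof (induction m rule: less_induct)
  case (less m)
  show ?case
  proof (cases "m = 1")
    case True
    then show ?thesis by simp
  next
    case False
    then obtain p where p: "prime p" "p dvd m"
      using prime_factor_nat by blast
    define k where "k = multiplicity p m"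
    obtain r where r: "m = p ^ k * r" "\<not> p dvd r"
      using multiplicity_decompose'[of m p] less.prems p unfolding k_def
      by (metis not_prime_unit neq0_conv)
    have k: "k > 0" using p less.prems r by (cases k) auto
    have rpos: "r > 0" using r less.prems by (intro Nat.gr0I) auto
    have pk: "p ^ k > 1" using k prime_gt_1_nat[OF p(1)] by (intro one_less_power) auto
    have rm: "r < m" using r rpos pk by simp
    define z where "z = of_nat p powr w"
    have zn: "norm z > 1"
      using prime_gt_1_nat[OF p(1)] assms(1) by (simp add: z_def norm_powr_real_powr)
    have inj: "inj_on (\<lambda>(i, d). p ^ i * d) ({..k} \<times> {d. d dvd r})"
    proof (rule inj_onI, clarify)
      fix i d j e assume ij: "d dvd r" "e dvd r" "p ^ i * d = p ^ j * e"
      have nd: "\<not> p dvd d" "\<not> p dvd e" using ij r dvd_trans by blast+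
      have pos: "d > 0" "e > 0" using ij rpos by (auto intro: Nat.gr0I)
      have "multiplicity p (p ^ i * d) = i" "multiplicity p (p ^ j * e) = j"
        using nd pos p by (auto simp: prime_elem_multiplicity_mult_distrib not_dvd_imp_multiplicity_0 multiplicity_same_power)
      then have "i = j" using ij by simp
      then show "i = j \<and> d = e" using ij p by auto
    qed
    have im: "(\<lambda>(i, d). p ^ i * d) ` ({..k} \<times> {d. d dvd r}) = {d. d dvd m}"
    proof (intro equalityI subsetI)
      fix x assume "x \<in> (\<lambda>(i, d). p ^ i * d) ` ({..k} \<times> {d. d dvd r})"
      then show "x \<in> {d. d dvd m}" by (auto simp: r intro!: mult_dvd_mono le_imp_power_dvd)
    next
      fix x assume "x \<in> {d. d dvd m}"
      then have "x dvd p ^ k * r" by (simp add: r)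
      then obtain a c where "x = a * c" "a dvd p ^ k" "c dvd r"
        by (rule division_decomp[elim_format]) blast
      moreover obtain i where "i \<le> k" "a = p ^ i"
        using divides_primepow_nat[OF p(1)] calculation by blast
      ultimately show "x \<in> (\<lambda>(i, d). p ^ i * d) ` ({..k} \<times> {d. d dvd r})" by auto
    qed
    have "(\<Sum>d | d dvd m. of_nat d powr w) = (\<Sum>(i,d)\<in>{..k} \<times> {d. d dvd r}. of_nat (p ^ i * d) powr w)"
      unfolding im[symmetric] by (subst sum.reindex[OF inj]) (simp add: o_def case_prod_unfold)
    also have "\<dots> = (\<Sum>(i,d)\<in>{..k} \<times> {d. d dvd r}. z ^ i * of_nat d powr w)"
    proof (rule sum.cong, simp, clarify)
      fix i d assume "d dvd r"
      have "of_nat (p ^ i * d) powr w = of_nat (p ^ i) powr w * of_nat d powr w"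
        by (simp add: powr_times_real del: of_nat_power)
      also have "of_nat (p ^ i) powr w = z ^ i"
      proof -
        have p0: "p > 0" using prime_gt_0_nat[OF p(1)] .
        then have "of_nat (p ^ i) powr w = exp (w * of_real (ln (real (p ^ i))))"
          by (simp add: powr_def Ln_of_nat del: of_nat_power)
        also have "ln (real (p ^ i)) = i * ln (real p)" using p0 by (simp add: ln_realpow)
        finally show ?thesis using p0 by (simp add: z_def powr_def exp_of_nat_mult[symmetric] mult_ac)
      qed
      finally show "of_nat (p ^ i * d) powr w = z ^ i * of_nat d powr w" .
    qed
    also have "\<dots> = (\<Sum>i\<le>k. z ^ i) * (\<Sum>d | d dvd r. of_nat d powr w)"
      by (simp add: sum_product sum.cartesian_product)
    also have "\<dots> \<noteq> 0"
    proof -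
      have "(\<Sum>i\<le>k. z ^ i) * (1 - z) = 1 - z ^ Suc k"
        by (metis mult.commute sum_gp_basic)
      moreover have "norm (z ^ Suc k) > 1"
        unfolding norm_power using zn one_less_power by blast
      then have "z ^ Suc k \<noteq> 1" by auto
      ultimately have "(\<Sum>i\<le>k. z ^ i) \<noteq> 0" by auto
      then show ?thesis using less.IH[OF rm rpos] by simp
    qed
    finally show ?thesis .
  qed
qed

section \<open>Dirichlet series\<close>

text \<open>Mean value estimate on the segment from n to n + 1; the power in the derivative is
  largest at n because -Re s - 1 \<le> 0.\<close>

lemma norm_powr_diff_le:
  fixes s :: complex
  assumes "n > 0" "Re s \<ge> -1"
  shows "norm (of_nat n powr (-s) - of_nat (Suc n) powr (-s)) \<le> norm s * real n powr (- Re s - 1)"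
proof -
  let ?S = "closed_segment (complex_of_real n) (complex_of_real (Suc n))"
  have S: "\<exists>x. z = of_real x \<and> x \<ge> real n" if z: "z \<in> ?S" for z
  proof -
    have "z \<in> \<real> \<and> Re z \<in> closed_segment (real n) (real (Suc n))"
      using z by (subst (asm) closed_segment_same_Im) (auto simp: complex_is_Real_iff)
    then show ?thesis by (intro exI[of _ "Re z"]) (auto simp: closed_segment_eq_real_ivl complex_is_Real_iff complex_eq_iff)
  qed
  have "norm (complex_of_real n powr (-s) - complex_of_real (Suc n) powr (-s)) \<le>
        (norm s * real n powr (- Re s - 1)) * norm (complex_of_real n - complex_of_real (Suc n))"
  proof (rule field_differentiable_bound[where S = ?S and f' = "\<lambda>z. -s * z powr (-s-1)"])
    fix z assume "z \<in> ?S"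
    then obtain x where x: "z = of_real x" "x \<ge> real n" using S by blast
    then have xpos: "x > 0" using assms by simp
    show "((\<lambda>z. z powr - s) has_field_derivative - s * z powr (- s - 1)) (at z within ?S)"
      using x xpos by (auto intro!: derivative_eq_intros simp: complex_nonpos_Reals_iff)
    have "norm (z powr (-s-1)) \<le> real n powr (- Re s - 1)"
      using x xpos assms by (simp add: norm_powr_real_powr powr_mono2')
    then show "norm (- s * z powr (- s - 1)) \<le> norm s * real n powr (- Re s - 1)"
      by (simp add: norm_mult mult_left_mono)
  qed auto
  also have "norm (complex_of_real n - complex_of_real (Suc n)) = 1"
    by simp
  finally show ?thesis by simp
qed

text \<open>Summation by parts: against partial sums O(N^\<theta>) the differences of k^(-s) leave
  terms O(k^(-1-d)), uniformly on bounded parts of Re s \<ge> \<theta> + d. It serves with \<theta>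
  = 1/2 + e for the Moebius function and with \<theta> = 0 for a series known to converge at a
  point.\<close>

lemma dirichlet_series_bounded_partial_sums:
  fixes a :: "nat \<Rightarrow> complex"
  assumes bound: "\<And>N. norm (\<Sum>k<N. a k) \<le> C * real N powr \<theta>" and "\<theta> \<ge> 0"
  shows dirichlet_series_summable: "Re s > \<theta> \<Longrightarrow> summable (\<lambda>k. a k / of_nat (Suc k) powr s)"
    and dirichlet_series_holomorphic:
      "(\<lambda>s. \<Sum>k. a k / of_nat (Suc k) powr s) holomorphic_on {s. Re s > \<theta>}"
proof -
  define A where "A = (\<lambda>N. \<Sum>k<N. a k)"
  define f where "f = (\<lambda>k s. A (Suc k) * (of_nat (Suc k) powr (-s) - of_nat (Suc (Suc k)) powr (-s)))"
  have parts: "(\<Sum>k<N. a k / of_nat (Suc k) powr s) = A N * of_nat (Suc N) powr (-s) + (\<Sum>k<N. f k s)" for N s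
    by (induction N) (simp_all add: A_def f_def algebra_simps powr_minus_divide add_divide_distrib)
  have C: "C \<ge> 0" using order_trans[OF norm_ge_zero bound[of 1]] by simp
  have f_bound: "norm (f k s) \<le> C * R * real (Suc k) powr (- 1 - d)"
    if "Re s \<ge> \<theta> + d" "norm s \<le> R" "d > 0" for k s R d
  proof -
    have "norm (f k s) \<le> (C * real (Suc k) powr \<theta>) * (norm s * real (Suc k) powr (- Re s - 1))"
      unfolding f_def norm_mult using bound[of "Suc k"] that assms(2) C
      by (intro mult_mono norm_powr_diff_le) (auto simp: A_def)
    also have "\<dots> \<le> (C * real (Suc k) powr \<theta>) * (R * real (Suc k) powr (- (\<theta> + d) - 1))"
      using that C by (intro mult_left_mono mult_mono powr_mono) (auto intro: order_trans[OF norm_ge_zero])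
    also have "\<dots> = C * R * real (Suc k) powr (- 1 - d)"
      by (simp add: powr_add[symmetric] algebra_simps flip: powr_add)
    finally show ?thesis .
  qed
  have summ: "summable (\<lambda>k. C * R * real (Suc k) powr (- 1 - d))" if "d > 0" for d R
    using that by (intro summable_mult) (subst summable_Suc_iff, simp add: summable_real_powr_iff)
  have unif: "uniform_limit {s. Re s \<ge> \<theta> + d \<and> norm s \<le> R} (\<lambda>N s. \<Sum>k<N. f k s) (\<lambda>s. \<Sum>k. f k s) sequentially"
    if "d > 0" for d R
    using that by (intro Weierstrass_m_test[OF _ summ[of d R]] f_bound) auto
  have sums: "(\<lambda>k. a k / of_nat (Suc k) powr s) sums (\<Sum>k. f k s)" if s: "Re s > \<theta>" for s
  proof -
    define d where "d = Re s - \<theta>"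
    have d: "d > 0" using s by (simp add: d_def)
    have "(\<lambda>N. \<Sum>k<N. f k s) \<longlonglongrightarrow> (\<Sum>k. f k s)"
      using tendsto_uniform_limitI[OF unif[OF d, of "norm s"], of s] by (simp add: d_def)
    moreover have "(\<lambda>N. A N * of_nat (Suc N) powr (-s)) \<longlonglongrightarrow> 0"
    proof (rule Lim_null_comparison)
      show "\<forall>\<^sub>F N in sequentially. norm (A N * of_nat (Suc N) powr (-s)) \<le> C * real (Suc N) powr (-d)"
      proof (intro always_eventually allI)
        fix N
        have "norm (A N * of_nat (Suc N) powr (-s)) \<le> (C * real (Suc N) powr \<theta>) * real (Suc N) powr (- Re s)"
          unfolding norm_mult
        proof (rule mult_mono)
          have "norm (A N) \<le> C * real N powr \<theta>" using bound[of N] by (simp add: A_def)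
          also have "\<dots> \<le> C * real (Suc N) powr \<theta>" using C assms(2) by (intro mult_left_mono powr_mono2) auto
          finally show "norm (A N) \<le> C * real (Suc N) powr \<theta>" .
          show "norm (complex_of_nat (Suc N) powr - s) \<le> real (Suc N) powr (- Re s)"
            unfolding norm_powr_of_nat by simp
        qed (use C in auto)
        also have "\<dots> = C * real (Suc N) powr (-d)"
          by (simp add: d_def powr_add[symmetric] algebra_simps flip: powr_add)
        finally show "norm (A N * of_nat (Suc N) powr (-s)) \<le> C * real (Suc N) powr (-d)" .
      qed
      have "(\<lambda>N. real (Suc N) powr (-d)) \<longlonglongrightarrow> 0"
        using d by (intro tendsto_Suc_powr_neg) simp
      then show "(\<lambda>N. C * real (Suc N) powr (-d)) \<longlonglongrightarrow> 0"
        by (rule tendsto_mult_right_zero)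
    qed
    ultimately show ?thesis
      unfolding sums_def parts using tendsto_add by fastforce
  qed
  show "Re s > \<theta> \<Longrightarrow> summable (\<lambda>k. a k / of_nat (Suc k) powr s)"
    using sums by (auto simp: summable_def)
  have "(\<lambda>s. \<Sum>k. f k s) holomorphic_on {s. Re s > \<theta>}"
  proof (rule holomorphic_uniform_sequence)
    show "open {s. Re s > \<theta>}" by (rule open_halfspace_Re_gt)
    show "(\<lambda>s. \<Sum>k<N. f k s) holomorphic_on {s. Re s > \<theta>}" for N
      unfolding f_def by (intro holomorphic_intros)
    fix x assume x: "x \<in> {s. Re s > \<theta>}"
    define d where "d = (Re x - \<theta>) / 2"
    have d: "d > 0" using x by (simp add: d_def)
    have sub: "cball x d \<subseteq> {s. Re s \<ge> \<theta> + d \<and> norm s \<le> norm x + d}"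
    proof
      fix s assume "s \<in> cball x d"
      then have n: "norm (x - s) \<le> d" by (simp add: dist_norm)
      have "Re x - Re s \<le> d" using n complex_Re_le_cmod[of "x - s"] by simp
      moreover have "norm s \<le> norm x + d" using norm_triangle_sub[of s x] n by (simp add: norm_minus_commute)
      moreover have "Re x = \<theta> + 2 * d" by (simp add: d_def field_simps)
      ultimately show "s \<in> {s. Re s \<ge> \<theta> + d \<and> norm s \<le> norm x + d}" by simp
    qed
    show "\<exists>d>0. cball x d \<subseteq> {s. Re s > \<theta>} \<and> uniform_limit (cball x d) (\<lambda>N s. \<Sum>k<N. f k s) (\<lambda>s. \<Sum>k. f k s) sequentially"
      using d sub uniform_limit_on_subset[OF unif[OF d] sub] by (intro exI[of _ d]) auto
  qed
  then show "(\<lambda>s. \<Sum>k. a k / of_nat (Suc k) powr s) holomorphic_on {s. Re s > \<theta>}"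
    by (rule holomorphic_transform) (use sums sums_unique in auto)
qed

section \<open>The Euler product and the line \<open>Re s = 1\<close>\<close>

text \<open>Both sides run over the pairs (d, e) with d e \<le> Q, sorted by the product on the left
  and by d on the right.\<close>

lemma sum_divisors_hyperbola:
  fixes h :: "nat \<Rightarrow> nat \<Rightarrow> 'a :: comm_monoid_add"
  shows "(\<Sum>q=1..Q. \<Sum>d | d dvd q. h d (q div d)) = (\<Sum>d=1..Q. \<Sum>e=1..Q div d. h d e)"
proof -
  have "(\<Sum>q=1..Q. \<Sum>d | d dvd q. h d (q div d)) = (\<Sum>(q, d)\<in>(SIGMA q:{1..Q}. {d. d dvd q}). h d (q div d))"
    by (rule sum.Sigma) auto
  also have "\<dots> = (\<Sum>(d, e)\<in>(SIGMA d:{1..Q}. {1..Q div d}). h d e)"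
  proof (rule sum.reindex_bij_witness[where i = "\<lambda>(d, e). (d * e, d)" and j = "\<lambda>(q, d). (d, q div d)"])
    fix a assume "a \<in> (SIGMA q:{1..Q}. {d. d dvd q})"
    then obtain q d where a: "a = (q, d)" "1 \<le> q" "q \<le> Q" "d dvd q" by auto
    then obtain e where e: "q = d * e" by auto
    have "d > 0" "e > 0" using a e by (auto intro: Nat.gr0I)
    moreover from this have "e \<le> Q div d" using div_le_mono[of q Q d] a e by simp
    moreover have "d \<le> Q" using dvd_imp_le[OF a(4)] a by simp
    ultimately show "(case case a of (q, d) \<Rightarrow> (d, q div d) of (d, e) \<Rightarrow> (d * e, d)) = a"
      and "(case a of (q, d) \<Rightarrow> (d, q div d)) \<in> (SIGMA d:{1..Q}. {1..Q div d})"
      by (simp_all add: a(1) e)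
  next
    fix b assume "b \<in> (SIGMA d:{1..Q}. {1..Q div d})"
    then obtain d e where b: "b = (d, e)" "1 \<le> d" "d \<le> Q" "1 \<le> e" "e \<le> Q div d" by auto
    have "d * e \<le> Q" using b by (meson le_trans mult_le_mono2 times_div_less_eq_dividend)
    then show "(case b of (d, e) \<Rightarrow> (d * e, d)) \<in> (SIGMA q:{1..Q}. {d. d dvd q})"
      and "(case case b of (d, e) \<Rightarrow> (d * e, d) of (q, d) \<Rightarrow> (d, q div d)) = b"
      using b by auto
  qed auto
  also have "\<dots> = (\<Sum>d=1..Q. \<Sum>e=1..Q div d. h d e)"
    by (rule sum.Sigma[symmetric]) auto
  finally show ?thesis .
qed

lemma of_nat_powr_mult:
  fixes s :: complex
  shows "of_nat (m * n) powr s = of_nat m powr s * of_nat n powr s"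
  by (simp add: powr_times_real)

lemma filterlim_div_nat: "d > 0 \<Longrightarrow> filterlim (\<lambda>Q::nat. Q div d) at_top at_top"
  unfolding filterlim_at_top
proof
  fix Z assume "d > 0"
  then show "\<forall>\<^sub>F Q in sequentially. Z \<le> Q div d"
    by (intro eventually_sequentiallyI[of "Z * d"]) (metis div_le_mono nonzero_mult_div_cancel_right less_numeral_extra(3))
qed

lemma sum_from_1_eq: "(\<Sum>n=1..N. f n) = (\<Sum>n<N. f (Suc n))"
  by (rule sum.reindex_bij_witness[where i = Suc and j = "\<lambda>n. n - 1"]) auto

lemma summable_Suc_powr: "e > 1 \<Longrightarrow> summable (\<lambda>n. 1 / real (Suc n) powr e)"
  using summable_Suc_iff[of "\<lambda>n. real n powr (-e)"] summable_real_powr_iff[of "-e"]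
  by (simp add: powr_minus_divide)

text \<open>Partial sums of the Dirichlet product of \<open>\<mu>\<close> and the constant function 1
  are grouped by the divisor and passed to the limit by Tannery's theorem.\<close>

lemma moebius_mu_series:
  assumes s: "Re s > 1"
  shows zeta_nonzero_Re_gt_1: "zeta s \<noteq> 0"
    and moebius_mu_sums: "(\<lambda>n. of_int (moebius_mu (Suc n)) / of_nat (Suc n) powr s) sums inverse (zeta s)"
proof -
  define Z where "Z = (\<lambda>N. \<Sum>n=1..N. 1 / of_nat n powr s)"
  define m where "m = (\<lambda>n. complex_of_int (moebius_mu n) / of_nat n powr s)"
  have Zlim: "Z \<longlonglongrightarrow> zeta s"
    using zeta_sums[OF s] unfolding Z_def sum_from_1_eq sums_def .
  then obtain C where C: "\<And>N. norm (Z N) \<le> C" using convergent_imp_Bseq[of Z] BseqE[of Z] by (metis convergentI)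
  have C0: "C \<ge> 0" using C[of 0] norm_ge_zero order_trans by blast
  have mle: "norm (m n) \<le> 1 / real n powr Re s" for n
    unfolding m_def norm_divide norm_powr_of_nat using norm_moebius_mu_le[of n] by (intro divide_right_mono) auto
  have summ: "summable (\<lambda>n. 1 / real (Suc n) powr Re s)"
    by (rule summable_Suc_powr[OF s])
  have m_summable: "summable (\<lambda>n. m (Suc n))"
    by (rule summable_comparison_test'[OF summ]) (rule mle)
  \<comment> \<open>The Dirichlet product of the Moebius function and 1 is the unit, so the identity
    is exact for every finite Q > 0.\<close>
  have one: "(\<Sum>n<Q. m (Suc n) * Z (Q div Suc n)) = 1" if "Q > 0" for Q
  proof -
    have "(\<Sum>n<Q. m (Suc n) * Z (Q div Suc n)) = (\<Sum>d=1..Q. \<Sum>e=1..Q div d. m d * (1 / of_nat e powr s))"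
      unfolding sum_from_1_eq[of _ Q] Z_def sum_distrib_left ..
    also have "\<dots> = (\<Sum>q=1..Q. \<Sum>d | d dvd q. m d * (1 / of_nat (q div d) powr s))"
      by (rule sum_divisors_hyperbola[symmetric])
    also have "\<dots> = (\<Sum>q=1..Q. if q = 1 then 1 else 0)"
    proof (rule sum.cong)
      fix q assume q: "q \<in> {1..Q}"
      have "(\<Sum>d | d dvd q. m d * (1 / of_nat (q div d) powr s)) = (\<Sum>d | d dvd q. of_int (moebius_mu d) / of_nat q powr s)"
      proof (rule sum.cong)
        fix d assume "d \<in> {d. d dvd q}"
        then obtain e where e: "q = d * e" by auto
        then have "d > 0" using q by (auto intro: Nat.gr0I)
        then show "m d * (1 / of_nat (q div d) powr s) = of_int (moebius_mu d) / of_nat q powr s"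
          by (simp add: m_def e of_nat_powr_mult del: of_nat_mult)
      qed simp
      also have "\<dots> = of_int (\<Sum>d | d dvd q. moebius_mu d) / of_nat q powr s"
        by (simp add: sum_divide_distrib)
      also have "\<dots> = (if q = 1 then 1 else 0)"
        using q by (subst sum_moebius_mu_divisors) auto
      finally show "(\<Sum>d | d dvd q. m d * (1 / of_nat (q div d) powr s)) = (if q = 1 then 1 else 0)" .
    qed simp
    also have "\<dots> = 1" using that by simp
    finally show ?thesis .
  qed
  \<comment> \<open>The cutoff turns the finite sums into series in \<open>n\<close> with a common
    majorant; for fixed \<open>n\<close> it disappears as \<open>Q\<close> grows.\<close>
  define a where "a = (\<lambda>n Q. if n < Q then m (Suc n) * Z (Q div Suc n) else 0)"
  have "(\<lambda>Q. \<Sum>n. a n Q) \<longlonglongrightarrow> (\<Sum>n. m (Suc n) * zeta s)"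
  proof (rule tannerys_theorem[THEN conjunct2, THEN conjunct2])
    show "(\<lambda>Q. a n Q) \<longlonglongrightarrow> m (Suc n) * zeta s" for n
    proof (rule Lim_transform_eventually)
      show "(\<lambda>Q. m (Suc n) * Z (Q div Suc n)) \<longlonglongrightarrow> m (Suc n) * zeta s"
        by (intro tendsto_mult tendsto_const filterlim_compose[OF Zlim] filterlim_div_nat) auto
      show "\<forall>\<^sub>F Q in sequentially. m (Suc n) * Z (Q div Suc n) = a n Q"
        using eventually_gt_at_top[of n] by eventually_elim (simp add: a_def)
    qed
    have "norm (a n Q) \<le> C * (1 / real (Suc n) powr Re s)" for n Q
    proof -
      have "norm (m (Suc n) * Z (Q div Suc n)) \<le> (1 / real (Suc n) powr Re s) * C"
        unfolding norm_mult by (intro mult_mono mle C) auto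
      then show ?thesis using C0 by (auto simp: a_def mult.commute)
    qed
    then show "\<forall>\<^sub>F (n, Q) in sequentially \<times>\<^sub>F sequentially. norm (a n Q) \<le> C * (1 / real (Suc n) powr Re s)"
      by (intro always_eventually) auto
    show "summable (\<lambda>n. C * (1 / real (Suc n) powr Re s))"
      by (intro summable_mult summ)
  qed simp
  moreover have "(\<Sum>n. a n Q) = (\<Sum>n<Q. m (Suc n) * Z (Q div Suc n))" for Q
    by (subst suminf_finite[of "{..<Q}"]) (auto simp: a_def)
  then have "\<forall>\<^sub>F Q in sequentially. (\<Sum>n. a n Q) = 1"
    using one by (intro eventually_mono[OF eventually_gt_at_top[of 0]]) simp
  then have "(\<lambda>Q. \<Sum>n. a n Q) \<longlonglongrightarrow> 1" by (rule tendsto_eventually)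
  ultimately have "(\<Sum>n. m (Suc n) * zeta s) = 1" by (rule LIMSEQ_unique)
  then have *: "(\<Sum>n. m (Suc n)) * zeta s = 1" using suminf_mult2[OF m_summable, of "zeta s"] by simp
  then show "zeta s \<noteq> 0" by auto
  have "(\<Sum>n. m (Suc n)) = inverse (zeta s)"
    using * by (metis inverse_unique mult.commute)
  then show "(\<lambda>n. of_int (moebius_mu (Suc n)) / of_nat (Suc n) powr s) sums inverse (zeta s)"
    using summable_sums[OF m_summable] by (simp add: m_def)
qed

section \<open>The Euler product\<close>

lemma zeta_has_sum:
  assumes s: "Re s > 1"
  shows "((\<lambda>n. of_nat n powr (-s)) has_sum zeta s) UNIV"
proof (rule norm_summable_imp_has_sum)
  show "summable (\<lambda>n. norm (complex_of_nat n powr (-s)))"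
    unfolding norm_powr_of_nat using s by (simp add: summable_real_powr_iff)
  have "(\<lambda>n. complex_of_nat (Suc n) powr (-s)) sums zeta s"
    using zeta_sums[OF s] by (simp only: powr_minus_divide)
  \<comment> \<open>The term n = 0 vanishes because \<open>0 powr\<close> is 0, which allows summing
    over all of \<open>UNIV\<close>.\<close>
  then show "(\<lambda>n. complex_of_nat n powr (-s)) sums zeta s"
    unfolding sums_Suc_iff[of "\<lambda>n. complex_of_nat n powr (-s)"] by simp
qed

text \<open>Sieve of Eratosthenes: among the numbers without prime divisors in S, the multiples of a
  new prime p are p times that same set, so removing them multiplies the sum by 1 - p^(-s).\<close>

lemma zeta_sieve:
  assumes s: "Re s > 1" and "finite S" "\<And>p. p \<in> S \<Longrightarrow> prime p"
  shows "((\<lambda>n. of_nat n powr (-s)) has_sum (zeta s * (\<Prod>p\<in>S. 1 - of_nat p powr (-s)))) {n. \<forall>p\<in>S. \<not> p dvd n}"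
  using assms(2,3)
proof (induction S rule: finite_induct)
  case empty
  then show ?case using zeta_has_sum[OF s] by simp
next
  case (insert p S)
  let ?A = "{n. \<forall>p\<in>S. \<not> p dvd n}" and ?V = "zeta s * (\<Prod>p\<in>S. 1 - of_nat p powr (-s))"
  have p: "prime p" "p > 0" using insert.prems by (auto simp: prime_gt_0_nat)
  have IH: "((\<lambda>n. of_nat n powr (-s)) has_sum ?V) ?A" using insert by auto
  have "((\<lambda>n. of_nat n powr (-s)) has_sum (of_nat p powr (-s) * ?V)) ((\<lambda>n. p * n) ` ?A)"
    using p by (subst has_sum_reindex)
      (auto simp: inj_on_def o_def of_nat_powr_mult simp del: of_nat_mult intro!: has_sum_cmult_right IH)
  moreover have "(\<lambda>n. p * n) ` ?A = {n\<in>?A. p dvd n}"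
  proof (intro equalityI subsetI)
    fix n assume n: "n \<in> (\<lambda>n. p * n) ` ?A"
    then obtain k where k: "n = p * k" "k \<in> ?A" by blast
    have "\<not> q dvd n" if "q \<in> S" for q
    proof
      assume "q dvd n"
      have q: "prime q" using insert.prems that by simp
      have "q dvd p \<or> q dvd k" using \<open>q dvd n\<close> k q by (simp add: prime_dvd_mult_iff)
      then have "q = p" using k that primes_dvd_imp_eq[OF q p(1)] by auto
      then show False using that insert.hyps by simp
    qed
    then show "n \<in> {n\<in>?A. p dvd n}" using k by simp
  next
    fix n assume n: "n \<in> {n\<in>?A. p dvd n}"
    then obtain k where "n = p * k" by auto
    moreover from this have "k \<in> ?A" using n by (auto dest: dvd_mult)
    ultimately show "n \<in> (\<lambda>n. p * n) ` ?A" by blast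
  qed
  ultimately have "((\<lambda>n. of_nat n powr (-s)) has_sum (?V - of_nat p powr (-s) * ?V)) (?A - {n\<in>?A. p dvd n})"
    by (intro has_sum_Diff IH) auto
  moreover have "?A - {n\<in>?A. p dvd n} = {n. \<forall>q\<in>insert p S. \<not> q dvd n}" by auto
  moreover have "?V - of_nat p powr (-s) * ?V = zeta s * (\<Prod>q\<in>insert p S. 1 - of_nat q powr (-s))"
    using insert.hyps by (simp add: algebra_simps)
  ultimately show ?case by simp
qed

text \<open>Formulated without an infinite product: after sieving by the primes up to P only 1 and
  numbers larger than P survive, so the distance to 1 is at most a tail of a convergent
  series.\<close>

lemma zeta_euler_product:
  assumes s: "Re s > 1"
  shows "(\<lambda>P. zeta s * (\<Prod>p | prime p \<and> p \<le> P. 1 - of_nat p powr (-s))) \<longlonglongrightarrow> 1"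
proof -
  let ?V = "\<lambda>P. zeta s * (\<Prod>p | prime p \<and> p \<le> P. 1 - of_nat p powr (-s))"
  let ?g = "\<lambda>n. real n powr (- Re s)"
  have summ: "summable ?g" using s by (simp add: summable_real_powr_iff)
  have "(\<lambda>P. ?V P - 1) \<longlonglongrightarrow> 0"
  proof (rule Lim_null_comparison)
    show "(\<lambda>P. \<Sum>k. ?g (k + P)) \<longlonglongrightarrow> 0" by (rule suminf_exist_split2[OF summ])
    show "\<forall>\<^sub>F P in sequentially. norm (?V P - 1) \<le> (\<Sum>k. ?g (k + P))"
      \<comment> \<open>For P \<ge> 2 the number 0 is sieved out as a multiple of 2.\<close>
      using eventually_ge_at_top[of 2]
    proof eventually_elim
      case (elim P)
      let ?S = "{p. prime p \<and> p \<le> P}"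
      let ?A = "{n. \<forall>p\<in>?S. \<not> p dvd n}"
      have 1: "1 \<in> ?A" by (auto dest: prime_gt_1_nat)
      have fin: "finite ?S" by simp
      have "((\<lambda>n. of_nat n powr (-s)) has_sum (?V P - 1)) (?A - {1})"
        using has_sum_Diff[OF zeta_sieve[OF s fin] has_sum_finiteI[of "{1}" 1 "\<lambda>n. complex_of_nat n powr (-s)"]] 1 by simp
      moreover have "((\<lambda>k. ?g (k + P)) has_sum (\<Sum>k. ?g (k + P))) UNIV"
      proof (intro norm_summable_imp_has_sum summable_sums)
        show "summable (\<lambda>k. ?g (k + P))" by (rule summable_ignore_initial_segment[OF summ])
        then show "summable (\<lambda>k. norm (?g (k + P)))" by simp
      qed
      then have hs: "(?g has_sum (\<Sum>k. ?g (k + P))) {P..}"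
        by (subst (asm) has_sum_reindex_bij_witness[where i = "\<lambda>n. n - P" and j = "\<lambda>k. k + P" and T = "{P..}" and h = ?g]) auto
      have sub: "?A - {1} \<subseteq> {P..}"
      proof
        fix n assume n: "n \<in> ?A - {1}"
        then have "n \<noteq> 1" by auto
        then obtain p where p: "prime p" "p dvd n" using prime_factor_nat by blast
        have "\<not> p \<le> P" using n p by auto
        moreover have "\<not> 2 dvd n" using n elim by auto
        then have "n \<noteq> 0" by (intro notI) simp
        ultimately show "n \<in> {P..}" using dvd_imp_le[OF p(2)] by simp
      qed
      have "?g summable_on (?A - {1})"
        using hs sub summable_on_subset_banach has_sum_imp_summable by blast
      then have h2: "(?g has_sum infsum ?g (?A - {1})) (?A - {1})" by simp
      ultimately have "norm (?V P - 1) \<le> infsum ?g (?A - {1})"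
        by (intro norm_has_sum_bound[where f = "\<lambda>n. of_nat n powr (-s)" and A = "?A - {1}"]) (auto simp: norm_powr_of_nat)
      also have "\<dots> \<le> (\<Sum>k. ?g (k + P))"
        by (rule has_sum_mono_neutral[OF h2 hs]) (use sub in auto)
      finally show ?case .
    qed
  qed
  then show ?thesis by (simp add: LIM_zero_iff)
qed

text \<open>The logarithm of the left side is a series with terms -(r^n/n) (3 + 4 cos x + cos 2x),
  where z^n = cis x, and the bracket equals 2 (1 + cos x)^2.\<close>

lemma three_four_one:
  fixes z :: complex and r :: real
  assumes r: "0 \<le> r" "r < 1" and z: "norm z = 1"
  shows "norm (1 - complex_of_real r) ^ 3 * norm (1 - r * z) ^ 4 * norm (1 - r * z\<^sup>2) \<le> 1"
proof -
  have L: "(\<lambda>n. - Re ((r * w) ^ n) / n) sums Re (ln (1 - r * w))" "norm (1 - r * w) = exp (Re (ln (1 - r * w)))"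
    if "norm w = 1" for w :: complex
  proof -
    have n: "norm (- (r * w)) < 1" using that r by (simp add: norm_mult)
    have "(\<lambda>n. Re (- ((- (- (r * w)))^n) / of_nat n)) sums Re (ln (1 + - (r * w)))"
      by (intro sums_Re Ln_series' n)
    then show "(\<lambda>n. - Re ((r * w) ^ n) / n) sums Re (ln (1 - r * w))" by simp
    have "1 - r * w \<noteq> 0" using n by (metis norm_minus_cancel norm_one eq_iff_diff_eq_0 less_irrefl)
    then show "norm (1 - r * w) = exp (Re (ln (1 - r * w)))"
      by (metis exp_Ln norm_exp_eq_Re)
  qed
  have z2: "norm (z\<^sup>2) = 1" using z by (simp add: norm_power)
  let ?l = "\<lambda>w::complex. Re (ln (1 - of_real r * w))"
  have "(\<lambda>n. 3 * (- Re ((r * 1) ^ n) / n) + 4 * (- Re ((r * z) ^ n) / n) + (- Re ((r * z\<^sup>2) ^ n) / n))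
      sums (3 * ?l 1 + 4 * ?l z + ?l (z\<^sup>2))"
    using L(1)[of 1] L(1)[OF z] L(1)[OF z2] by (intro sums_add sums_mult) auto
  moreover have "3 * (- Re ((r * 1) ^ n) / n) + 4 * (- Re ((r * z) ^ n) / n) + (- Re ((r * z\<^sup>2) ^ n) / n) \<le> 0" for n
  proof -
    define u where "u = z ^ n"
    have u: "(Re u)\<^sup>2 + (Im u)\<^sup>2 = 1" using z by (simp add: u_def norm_power flip: cmod_power2)
    have zu: "(z\<^sup>2) ^ n = u\<^sup>2" by (simp add: u_def flip: power_mult add: mult.commute)
    have "3 + 4 * Re u + Re (u\<^sup>2) = 2 * (1 + Re u)\<^sup>2"
      using u by (simp add: power2_eq_square algebra_simps)
    then have "3 + 4 * Re u + Re (u\<^sup>2) \<ge> 0" by simp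
    then have "- (r ^ n / n * (3 + 4 * Re u + Re (u\<^sup>2))) \<le> 0" using r by simp
    also have "- (r ^ n / n * (3 + 4 * Re u + Re (u\<^sup>2))) =
      3 * (- Re ((r * 1) ^ n) / n) + 4 * (- Re ((r * z) ^ n) / n) + (- Re ((r * z\<^sup>2) ^ n) / n)"
      by (simp add: power_mult_distrib zu u_def[symmetric] ring_distribs add_divide_distrib mult_ac del: Re_power2 flip: of_real_power)
    finally show ?thesis .
  qed
  ultimately have "3 * ?l 1 + 4 * ?l z + ?l (z\<^sup>2) \<le> 0"
    by (rule sums_le[rotated, OF _ sums_zero])
  then have "exp (3 * ?l 1 + 4 * ?l z + ?l (z\<^sup>2)) \<le> 1" by simp
  also have "exp (3 * ?l 1 + 4 * ?l z + ?l (z\<^sup>2)) = exp (?l 1) ^ 3 * exp (?l z) ^ 4 * exp (?l (z\<^sup>2))"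
    by (simp add: exp_add exp_of_nat_mult[of 3, simplified] exp_of_nat_mult[of 4, simplified])
  finally show ?thesis using L(2)[of 1] L(2)[OF z] L(2)[OF z2] by simp
qed

text \<open>Every prime satisfies \<open>three_four_one\<close> with r = p^(-x) and z = p^(-it), so
  the sieving products \<open>E\<close> contribute at most 1, while zeta times \<open>E\<close>
  tends to 1.\<close>

lemma zeta_three_four_one:
  assumes x: "x > 1"
  shows "norm (zeta (of_real x)) ^ 3 * norm (zeta (Complex x t)) ^ 4 * norm (zeta (Complex x (2 * t))) \<ge> 1"
proof -
  define E where "E = (\<lambda>s P. \<Prod>p | prime p \<and> p \<le> P. 1 - complex_of_nat p powr (-s))"
  let ?a = "complex_of_real x" and ?b = "Complex x t" and ?c = "Complex x (2 * t)"
  have lim: "(\<lambda>P. norm (zeta s * E s P)) \<longlonglongrightarrow> 1" if "Re s > 1" for s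
    using tendsto_norm[OF zeta_euler_product[OF that]] by (simp add: E_def)
  have "(\<lambda>P. norm (zeta ?a * E ?a P) ^ 3 * norm (zeta ?b * E ?b P) ^ 4 * norm (zeta ?c * E ?c P)) \<longlonglongrightarrow> 1 ^ 3 * 1 ^ 4 * 1"
    using x by (intro tendsto_intros lim) auto
  moreover have "norm (zeta ?a * E ?a P) ^ 3 * norm (zeta ?b * E ?b P) ^ 4 * norm (zeta ?c * E ?c P) \<le>
      norm (zeta ?a) ^ 3 * norm (zeta ?b) ^ 4 * norm (zeta ?c)" for P
  proof -
    have "norm (E ?a P) ^ 3 * norm (E ?b P) ^ 4 * norm (E ?c P) =
       (\<Prod>p | prime p \<and> p \<le> P. norm (1 - complex_of_nat p powr (-?a)) ^ 3 *
         norm (1 - complex_of_nat p powr (-?b)) ^ 4 * norm (1 - complex_of_nat p powr (-?c)))"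
      by (simp add: E_def prod.distrib prod_power_distrib flip: prod_norm)
    also have "\<dots> \<le> 1"
    proof (rule prod_le_1, rule conjI)
      fix p assume "p \<in> {p. prime p \<and> p \<le> P}"
      then have p: "real p > 1" using prime_gt_1_nat by auto
      define r where "r = real p powr (-x)"
      define z where "z = cis (- t * ln p)"
      have r: "0 \<le> r" "r < 1" using p x by (auto simp: r_def powr_less_one)
      have e: "complex_of_nat p powr w = exp (w * of_real (ln p))" for w using p by (simp add: powr_def Ln_of_nat)
      have "complex_of_nat p powr (-?a) = r"
        using p by (simp add: e r_def powr_def flip: exp_of_real)
      moreover have "complex_of_nat p powr (- Complex x y) = r * cis (- y * ln p)" for y
      proof -
        have "- Complex x y * of_real (ln p) = of_real (- x * ln p) + \<i> * of_real (- y * ln p)"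
          by (simp add: complex_eq_iff)
        then have "complex_of_nat p powr (- Complex x y) = of_real (exp (- x * ln p)) * cis (- y * ln p)"
          by (simp only: e exp_add cis_conv_exp exp_of_real)
        also have "exp (- x * ln p) = r" using p by (simp add: r_def powr_def)
        finally show ?thesis .
      qed
      moreover have "cis (- (2 * t) * ln p) = z\<^sup>2"
        by (simp add: z_def Complex.DeMoivre algebra_simps)
      ultimately show "norm (1 - complex_of_nat p powr (-?a)) ^ 3 *
         norm (1 - complex_of_nat p powr (-?b)) ^ 4 * norm (1 - complex_of_nat p powr (-?c)) \<le> 1"
        using three_four_one[OF r, of z] by (simp add: z_def)
    qed auto
    finally have "norm (zeta ?a) ^ 3 * norm (zeta ?b) ^ 4 * norm (zeta ?c) * (norm (E ?a P) ^ 3 * norm (E ?b P) ^ 4 * norm (E ?c P)) \<le>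
      norm (zeta ?a) ^ 3 * norm (zeta ?b) ^ 4 * norm (zeta ?c) * 1"
      by (intro mult_left_mono) auto
    then show ?thesis by (simp add: norm_mult power_mult_distrib mult_ac)
  qed
  ultimately show ?thesis
    by (intro tendsto_upperbound[where F = sequentially]) auto
qed

text \<open>A zero at 1 + it would enter \<open>zeta_three_four_one\<close> with the fourth power,
  against the third power of the pole at 1: for x = 1 + h the product would tend to 0 with h, yet it
  is at least 1.\<close>

lemma zeta_nonzero_Re_eq_1:
  assumes "t \<noteq> 0"
  shows "zeta (Complex 1 t) \<noteq> 0"
proof
  assume zero: "zeta (Complex 1 t) = 0"
  have hol: "zeta holomorphic_on {s. Re s > 0} - {1}"
  proof (rule holomorphic_transform)
    show "(\<lambda>s. zeta_reg s / (s - 1)) holomorphic_on {s. Re s > 0} - {1}"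
      by (intro holomorphic_intros holomorphic_on_subset[OF zeta_reg_holomorphic]) auto
  qed (auto simp: zeta_eq_zeta_reg)
  have op: "open ({s. Re s > 0} - {1})" by (intro open_Diff open_halfspace_Re_gt) auto
  have dir: "filterlim (\<lambda>h. Complex (1 + h) y) (at (Complex 1 y)) (at_right 0)" for y
  proof -
    have "((\<lambda>h. Complex 1 y + of_real h) \<longlongrightarrow> Complex 1 y + of_real 0) (at_right 0)"
      by (intro tendsto_intros)
    moreover have "Complex 1 y + of_real h = Complex (1 + h) y" for h by (simp add: complex_eq_iff)
    ultimately show ?thesis
      by (auto simp: filterlim_at eventually_at_filter complex_eq_iff)
  qed
  have tz: "((\<lambda>h. zeta (Complex (1 + h) (2 * t))) \<longlongrightarrow> zeta (Complex 1 (2 * t))) (at_right 0)"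
  proof -
    have "Complex 1 (2 * t) \<in> {s. Re s > 0} - {1}" using assms by (auto simp: complex_eq_iff)
    then have "isCont zeta (Complex 1 (2 * t))"
      using continuous_on_interior[OF holomorphic_on_imp_continuous_on[OF hol]] interior_open[OF op] by blast
    then show ?thesis using dir[of "2 * t"] by (auto simp: isCont_def intro: filterlim_compose)
  qed
  have "Complex 1 t \<in> {s. Re s > 0} - {1}" using assms by (auto simp: complex_eq_iff)
  then obtain D where "(zeta has_field_derivative D) (at (Complex 1 t))"
    using hol op by (meson holomorphic_on_imp_differentiable_at field_differentiable_def)
  then have "((\<lambda>s. (zeta s - zeta (Complex 1 t)) / (s - Complex 1 t)) \<longlongrightarrow> D) (at (Complex 1 t))"
    by (simp add: has_field_derivative_iff)
  then have "((\<lambda>h. (zeta (Complex (1 + h) t) - zeta (Complex 1 t)) / (Complex (1 + h) t - Complex 1 t)) \<longlongrightarrow> D) (at_right 0)"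
    by (rule filterlim_compose[OF _ dir])
  moreover have "Complex (1 + h) t - Complex 1 t = of_real h" for h by (simp add: complex_eq_iff)
  ultimately have td: "((\<lambda>h. zeta (Complex (1 + h) t) / of_real h) \<longlongrightarrow> D) (at_right 0)"
    using zero by simp
  have tr: "((\<lambda>h. zeta_reg (Complex (1 + h) 0)) \<longlongrightarrow> zeta_reg (Complex 1 0)) (at_right 0)"
  proof -
    have "isCont zeta_reg (Complex 1 0)"
      using continuous_on_interior[OF holomorphic_on_imp_continuous_on[OF zeta_reg_holomorphic]]
        interior_open[OF open_halfspace_Re_gt[of 0]] by force
    then show ?thesis using dir[of 0] by (auto simp: isCont_def intro: filterlim_compose)
  qed
  have th: "((\<lambda>h::real. h) \<longlongrightarrow> 0) (at_right 0)" by (intro tendsto_intros)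
  \<comment> \<open>h^4 from the assumed zero and h^(-3) from zeta(1 + h) = zeta_reg(1 + h)/h leave
    one factor h; zeta(1 + h + 2it) has a finite limit because t \<noteq> 0.\<close>
  have "((\<lambda>h. norm (zeta_reg (Complex (1 + h) 0)) ^ 3 * norm (zeta (Complex (1 + h) t) / of_real h) ^ 4 * h *
     norm (zeta (Complex (1 + h) (2 * t)))) \<longlongrightarrow>
     norm (zeta_reg (Complex 1 0)) ^ 3 * norm D ^ 4 * 0 * norm (zeta (Complex 1 (2 * t)))) (at_right 0)"
    by (intro tendsto_intros td tr tz th)
  moreover have "\<forall>\<^sub>F h in at_right 0. 1 \<le> norm (zeta_reg (Complex (1 + h) 0)) ^ 3 * norm (zeta (Complex (1 + h) t) / of_real h) ^ 4 * h *
     norm (zeta (Complex (1 + h) (2 * t)))"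
  proof (rule eventually_at_rightI[of 0 1])
    fix h :: real assume "h \<in> {0<..<1}"
    then have h: "h > 0" by simp
    have "complex_of_real (1 + h) = Complex (1 + h) 0" "Complex (1 + h) 0 - 1 = of_real h" "Complex (1 + h) 0 \<noteq> 1"
      using h by (simp_all add: complex_eq_iff)
    then have "zeta (of_real (1 + h)) = zeta_reg (Complex (1 + h) 0) / h"
      by (metis zeta_eq_zeta_reg)
    then have "norm (zeta (of_real (1 + h))) ^ 3 = norm (zeta_reg (Complex (1 + h) 0)) ^ 3 / h ^ 3"
      using h by (simp add: norm_divide power_divide)
    then have "norm (zeta_reg (Complex (1 + h) 0)) ^ 3 / h ^ 3 * norm (zeta (Complex (1 + h) t)) ^ 4 *
        norm (zeta (Complex (1 + h) (2 * t))) \<ge> 1"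
      using zeta_three_four_one[of "1 + h" t] h by simp
    also have "norm (zeta_reg (Complex (1 + h) 0)) ^ 3 / h ^ 3 * norm (zeta (Complex (1 + h) t)) ^ 4 *
        norm (zeta (Complex (1 + h) (2 * t))) = norm (zeta_reg (Complex (1 + h) 0)) ^ 3 *
        norm (zeta (Complex (1 + h) t) / of_real h) ^ 4 * h * norm (zeta (Complex (1 + h) (2 * t)))"
      using h by (simp add: norm_divide power_divide eval_nat_numeral)
    finally show "1 \<le> norm (zeta_reg (Complex (1 + h) 0)) ^ 3 * norm (zeta (Complex (1 + h) t) / of_real h) ^ 4 * h *
     norm (zeta (Complex (1 + h) (2 * t)))" .
  qed simp
  ultimately have "1 \<le> norm (zeta_reg (Complex 1 0)) ^ 3 * norm D ^ 4 * 0 * norm (zeta (Complex 1 (2 * t)))"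
    by (intro tendsto_lowerbound[where F = "at_right 0"]) auto
  then show False by simp
qed

section \<open>Growth of \<open>1/\<zeta>\<close> under the Riemann hypothesis\<close>

text \<open>The map h / (2A - h) sends the half-plane Re h < A into the unit disc and fixes 0, so
  Schwarz's lemma applies after rescaling the disc; solving back for h gives the bound.\<close>

lemma borel_caratheodory:
  fixes g :: "complex \<Rightarrow> complex"
  assumes hol: "g holomorphic_on ball c R" and "g c = 0"
    and A: "\<And>z. z \<in> ball c R \<Longrightarrow> Re (g z) < A" and z: "norm (z - c) \<le> r" "r < R"
  shows "norm (g z) \<le> 2 * A * r / (R - r)"
proof -
  have r: "r \<ge> 0" using z norm_ge_zero order_trans by blast
  then have R: "R > 0" using z by simp
  have Apos: "A > 0" using A[of c] assms(2) R by simp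
  define h where "h = (\<lambda>w::complex. g (c + R * w))"
  define \<phi> where "\<phi> = (\<lambda>w. h w / (2 * A - h w))"
  have mem: "c + R * w \<in> ball c R" if "w \<in> ball 0 1" for w :: complex
    using that R by (simp add: dist_norm norm_mult)
  have Re_h: "Re (h w) < A" if "w \<in> ball 0 1" for w
    unfolding h_def by (rule A[OF mem[OF that]])
  have ne: "2 * of_real A - h w \<noteq> 0" if "w \<in> ball 0 1" for w
    using Re_h[OF that] Apos by (auto simp: complex_eq_iff)
  have h_hol: "h holomorphic_on ball 0 1"
    unfolding h_def using mem
    by (intro holomorphic_on_compose_gen[OF _ hol, unfolded o_def] holomorphic_intros) auto
  have phi_hol: "\<phi> holomorphic_on ball 0 1"
    unfolding \<phi>_def using ne by (intro holomorphic_intros h_hol) auto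
  have lt: "norm (h w) < norm (2 * of_real A - h w)" if "w \<in> ball 0 1" for w
  proof -
    have "(norm (h w))\<^sup>2 < (norm (2 * of_real A - h w))\<^sup>2"
      using Re_h[OF that] Apos unfolding cmod_power2 by (simp add: power2_eq_square algebra_simps)
    then show ?thesis by (rule power2_less_imp_less) simp
  qed
  define w where "w = (z - c) / R"
  have w: "norm w \<le> r / R" "norm w < 1"
    using z R by (auto simp: w_def norm_divide divide_right_mono field_simps)
  have "norm (\<phi> w) \<le> norm w"
  proof (rule Schwarz_Lemma(1)[OF phi_hol])
    show "\<phi> 0 = 0" by (simp add: \<phi>_def h_def assms(2))
    show "norm (\<phi> v) < 1" if "norm v < 1" for v
      using lt[of v] ne[of v] that by (simp add: \<phi>_def norm_divide field_simps)
  qed (use w in auto)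
  then have phi: "norm (\<phi> w) \<le> r / R" using w by simp
  have hw: "h w = g z" using R by (simp add: h_def w_def)
  have e: "h w * (1 + \<phi> w) = 2 * A * \<phi> w"
  proof -
    have d: "2 * complex_of_real A - h w \<noteq> 0" using ne[of w] w by simp
    then have "1 + \<phi> w = 2 * A / (2 * A - h w)" by (simp add: \<phi>_def add_divide_eq_iff)
    then show ?thesis by (simp add: \<phi>_def)
  qed
  have "norm (h w) * (1 - r / R) \<le> norm (h w) * norm (1 + \<phi> w)"
  proof (rule mult_left_mono)
    show "1 - r / R \<le> norm (1 + \<phi> w)"
      using phi norm_triangle_ineq2[of 1 "- \<phi> w"] by simp
  qed simp
  also have "\<dots> = 2 * A * norm (\<phi> w)"
    using arg_cong[OF e, of norm] Apos by (simp add: norm_mult)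
  also have "\<dots> \<le> 2 * A * (r / R)" using phi Apos by (intro mult_left_mono) auto
  finally have "norm (g z) * (1 - r / R) * R \<le> 2 * A * (r / R) * R"
    unfolding hw using R by (intro mult_right_mono) auto
  moreover have "(1 - r / R) * R = R - r" "r / R * R = r" using R by (simp_all add: left_diff_distrib)
  ultimately have "norm (g z) * (R - r) \<le> 2 * A * r" by (simp only: mult.assoc)
  then show ?thesis using z by (simp add: field_simps)
qed

text \<open>A weak form of the three circles theorem: a bound that holds on a small disc makes the
  dependence on the bound \<open>L\<close> for a large disc arbitrarily small in between. The first
  Taylor coefficients are estimated on the small disc and the others on the large one.\<close>

lemma interpolated_bound:
  fixes r0 r R B \<epsilon> :: real
  assumes "0 < r0" "0 < r" "r < R" "r0 < R" "\<epsilon> > 0" "B \<ge> 0"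
  obtains K where "K \<ge> 0" and
    "\<And>(g :: complex \<Rightarrow> complex) c S L z. g holomorphic_on ball c S \<Longrightarrow> R < S \<Longrightarrow>
       (\<And>z. norm (z - c) \<le> r0 \<Longrightarrow> norm (g z) \<le> B) \<Longrightarrow>
       (\<And>z. norm (z - c) \<le> R \<Longrightarrow> norm (g z) \<le> L) \<Longrightarrow> norm (z - c) \<le> r \<Longrightarrow>
       norm (g z) \<le> K + \<epsilon> * L"
proof -
  define x where "x = r / R"
  have x: "0 < x" "x < 1" using assms by (auto simp: x_def)
  have "(\<lambda>n. x ^ n) \<longlonglongrightarrow> 0" using x by (intro LIMSEQ_realpow_zero) auto
  then have "\<forall>\<^sub>F n in sequentially. x ^ n < \<epsilon> * (1 - x)"
    using assms x by (intro order_tendstoD) auto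
  \<comment> \<open>This makes the tail x^N / (1 - x) of the geometric series smaller than
    \<epsilon>.\<close>
  then obtain N where N: "x ^ N < \<epsilon> * (1 - x)"
    by (auto simp: eventually_sequentially)
  \<comment> \<open>\<open>r / r0\<close> may exceed 1, but \<open>N\<close> depends only on
    \<open>x\<close> and \<epsilon>, so \<open>K\<close> is independent of the function, the centre
    and \<open>L\<close>.\<close>
  define K where "K = (\<Sum>n<N. B * (r / r0) ^ n)"
  show ?thesis
  proof (rule that)
    show "K \<ge> 0" unfolding K_def using assms by (intro sum_nonneg) auto
    fix g :: "complex \<Rightarrow> complex" and c S L z
    assume hol: "g holomorphic_on ball c S" and S: "R < S"
      and g1: "\<And>z. norm (z - c) \<le> r0 \<Longrightarrow> norm (g z) \<le> B"
      and g2: "\<And>z. norm (z - c) \<le> R \<Longrightarrow> norm (g z) \<le> L" and z: "norm (z - c) \<le> r"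
    have L: "L \<ge> 0" using g2[of c] assms by (auto intro: order_trans[OF norm_ge_zero])
    define a where "a = (\<lambda>n. (deriv ^^ n) g c / fact n)"
    have coeff: "norm (a n) \<le> M / \<rho> ^ n"
      if "0 < \<rho>" "\<rho> < S" "\<And>z. norm (z - c) \<le> \<rho> \<Longrightarrow> norm (g z) \<le> M" for n \<rho> M
    proof -
      have "norm ((deriv ^^ n) g c) \<le> fact n * M / \<rho> ^ n"
      proof (rule Cauchy_inequality)
        have sub: "ball c \<rho> \<subseteq> ball c S" "cball c \<rho> \<subseteq> ball c S" using that by auto
        show "g holomorphic_on ball c \<rho>" "continuous_on (cball c \<rho>) g"
          using holomorphic_on_subset[OF hol sub(1)] holomorphic_on_subset[OF hol sub(2)]
          by (auto intro: holomorphic_on_imp_continuous_on)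
      qed (use that in \<open>auto simp: norm_minus_commute\<close>)
      then show ?thesis by (simp add: a_def norm_divide field_simps)
    qed
    have zS: "z \<in> ball c S" using z assms S by (simp add: dist_norm norm_minus_commute)
    have sums: "(\<lambda>n. a n * (z - c) ^ n) sums g z"
      unfolding a_def by (rule holomorphic_power_series[OF hol zS])
    have zn: "norm (z - c) ^ n \<le> r ^ n" for n using z by (intro power_mono) auto
    have t1: "norm (a n * (z - c) ^ n) \<le> B * (r / r0) ^ n" for n
    proof -
      have "norm (a n * (z - c) ^ n) \<le> (B / r0 ^ n) * r ^ n"
        unfolding norm_mult norm_power
        using coeff[of r0 B n] assms S g1 zn[of n] by (intro mult_mono) auto
      then show ?thesis by (simp add: power_divide)
    qed
    have t2: "norm (a n * (z - c) ^ n) \<le> L * x ^ n" for n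
    proof -
      have "norm (a n * (z - c) ^ n) \<le> (L / R ^ n) * r ^ n"
        unfolding norm_mult norm_power
        using coeff[of R L n] assms S g2 zn[of n] L by (intro mult_mono) auto
      then show ?thesis by (simp add: power_divide x_def)
    qed
    have "(\<lambda>n. a (n + N) * (z - c) ^ (n + N)) sums (g z - (\<Sum>n<N. a n * (z - c) ^ n))"
      using sums by (subst sums_iff_shift) simp
    moreover have "(\<lambda>n. L * x ^ N * x ^ n) sums (L * x ^ N * (1 / (1 - x)))"
      using x by (intro sums_mult geometric_sums) auto
    ultimately have "norm (g z - (\<Sum>n<N. a n * (z - c) ^ n)) \<le> L * x ^ N * (1 / (1 - x))"
    proof (rule norm_sums_le)
      show "norm (a (n + N) * (z - c) ^ (n + N)) \<le> L * x ^ N * x ^ n" for n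
        using t2[of "n + N"] by (simp add: power_add mult_ac)
    qed
    also have "\<dots> = L * (x ^ N / (1 - x))" by simp
    also have "\<dots> \<le> L * \<epsilon>"
      using N x L by (intro mult_left_mono) (auto simp: field_simps)
    finally have "norm (g z - (\<Sum>n<N. a n * (z - c) ^ n)) \<le> L * \<epsilon>" .
    moreover have "norm (\<Sum>n<N. a n * (z - c) ^ n) \<le> K"
      unfolding K_def by (intro sum_norm_le t1)
    ultimately show "norm (g z) \<le> K + \<epsilon> * L"
      using norm_triangle_sub[of "g z" "\<Sum>n<N. a n * (z - c) ^ n"] by (simp add: mult.commute)
  qed
qed

section \<open>Littlewood's bound for 1/zeta\<close>

lemma zeta_bounded_Re_ge:
  assumes "\<sigma> > 1"
  obtains B where "B \<ge> 1" "\<And>s. Re s \<ge> \<sigma> \<Longrightarrow> norm (zeta s) \<le> B" "\<And>s. Re s \<ge> \<sigma> \<Longrightarrow> norm (inverse (zeta s)) \<le> B"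
proof
  define B where "B = (\<Sum>n. 1 / real (Suc n) powr \<sigma>)"
  have sums: "(\<lambda>n. 1 / real (Suc n) powr \<sigma>) sums B"
    unfolding B_def by (intro summable_sums summable_Suc_powr assms)
  have "(\<Sum>n<1. 1 / real (Suc n) powr \<sigma>) \<le> B"
    unfolding B_def by (intro sum_le_suminf summable_Suc_powr assms) auto
  then show "B \<ge> 1" by simp
  have le: "1 / real (Suc n) powr Re s \<le> 1 / real (Suc n) powr \<sigma>" if "Re s \<ge> \<sigma>" for n s
    using that by (intro divide_left_mono powr_mono) auto
  fix s assume s: "Re s \<ge> \<sigma>"
  then have s1: "Re s > 1" using assms by simp
  show "norm (zeta s) \<le> B"
    using norm_sums_le[OF zeta_sums[OF s1] sums] le[OF s] by (simp only: norm_divide norm_powr_of_nat norm_one)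
  have "norm (of_int (moebius_mu (Suc n)) / of_nat (Suc n) powr s) \<le> 1 / real (Suc n) powr \<sigma>" for n
  proof -
    have "norm (of_int (moebius_mu (Suc n)) / of_nat (Suc n) powr s) \<le> 1 / real (Suc n) powr Re s"
      unfolding norm_divide norm_powr_of_nat using norm_moebius_mu_le[of "Suc n"] by (intro divide_right_mono) auto
    then show ?thesis using le[OF s, of n] by simp
  qed
  then show "norm (inverse (zeta s)) \<le> B"
    by (rule norm_sums_le[OF moebius_mu_sums[OF s1] sums])
qed

lemma zeta_reg_nonzero_Re_ge_1:
  assumes "Re s \<ge> 1"
  shows "zeta_reg s \<noteq> 0"
proof (cases "s = 1")
  case False
  have "zeta s \<noteq> 0"
  proof (cases "Re s = 1")
    case True
    then have "s = Complex 1 (Im s)" by (simp add: complex_eq_iff)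
    moreover have "Im s \<noteq> 0" using True False by (auto simp: complex_eq_iff)
    ultimately show ?thesis using zeta_nonzero_Re_eq_1 by metis
  qed (use assms zeta_nonzero_Re_gt_1 in auto)
  then show ?thesis using zeta_eq_zeta_reg[OF False] by auto
qed simp

lemma zeta_reg_nonzero_RH:
  assumes "riemann_hypothesis" "Re s > 1/2"
  shows "zeta_reg s \<noteq> 0"
proof (cases "Re s \<ge> 1")
  case False
  then have "0 < Re s" "Re s < 1" "Re s \<noteq> 1/2" "s \<noteq> 1" using assms(2) by auto
  moreover from this have "zeta s \<noteq> 0" using assms(1) unfolding riemann_hypothesis_def by blast
  ultimately show ?thesis using zeta_eq_zeta_reg[of s] by auto
qed (rule zeta_reg_nonzero_Re_ge_1)

text \<open>\<open>(s - 1) / zeta_reg s\<close> is 1/zeta with the value 0 at s = 1, so the pole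
  needs no exception. The strip up to Re s = 2 contains the region swept by the later contour
  shift.\<close>

lemma inverse_zeta_growth_RH:
  assumes RH: "riemann_hypothesis" and d: "0 < \<delta>" "\<delta> < 1/2" and eps: "\<epsilon> > 0"
  obtains C where "\<And>s. 1/2 + \<delta> \<le> Re s \<Longrightarrow> Re s \<le> 2 \<Longrightarrow>
    norm ((s - 1) / zeta_reg s) \<le> C * (2 + \<bar>Im s\<bar>) powr \<epsilon>"
proof -
  \<comment> \<open>5/4 = 2 - 3/4: the disc of radius 3/4 about \<open>c\<close> lies where both
    \<open>zeta\<close> and its inverse are bounded.\<close>
  obtain B where B: "B \<ge> 1" "\<And>s. Re s \<ge> 5/4 \<Longrightarrow> norm (zeta s) \<le> B"
    "\<And>s. Re s \<ge> 5/4 \<Longrightarrow> norm (inverse (zeta s)) \<le> B"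
    using zeta_bounded_Re_ge[of "5/4"] by auto
  define A1 where "A1 = ln (2 * B\<^sup>2) + 1"
  have "B\<^sup>2 \<ge> 1" using B(1) by simp
  then have A1: "A1 > 0" unfolding A1_def by (intro add_nonneg_pos ln_ge_zero) auto
  \<comment> \<open>The disc of radius \<open>r\<close> about \<open>c\<close> just reaches Re s =
    1/2 + \<delta>; \<open>R\<close> lies halfway between \<open>r\<close> and 3/2.\<close>
  define r where "r = 3/2 - \<delta>"
  define R where "R = 3/2 - \<delta>/2"
  \<comment> \<open>\<epsilon> * \<delta> / 12 times the later bound 6 * A2 / \<delta> is \<epsilon>
    * A2 / 2; since \<open>A2\<close> contains 2 * ln \<tau>, this leaves \<epsilon> * ln
    \<tau>.\<close>
  obtain K where K: "K \<ge> 0" "\<And>(g :: complex \<Rightarrow> complex) c S L z. g holomorphic_on ball c S \<Longrightarrow> R < S \<Longrightarrow>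
       (\<And>z. norm (z - c) \<le> 1/2 \<Longrightarrow> norm (g z) \<le> 4 * A1) \<Longrightarrow>
       (\<And>z. norm (z - c) \<le> R \<Longrightarrow> norm (g z) \<le> L) \<Longrightarrow> norm (z - c) \<le> r \<Longrightarrow>
       norm (g z) \<le> K + (\<epsilon> * \<delta> / 12) * L"
    by (rule interpolated_bound[of "1/2" r R "\<epsilon> * \<delta> / 12" "4 * A1"])
       (use d eps A1 in \<open>auto simp: r_def R_def\<close>)
  define K1 where "K1 = K + \<epsilon> / 2 * (ln (9 * B) + 1)"
  have "norm ((s - 1) / zeta_reg s) \<le> B * exp K1 * (2 + \<bar>Im s\<bar>) powr \<epsilon>"
    if s: "1/2 + \<delta> \<le> Re s" "Re s \<le> 2" for s
  proof -
    define t where "t = Im s"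
    define c where "c = Complex 2 t"
    define \<tau> where "\<tau> = 2 + \<bar>t\<bar>"
    have tau: "\<tau> \<ge> 2" by (simp add: \<tau>_def)
    have c1: "norm (c - 1) \<ge> 1" using abs_Re_le_cmod[of "c - 1"] by (simp add: c_def)
    have "c \<noteq> 1" by (auto simp: c_def complex_eq_iff)
    have zc: "zeta_reg c = zeta c * (c - 1)" using zeta_eq_zeta_reg[OF \<open>c \<noteq> 1\<close>] \<open>c \<noteq> 1\<close> by simp
    have Bc: "norm (inverse (zeta c)) \<le> B" by (rule B(3)) (simp add: c_def)
    have Re_ball: "Re z > 2 - \<rho>" if "z \<in> ball c \<rho>" for z \<rho>
    proof -
      have "\<bar>Re (c - z)\<bar> < \<rho>" using that abs_Re_le_cmod[of "c - z"] by (simp add: dist_norm)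
      then show ?thesis by (simp add: c_def)
    qed
    have sub: "ball c (3/2) \<subseteq> {s. Re s > 0}"
    proof
      fix z assume "z \<in> ball c (3/2)"
      from Re_ball[OF this] show "z \<in> {s. Re s > 0}" by simp
    qed
    have nz: "zeta_reg z \<noteq> 0" if "z \<in> ball c (3/2)" for z
      using zeta_reg_nonzero_RH[OF RH] Re_ball[OF that] by simp
    have nzc: "zeta_reg c \<noteq> 0" by (rule nz) simp
    \<comment> \<open>Normalised to 1 at \<open>c\<close>, so that the logarithm can be chosen to
      vanish there. It exists because the disc is convex and, under the hypothesis, free of
      zeros.\<close>
    define W where "W = (\<lambda>z. zeta_reg z / zeta_reg c)"
    have W_hol: "W holomorphic_on ball c (3/2)"
      unfolding W_def using nzc by (intro holomorphic_intros holomorphic_on_subset[OF zeta_reg_holomorphic sub])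
    have W_nz: "W z \<noteq> 0" if "z \<in> ball c (3/2)" for z using nz[OF that] nzc by (simp add: W_def)
    obtain g0 where g0: "g0 holomorphic_on ball c (3/2)" "\<And>z. z \<in> ball c (3/2) \<Longrightarrow> exp (g0 z) = W z"
      using holomorphic_logarithm_exists[OF convex_ball open_ball W_hol W_nz, of c] by auto
    define g where "g = (\<lambda>z. g0 z - g0 c)"
    have g_hol: "g holomorphic_on ball c (3/2)" unfolding g_def by (intro holomorphic_intros g0)
    have gc: "g c = 0" by (simp add: g_def)
    have exp_g: "exp (g z) = W z" if "z \<in> ball c (3/2)" for z
      using g0(2)[OF that] g0(2)[of c] nzc by (simp add: g_def exp_diff W_def)
    have Re_g: "Re (g z) = ln (norm (W z))" if "z \<in> ball c (3/2)" for z
      using exp_g[OF that] by (metis norm_exp_eq_Re ln_exp)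
    have small: "norm (g z) \<le> 4 * A1" if "norm (z - c) \<le> 1/2" for z
    proof -
      \<comment> \<open>The factor 4 in the claim is 2 * (1/2) / (3/4 - 1/2).\<close>
      have "norm (g z) \<le> 2 * A1 * (1/2) / (3/4 - 1/2)"
      proof (rule borel_caratheodory[where g = g and c = c, OF _ gc])
        show "g holomorphic_on ball c (3/4)" by (rule holomorphic_on_subset[OF g_hol]) auto
        fix w assume w: "w \<in> ball c (3/4)"
        then have w': "w \<in> ball c (3/2)" by simp
        have Rew: "Re w > 5/4" using Re_ball[OF w] by simp
        then have "w \<noteq> 1" by auto
        have "norm (w - 1) \<le> norm (c - 1) + 3/4"
          using norm_triangle_ineq[of "w - c" "c - 1"] w by (simp add: dist_norm norm_minus_commute)
        also have "\<dots> \<le> 2 * norm (c - 1)" using c1 by simp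
        finally have w1: "norm (w - 1) \<le> 2 * norm (c - 1)" .
        have q: "norm ((w - 1) / (c - 1)) \<le> 2" using w1 \<open>c \<noteq> 1\<close> by (simp add: norm_divide divide_le_eq)
        have "W w = zeta w * inverse (zeta c) * ((w - 1) / (c - 1))"
          using zeta_eq_zeta_reg[OF \<open>w \<noteq> 1\<close>] \<open>w \<noteq> 1\<close> by (simp add: W_def zc field_simps)
        also have "norm \<dots> \<le> B * B * 2"
          unfolding norm_mult using B(1) B(2)[of w] Bc Rew q
          by (intro mult_mono) (auto simp only: norm_ge_zero mult_nonneg_nonneg norm_mult[symmetric])
        finally have "norm (W w) \<le> 2 * B\<^sup>2" by (simp add: power2_eq_square)
        then have "ln (norm (W w)) \<le> ln (2 * B\<^sup>2)"
          using W_nz[OF w'] B(1) by (subst ln_le_cancel_iff) auto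
        then show "Re (g w) < A1" using Re_g[OF w'] by (simp add: A1_def)
      qed (use that in auto)
      then show ?thesis by simp
    qed
    \<comment> \<open>The logarithm of the bound 9 B \<tau>^2 for |W| on the large disc; the added 1
      makes the inequality strict.\<close>
    define A2 where "A2 = ln (9 * B) + 2 * ln \<tau> + 1"
    have A2: "A2 > 0" unfolding A2_def using B(1) tau by (intro add_nonneg_pos add_nonneg_nonneg) auto
    have large: "norm (g z) \<le> 6 * A2 / \<delta>" if z: "norm (z - c) \<le> R" for z
    proof -
      have "norm (g z) \<le> 2 * A2 * R / (3/2 - R)"
      proof (rule borel_caratheodory[where g = g and c = c, OF g_hol gc])
        fix w assume w: "w \<in> ball c (3/2)"
        have Rew: "Re w > 1/2" using Re_ball[OF w] by simp
        have wc: "norm (w - c) \<le> 3/2" using w by (simp add: dist_norm norm_minus_commute)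
        have nc: "norm c \<le> 2 + \<bar>t\<bar>" "norm (c - 1) \<le> 1 + \<bar>t\<bar>"
          using cmod_le[of c] cmod_le[of "c - 1"] by (auto simp: c_def)
        have w1: "norm w \<le> 2 * \<tau>" "norm (w - 1) \<le> 2 * \<tau>"
          using norm_triangle_ineq[of "w - c" c] norm_triangle_ineq[of "w - c" "c - 1"] wc nc
          by (auto simp: \<tau>_def)
        have "norm w * norm (w - 1) / Re w \<le> (2 * \<tau>) * (2 * \<tau>) / (1/2)"
          using w1 Rew tau by (intro frac_le mult_mono) auto
        then have "norm (zeta_reg w) \<le> 2 * \<tau> + 8 * \<tau>\<^sup>2"
          using norm_zeta_reg_le[of w] Rew w1(1) by (simp add: power2_eq_square)
        also have "\<dots> \<le> 9 * \<tau>\<^sup>2" using tau mult_right_mono[OF tau, of \<tau>] by (simp add: power2_eq_square)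
        finally have zw: "norm (zeta_reg w) \<le> 9 * \<tau>\<^sup>2" .
        have "norm (inverse (zeta_reg c)) \<le> B * 1"
          unfolding zc inverse_mult_distrib norm_mult using c1 B(1)
          by (intro mult_mono Bc) (auto simp: norm_inverse inverse_le_1_iff)
        then have "norm (W w) \<le> 9 * \<tau>\<^sup>2 * B"
          unfolding W_def divide_inverse norm_mult using zw by (intro mult_mono) auto
        then have "ln (norm (W w)) \<le> ln (9 * \<tau>\<^sup>2 * B)"
          using W_nz[OF w] B(1) tau by (subst ln_le_cancel_iff) auto
        also have "\<dots> = ln (9 * B) + 2 * ln \<tau>"
          using B(1) tau by (simp add: ln_mult ln_realpow)
        finally show "Re (g w) < A2" using Re_g[OF w] by (simp add: A2_def)
      qed (use z d in \<open>auto simp: R_def\<close>)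
      also have "2 * A2 * R / (3/2 - R) = (4 * R) * A2 / \<delta>" using d by (simp add: R_def field_simps)
      also have "\<dots> \<le> 6 * A2 / \<delta>"
        using A2 d by (intro divide_right_mono mult_right_mono) (auto simp: R_def)
      finally show ?thesis .
    qed
    have sc: "s - c = of_real (Re s - 2)" by (simp add: c_def t_def complex_eq_iff)
    then have sr: "norm (s - c) \<le> r" using s by (simp add: r_def norm_of_real del: of_real_diff)
    have "norm (g s) \<le> K + (\<epsilon> * \<delta> / 12) * (6 * A2 / \<delta>)"
      by (rule K(2)[OF g_hol _ small large sr]) (use d in \<open>auto simp: R_def\<close>)
    also have "\<dots> = K1 + \<epsilon> * ln \<tau>"
      using d by (simp add: K1_def A2_def field_simps)
    finally have gs: "norm (g s) \<le> K1 + \<epsilon> * ln \<tau>" .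
    have sball: "s \<in> ball c (3/2)" using sr d by (simp add: dist_norm norm_minus_commute r_def)
    have "norm (inverse (W s)) = exp (- Re (g s))"
      using exp_g[OF sball] by (metis norm_exp_eq_Re norm_inverse exp_minus)
    also have "\<dots> \<le> exp (K1 + \<epsilon> * ln \<tau>)" using gs abs_Re_le_cmod[of "g s"] by simp
    also have "\<dots> = exp K1 * \<tau> powr \<epsilon>" using tau by (simp add: exp_add powr_def)
    finally have Ws: "norm (inverse (W s)) \<le> exp K1 * \<tau> powr \<epsilon>" .
    have "norm (s - 1) \<le> norm (c - 1)"
    proof -
      have "(norm (s - 1))\<^sup>2 \<le> (norm (c - 1))\<^sup>2"
        using s d unfolding cmod_power2 by (auto simp: c_def t_def abs_square_le_1)
      then show ?thesis by (rule power2_le_imp_le) simp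
    qed
    then have sc1: "norm ((s - 1) / (c - 1)) \<le> 1" using \<open>c \<noteq> 1\<close> by (simp add: norm_divide divide_le_eq)
    have "(s - 1) / zeta_reg s = inverse (zeta c) * ((s - 1) / (c - 1)) * inverse (W s)"
      using nzc by (simp add: W_def zc)
    also have "norm \<dots> \<le> B * 1 * (exp K1 * \<tau> powr \<epsilon>)"
      unfolding norm_mult[of _ "inverse (W s)"] norm_mult[of "inverse _"]
      using B(1) by (intro mult_mono Bc sc1 Ws) auto
    finally show ?thesis by (simp add: \<tau>_def t_def mult_ac)
  qed
  then show ?thesis using that by blast
qed

section \<open>Perron's formula\<close>

lemma contour_integral_rectpath:
  assumes "continuous_on (path_image (rectpath a1 a3)) f"
  defines "a2 \<equiv> Complex (Re a3) (Im a1)" and "a4 \<equiv> Complex (Re a1) (Im a3)"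
  shows "contour_integral (rectpath a1 a3) f =
    contour_integral (linepath a1 a2) f + contour_integral (linepath a2 a3) f +
    contour_integral (linepath a3 a4) f + contour_integral (linepath a4 a1) f"
proof -
  have im: "path_image (rectpath a1 a3) = closed_segment a1 a2 \<union> closed_segment a2 a3 \<union>
      closed_segment a3 a4 \<union> closed_segment a4 a1"
    by (simp add: rectpath_def Let_def path_image_join Un_assoc a2_def a4_def)
  have "f contour_integrable_on linepath a1 a2" "f contour_integrable_on linepath a2 a3"
    "f contour_integrable_on linepath a3 a4" "f contour_integrable_on linepath a4 a1"
    using assms(1) unfolding im
    by (auto intro!: contour_integrable_continuous_linepath elim: continuous_on_subset)
  then show ?thesis
    unfolding rectpath_def Let_def a2_def[symmetric] a4_def[symmetric]
    by (simp add: contour_integrable_joinI)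
qed

lemma contour_integral_linepath_bound:
  assumes "continuous_on (closed_segment a b) f" "0 \<le> B" "\<And>z. z \<in> closed_segment a b \<Longrightarrow> norm (f z) \<le> B"
    and l: "\<bar>Re (b - a)\<bar> + \<bar>Im (b - a)\<bar> \<le> l"
  shows "norm (contour_integral (linepath a b) f) \<le> B * l"
proof -
  have "norm (contour_integral (linepath a b) f) \<le> B * norm (b - a)"
    using assms by (intro contour_integral_bound_linepath contour_integrable_continuous_linepath) auto
  also have "\<dots> \<le> B * l" using assms(2) l cmod_le[of "b - a"] by (intro mult_left_mono) auto
  finally show ?thesis .
qed

lemma closed_segment_horizontal:
  "z \<in> closed_segment (Complex a t) (Complex b t) \<Longrightarrow> Im z = t \<and> min a b \<le> Re z \<and> Re z \<le> max a b"
  by (auto simp: closed_segment_same_Im closed_segment_eq_real_ivl split: if_splits)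

lemma closed_segment_vertical:
  "z \<in> closed_segment (Complex a s) (Complex a t) \<Longrightarrow> Re z = a \<and> min s t \<le> Im z \<and> Im z \<le> max s t"
  by (auto simp: closed_segment_same_Re closed_segment_eq_real_ivl split: if_splits)

abbreviation vline :: "real \<Rightarrow> real \<Rightarrow> real \<Rightarrow> complex" where
  "vline c T \<equiv> linepath (Complex c (-T)) (Complex c T)"

text \<open>For y \<ge> 1 the contour is closed on the left, around the poles at 0 and -1 with
  residues y and -1; for y < 1 it is closed on the right, where there is no pole. On the added sides
  |s| \<ge> T and y^(Re s + 1) is at most y^3, which gives the error.\<close>

lemma perron_kernel:
  fixes y T :: real
  assumes y: "y > 0" and T: "T \<ge> 4"
  shows "norm (contour_integral (vline 2 T) (\<lambda>s. of_real y powr (s + 1) / (s * (s + 1)))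
     - 2 * pi * \<i> * (if y \<ge> 1 then y - 1 else 0)) \<le> 10 * y ^ 3 / T"
proof -
  define f where "f = (\<lambda>s::complex. of_real y powr (s + 1) / (s * (s + 1)))"
  have ny: "norm (complex_of_real y powr (s + 1)) = y powr (Re s + 1)" for s
    using y by (simp add: norm_powr_real_powr)
  have fcont: "continuous_on A f" if "\<And>s. s \<in> A \<Longrightarrow> s \<noteq> 0 \<and> s \<noteq> -1" for A
    unfolding f_def using that y by (intro continuous_intros) (auto simp: eq_neg_iff_add_eq_0)
  have fchorizontal: "continuous_on (closed_segment (Complex a t) (Complex b t)) f" if "t \<noteq> 0" for a b t
    using that by (intro fcont) (auto simp: closed_segment_same_Im)
  have fcvertical: "continuous_on (closed_segment (Complex a t) (Complex a u)) f" if "a \<noteq> 0" "a \<noteq> -1" for a t u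
    using that by (intro fcont) (auto simp: closed_segment_same_Re)
  have nf: "norm (f s) \<le> M / (T * (T/2))" if "T \<le> norm s" "T/2 \<le> norm (s + 1)" "y powr (Re s + 1) \<le> M" for s M
    unfolding f_def norm_divide norm_mult ny using that T
    by (intro frac_le mult_mono) (auto intro: order_trans[OF powr_ge_zero])
  have y3: "y powr 3 = y ^ 3" using y by (simp add: powr_numeral)
  define M where "M = y ^ 3"
  have M: "M \<ge> 0" using y by (simp add: M_def)
  define B where "B = M / (T * (T/2))"
  have B: "B \<ge> 0" using M T by (simp add: B_def)
  have ReIm: "\<bar>Re s\<bar> \<le> norm s" "\<bar>Im s\<bar> \<le> norm s" for s :: complex
    by (auto simp: abs_Re_le_cmod abs_Im_le_cmod)
  \<comment> \<open>T \<ge> 4 gives 4 T + 4 \<le> 5 T for the bound on the length of the three added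
    sides.\<close>
  have B_le: "B * (2 * (T + 2) + 2 * T) \<le> 10 * y ^ 3 / T"
  proof -
    have "B * (2 * (T + 2) + 2 * T) \<le> B * (5 * T)" using B T by (intro mult_left_mono) auto
    also have "\<dots> = 10 * y ^ 3 / T" using T by (simp add: B_def M_def field_simps)
    finally show ?thesis .
  qed
  show ?thesis
  proof (cases "y \<ge> 1")
    case True
    let ?R = "rectpath (Complex (-T) (-T)) (Complex 2 T)"
    have box: "0 \<in> box (Complex (-T) (-T)) (Complex 2 T)" "-1 \<in> box (Complex (-T) (-T)) (Complex 2 T)"
      using T by (auto simp: in_box_complex_iff)
    have nim: "0 \<notin> path_image ?R" "-1 \<notin> path_image ?R"
      using path_image_rectpath_cbox_minus_box[of "Complex (-T) (-T)" "Complex 2 T"] box T by auto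
    define N where "N = (\<lambda>s::complex. complex_of_real y powr (s + 1))"
    have Nh: "N holomorphic_on UNIV" unfolding N_def using y by (auto intro!: holomorphic_intros)
    have i0: "((\<lambda>w. N w / (w - z)) has_contour_integral (2 * pi * \<i> * N z)) ?R"
      if "z \<in> box (Complex (-T) (-T)) (Complex 2 T)" "z \<notin> path_image ?R" for z
      using Cauchy_integral_formula_convex_simple[OF convex_UNIV Nh, of z ?R] that
        winding_number_rectpath[OF that(1)] by (simp add: subset_Diff_insert)
    \<comment> \<open>The decomposition 1/(s (s + 1)) = 1/s - 1/(s + 1) reduces the two residues to
      Cauchy's formula.\<close>
    have "((\<lambda>w. N w / (w - 0) - N w / (w - (-1))) has_contour_integral (2 * pi * \<i> * N 0 - 2 * pi * \<i> * N (-1))) ?R"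
      by (intro has_contour_integral_diff i0 box nim)
    moreover have "N w / (w - 0) - N w / (w - (-1)) = f w" if "w \<in> path_image ?R" for w
    proof -
      have "w \<noteq> 0" "w + 1 \<noteq> 0" using that nim by (auto simp: add_eq_0_iff2)
      then show ?thesis by (simp add: f_def N_def divide_simps) (simp add: algebra_simps)
    qed
    ultimately have "(f has_contour_integral (2 * pi * \<i> * N 0 - 2 * pi * \<i> * N (-1))) ?R"
      by (rule has_contour_integral_eq)
    then have tot: "contour_integral ?R f = 2 * pi * \<i> * (y - 1)"
      using y by (simp add: contour_integral_unique N_def algebra_simps)
    have "continuous_on (path_image ?R) f" using nim by (intro fcont) auto
    from contour_integral_rectpath[OF this] tot
    have eq: "contour_integral (vline 2 T) f - 2 * pi * \<i> * (y - 1) =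
        - (contour_integral (linepath (Complex (-T) (-T)) (Complex 2 (-T))) f
        + contour_integral (linepath (Complex 2 T) (Complex (-T) T)) f
        + contour_integral (linepath (Complex (-T) T) (Complex (-T) (-T))) f)"
      by (simp add: algebra_simps)
    have M_ge: "y powr (Re s + 1) \<le> M" if "Re s \<le> 2" for s
    proof -
      have "y powr (Re s + 1) \<le> y powr 3" using that True by (intro powr_mono) auto
      then show ?thesis by (simp add: M_def y3)
    qed
    have fB: "norm (f s) \<le> B" if "\<bar>Im s\<bar> = T \<or> Re s = -T" "Re s \<le> 2" for s
      unfolding B_def using that T ReIm[of s] ReIm[of "s + 1"] by (intro nf M_ge) auto
    have n1: "norm (contour_integral (linepath (Complex (-T) (-T)) (Complex 2 (-T))) f) \<le> B * (T + 2)"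
      by (rule contour_integral_linepath_bound[OF fchorizontal B fB])
         (use T in \<open>auto dest!: closed_segment_horizontal simp: min_def max_def\<close>)
    have n2: "norm (contour_integral (linepath (Complex 2 T) (Complex (-T) T)) f) \<le> B * (T + 2)"
      by (rule contour_integral_linepath_bound[OF fchorizontal B fB])
         (use T in \<open>auto dest!: closed_segment_horizontal simp: min_def max_def\<close>)
    have n3: "norm (contour_integral (linepath (Complex (-T) T) (Complex (-T) (-T))) f) \<le> B * (2 * T)"
      by (rule contour_integral_linepath_bound[OF fcvertical B fB])
         (use T in \<open>auto dest!: closed_segment_vertical simp: min_def max_def\<close>)
    have "norm (contour_integral (vline 2 T) f - 2 * pi * \<i> * (y - 1)) \<le>
       B * (T + 2) + B * (T + 2) + B * (2 * T)"
      unfolding eq norm_minus_cancel by (intro order_trans[OF norm_triangle_ineq] add_mono n1 n2 n3)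
    also have "\<dots> = B * (2 * (T + 2) + 2 * T)" by (simp add: algebra_simps)
    finally show ?thesis using B_le True unfolding f_def by simp
  next
    case False
    let ?R = "rectpath (Complex 2 (-T)) (Complex T T)"
    let ?H = "{s. Re s > 0}"
    have sub: "path_image ?R \<subseteq> ?H"
      using path_image_rectpath_subset_cbox[of "Complex 2 (-T)" "Complex T T"] T by (auto simp: in_cbox_complex_iff)
    have fh: "f holomorphic_on ?H"
      unfolding f_def using y by (intro holomorphic_intros) (auto simp: add_eq_0_iff2)
    have "(f has_contour_integral 0) ?R"
      using Cauchy_theorem_convex_simple[OF fh convex_halfspace_Re_gt _ sub] by auto
    then have tot: "contour_integral ?R f = 0" by (rule contour_integral_unique)
    have "continuous_on (path_image ?R) f" using sub by (intro fcont) auto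
    from contour_integral_rectpath[OF this] tot
    have "contour_integral (linepath (Complex 2 T) (Complex 2 (-T))) f =
        - (contour_integral (linepath (Complex 2 (-T)) (Complex T (-T))) f
        + contour_integral (linepath (Complex T T) (Complex 2 T)) f
        + contour_integral (linepath (Complex T (-T)) (Complex T T)) f)"
      by (simp add: algebra_simps eq_neg_iff_add_eq_0)
    moreover have "continuous_on (closed_segment (Complex 2 (-T)) (Complex 2 T)) f"
      by (intro fcvertical) auto
    ultimately have eq: "contour_integral (vline 2 T) f =
         (contour_integral (linepath (Complex 2 (-T)) (Complex T (-T))) f
        + contour_integral (linepath (Complex T T) (Complex 2 T)) f
        + contour_integral (linepath (Complex T (-T)) (Complex T T)) f)"
      using contour_integral_reverse_linepath[of "Complex 2 (-T)" "Complex 2 T" f] by (metis add.inverse_inverse)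
    have M_ge: "y powr (Re s + 1) \<le> M" if "Re s \<ge> 2" for s
    proof -
      have "y powr (Re s + 1) \<le> y powr 3" using that False y by (intro powr_mono') auto
      then show ?thesis by (simp add: M_def y3)
    qed
    have fB: "norm (f s) \<le> B" if "\<bar>Im s\<bar> = T \<or> Re s = T" "Re s \<ge> 2" for s
      unfolding B_def using that T ReIm[of s] ReIm[of "s + 1"] by (intro nf M_ge) auto
    have n1: "norm (contour_integral (linepath (Complex 2 (-T)) (Complex T (-T))) f) \<le> B * (T + 2)"
      by (rule contour_integral_linepath_bound[OF fchorizontal B fB])
         (use T in \<open>auto dest!: closed_segment_horizontal simp: min_def max_def\<close>)
    have n2: "norm (contour_integral (linepath (Complex T T) (Complex 2 T)) f) \<le> B * (T + 2)"
      by (rule contour_integral_linepath_bound[OF fchorizontal B fB])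
         (use T in \<open>auto dest!: closed_segment_horizontal simp: min_def max_def\<close>)
    have n3: "norm (contour_integral (linepath (Complex T (-T)) (Complex T T)) f) \<le> B * (2 * T)"
      by (rule contour_integral_linepath_bound[OF fcvertical B fB])
         (use T in \<open>auto dest!: closed_segment_vertical simp: min_def max_def\<close>)
    have "norm (contour_integral (vline 2 T) f) \<le>
       B * (T + 2) + B * (T + 2) + B * (2 * T)"
      unfolding eq by (intro order_trans[OF norm_triangle_ineq] add_mono n1 n2 n3)
    also have "\<dots> = B * (2 * (T + 2) + 2 * T)" by (simp add: algebra_simps)
    finally show ?thesis using B_le False unfolding f_def by simp
  qed
qed

text \<open>With y = X/n one has X^(s+1)/n^s = n y^(s+1), so each term is the kernel with weight n.
  The errors n y^3 / T = X^3 / (n^2 T) are summable over n, and their sum tends to 0 with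
  1/T.\<close>

lemma perron_moebius_mu:
  assumes X: "X > 0"
  shows "((\<lambda>T. contour_integral (vline 2 T)
            (\<lambda>s. of_nat X powr (s + 1) / (s * (s + 1)) * inverse (zeta s))) \<longlongrightarrow>
         2 * pi * \<i> * (\<Sum>n<X. of_int (moebius_mu (Suc n)) * (of_nat X - of_nat (Suc n)))) at_top"
proof -
  define K where "K = (\<lambda>y s. complex_of_real y powr (s + 1) / (s * (s + 1)))"
  define y where "y = (\<lambda>n. real X / real (Suc n))"
  define a where "a = (\<lambda>n. complex_of_int (moebius_mu (Suc n)) * of_nat (Suc n))"
  define m where "m = (\<lambda>n. if y n \<ge> 1 then complex_of_real (y n) - 1 else 0)"
  let ?F = "\<lambda>s. of_nat X powr (s + 1) / (s * (s + 1)) * inverse (zeta s)"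
  have ypos: "y n > 0" for n using X by (simp add: y_def)
  have a_le: "norm (a n) \<le> real (Suc n)" for n
    using mult_right_mono[OF norm_moebius_mu_le[of "Suc n"], of "real (Suc n)"]
    by (simp add: a_def norm_mult del: of_nat_Suc)
  have inv: "summable (\<lambda>n. 1 / real (Suc n) ^ 2)"
    using summable_Suc_powr[of 2] by (simp add: powr_numeral del: of_nat_Suc)
  have ay: "real (Suc n) * y n ^ 3 = real X ^ 3 * (1 / real (Suc n) ^ 2)" for n
    by (simp add: y_def power_divide eval_nat_numeral del: of_nat_Suc)
  have sums_F: "(\<lambda>n. a n * K (y n) s) sums ?F s" if s: "Re s = 2" for s
  proof -
    have "(\<lambda>n. of_nat X powr (s + 1) / (s * (s + 1)) * (of_int (moebius_mu (Suc n)) / of_nat (Suc n) powr s)) sums ?F s"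
      using s by (intro sums_mult moebius_mu_sums) auto
    moreover have "of_nat X powr (s + 1) / (s * (s + 1)) * (of_int (moebius_mu (Suc n)) / of_nat (Suc n) powr s) = a n * K (y n) s" for n
    proof -
      have "complex_of_real (y n) powr (s + 1) = of_nat X powr (s + 1) / of_nat (Suc n) powr (s + 1)"
      proof -
        have "complex_of_nat X = of_real (y n) * of_nat (Suc n)" by (simp add: y_def del: of_nat_Suc)
        then have "of_nat X powr (s + 1) = of_real (y n) powr (s + 1) * complex_of_nat (Suc n) powr (s + 1)"
          using ypos[of n] by (simp add: powr_times_real del: of_nat_Suc)
        then show ?thesis by (simp del: of_nat_Suc)
      qed
      also have "complex_of_nat (Suc n) powr (s + 1) = of_nat (Suc n) powr s * of_nat (Suc n)"
        by (simp add: powr_add del: of_nat_Suc)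
      finally show ?thesis by (simp add: a_def K_def mult_ac del: of_nat_Suc)
    qed
    ultimately show ?thesis by simp
  qed
  have bound: "norm (a n * K (y n) s) \<le> real X ^ 3 * (1 / real (Suc n) ^ 2)" if s: "Re s = 2" for n s
  proof -
    have "1 \<le> norm s" "1 \<le> norm (s + 1)" using abs_Re_le_cmod[of s] abs_Re_le_cmod[of "s + 1"] s by auto
    then have "1 * 1 \<le> norm s * norm (s + 1)" by (intro mult_mono) auto
    moreover have "norm (complex_of_real (y n) powr (s + 1)) = y n ^ 3"
      using ypos[of n] s by (simp add: norm_powr_real_powr powr_numeral)
    ultimately have "norm (K (y n) s) \<le> y n ^ 3"
      using ypos[of n] divide_left_mono[of 1 "norm s * norm (s + 1)" "y n ^ 3"] by (simp add: K_def norm_divide norm_mult)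
    then have "norm (a n * K (y n) s) \<le> real (Suc n) * y n ^ 3"
      unfolding norm_mult by (intro mult_mono a_le) auto
    then show ?thesis unfolding ay .
  qed
  define S where "S = (\<Sum>n. 1 / real (Suc n) ^ 2)"
  have err: "norm (contour_integral (vline 2 T) ?F -
      2 * pi * \<i> * (\<Sum>n<X. a n * m n)) \<le> (10 * real X ^ 3 * S) / T" if T: "T \<ge> 4" for T
  proof -
    let ?g = "vline 2 T"
    have seg: "Re s = 2" if "s \<in> path_image ?g" for s
      using that closed_segment_vertical[of s 2 "-T" T] by simp
    have K_int: "K (y n) contour_integrable_on ?g" for n
    proof (rule contour_integrable_continuous_linepath)
      show "continuous_on (closed_segment (Complex 2 (-T)) (Complex 2 T)) (K (y n))"
        unfolding K_def using ypos[of n] seg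
        by (intro continuous_intros) (auto simp: eq_neg_iff_add_eq_0 complex_eq_iff)
    qed
    have u: "uniform_limit (path_image ?g) (\<lambda>N s. \<Sum>n<N. a n * K (y n) s) (\<lambda>s. \<Sum>n. a n * K (y n) s) sequentially"
      by (rule Weierstrass_m_test[OF bound[OF seg] summable_mult[OF inv]])
    have u: "uniform_limit (path_image ?g) (\<lambda>N s. \<Sum>n<N. a n * K (y n) s) ?F sequentially"
      by (rule uniform_limit_cong'[THEN iffD1, OF _ _ u]) (use sums_F seg in \<open>auto simp: sums_iff\<close>)
    have "(\<lambda>N. contour_integral ?g (\<lambda>s. \<Sum>n<N. a n * K (y n) s)) \<longlonglongrightarrow> contour_integral ?g ?F"
    proof (rule contour_integral_uniform_limit(2)[OF _ u])
      show "\<forall>\<^sub>F N in sequentially. (\<lambda>s. \<Sum>n<N. a n * K (y n) s) contour_integrable_on ?g"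
        by (intro always_eventually allI contour_integrable_sum contour_integrable_lmul K_int) auto
      show "norm (vector_derivative ?g (at t)) \<le> norm (Complex 2 T - Complex 2 (-T))" for t
        by simp
    qed auto
    moreover have "contour_integral ?g (\<lambda>s. \<Sum>n<N. a n * K (y n) s) = (\<Sum>n<N. a n * contour_integral ?g (K (y n)))" for N
      by (simp add: contour_integral_sum contour_integrable_lmul K_int contour_integral_lmul)
    ultimately have s1: "(\<lambda>n. a n * contour_integral ?g (K (y n))) sums contour_integral ?g ?F"
      by (simp add: sums_def)
    have "m n = 0" if "n \<notin> {..<X}" for n
      using that by (auto simp: m_def y_def divide_simps)
    then have s2: "(\<lambda>n. 2 * pi * \<i> * (a n * m n)) sums (2 * pi * \<i> * (\<Sum>n<X. a n * m n))"
      by (intro sums_mult sums_finite) auto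
    have S: "(\<lambda>n. 10 * real X ^ 3 / T * (1 / real (Suc n) ^ 2)) sums (10 * real X ^ 3 / T * S)"
      unfolding S_def by (intro sums_mult summable_sums inv)
    have "norm (contour_integral ?g ?F - 2 * pi * \<i> * (\<Sum>n<X. a n * m n)) \<le> 10 * real X ^ 3 / T * S"
    proof (rule norm_sums_le[OF sums_diff[OF s1 s2] S])
      fix n
      have diff: "a n * contour_integral ?g (K (y n)) - 2 * pi * \<i> * (a n * m n) =
          a n * (contour_integral ?g (K (y n)) - 2 * pi * \<i> * m n)" by (simp add: right_diff_distrib)
      have "norm (contour_integral ?g (K (y n)) - 2 * pi * \<i> * m n) \<le> 10 * y n ^ 3 / T"
        using perron_kernel[OF ypos[of n] T] by (auto simp: K_def m_def)
      then have "norm (a n) * norm (contour_integral ?g (K (y n)) - 2 * pi * \<i> * m n) \<le> real (Suc n) * (10 * y n ^ 3 / T)"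
        using T ypos[of n] by (intro mult_mono a_le) auto
      also have "\<dots> = 10 / T * (real (Suc n) * y n ^ 3)" by simp
      also have "\<dots> = 10 * real X ^ 3 / T * (1 / real (Suc n) ^ 2)" unfolding ay by simp
      finally show "norm (a n * contour_integral ?g (K (y n)) - 2 * pi * \<i> * (a n * m n)) \<le> 10 * real X ^ 3 / T * (1 / real (Suc n) ^ 2)"
        unfolding diff norm_mult .
    qed
    then show ?thesis by simp
  qed
  have "((\<lambda>T. contour_integral (vline 2 T) ?F - 2 * pi * \<i> * (\<Sum>n<X. a n * m n)) \<longlongrightarrow> 0) at_top"
  proof (rule Lim_null_comparison)
    show "\<forall>\<^sub>F T in at_top. norm (contour_integral (vline 2 T) ?F -
      2 * pi * \<i> * (\<Sum>n<X. a n * m n)) \<le> (10 * real X ^ 3 * S) / T"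
      using eventually_ge_at_top[of 4] by eventually_elim (rule err)
    show "((\<lambda>T. (10 * real X ^ 3 * S) / T) \<longlongrightarrow> 0) at_top"
      by (intro tendsto_divide_0[OF tendsto_const] filterlim_at_top_imp_at_infinity filterlim_ident)
  qed
  moreover have "a n * m n = of_int (moebius_mu (Suc n)) * (of_nat X - of_nat (Suc n))" if "n < X" for n
  proof -
    have "y n \<ge> 1" using that by (simp add: y_def)
    then show ?thesis by (simp add: m_def a_def y_def right_diff_distrib del: of_nat_Suc)
  qed
  ultimately show ?thesis by (simp add: LIM_zero_iff)
qed

text \<open>Interpolation between the trivial bound 2 X^(Re s + 1), used when X \<le> |s + 1|, and
  the mean value bound |s + 1| X^(Re s). After division by s (s + 1) it leaves decay |s|^(-1-\<eta>)
  at the cost of X^\<eta>, whereas the mean value bound alone leaves 1/|s|.\<close>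

lemma norm_powr_diff_interpolated:
  fixes s :: complex
  assumes N: "N > 0" and s: "Re s \<ge> 0" and \<eta>: "0 \<le> \<eta>" "\<eta> \<le> 1"
  shows "norm (of_nat (Suc N) powr (s + 1) - of_nat N powr (s + 1)) \<le>
    2 * real (Suc N) powr (Re s + \<eta>) * norm (s + 1) powr (1 - \<eta>)"
proof -
  let ?X = "real (Suc N)" and ?d = "of_nat (Suc N) powr (s + 1) - complex_of_nat N powr (s + 1)"
  have "0 < Re (s + 1)" using s by simp
  also have "\<dots> \<le> norm (s + 1)" by (rule complex_Re_le_cmod)
  finally have w: "norm (s + 1) > 0" .
  show ?thesis
  proof (cases "?X \<le> norm (s + 1)")
    case True
    have "norm ?d \<le> ?X powr (Re s + 1) + real N powr (Re s + 1)"
      using norm_triangle_ineq4[of "of_nat (Suc N) powr (s + 1)" "complex_of_nat N powr (s + 1)"]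
      by (simp only: norm_powr_of_nat) simp
    also have "\<dots> \<le> 2 * ?X powr (Re s + 1)" using powr_mono2[of "Re s + 1" "real N" ?X] s by simp
    also have "\<dots> = 2 * ?X powr (Re s + \<eta>) * ?X powr (1 - \<eta>)" by (simp flip: powr_add)
    also have "\<dots> \<le> 2 * ?X powr (Re s + \<eta>) * norm (s + 1) powr (1 - \<eta>)"
      using True \<eta> by (intro mult_left_mono powr_mono2) auto
    finally show ?thesis .
  next
    case False
    let ?S = "closed_segment (complex_of_real N) (complex_of_real ?X)"
    have "norm (complex_of_real ?X powr (s + 1) - complex_of_real N powr (s + 1)) \<le>
          (norm (s + 1) * ?X powr Re s) * norm (complex_of_real ?X - complex_of_real N)"
    proof (rule field_differentiable_bound[where S = ?S and f' = "\<lambda>z. (s + 1) * z powr s"])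
      fix z assume z: "z \<in> ?S"
      then have "z \<in> \<real> \<and> Re z \<in> closed_segment (real N) ?X"
        by (subst (asm) closed_segment_same_Im) (auto simp: complex_is_Real_iff)
      then have "z = of_real (Re z) \<and> real N \<le> Re z \<and> Re z \<le> ?X"
        by (auto simp: closed_segment_eq_real_ivl complex_is_Real_iff complex_eq_iff)
      then obtain x where x: "z = of_real x" "real N \<le> x" "x \<le> ?X" by blast
      then have xpos: "x > 0" using N by simp
      show "((\<lambda>z. z powr (s + 1)) has_field_derivative (s + 1) * z powr s) (at z within ?S)"
        using x xpos by (auto intro!: derivative_eq_intros simp: complex_nonpos_Reals_iff)
      show "norm ((s + 1) * z powr s) \<le> norm (s + 1) * ?X powr Re s"
        unfolding norm_mult using x xpos s
        by (intro mult_left_mono) (auto simp: norm_powr_real_powr intro!: powr_mono2)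
    qed auto
    then have "norm ?d \<le> norm (s + 1) * ?X powr Re s" by simp
    also have "norm (s + 1) = norm (s + 1) powr \<eta> * norm (s + 1) powr (1 - \<eta>)" using w by (simp flip: powr_add)
    also have "\<dots> \<le> ?X powr \<eta> * norm (s + 1) powr (1 - \<eta>)"
      using False \<eta> w by (intro mult_right_mono powr_mono2) auto
    finally have "norm ?d \<le> ?X powr (Re s + \<eta>) * norm (s + 1) powr (1 - \<eta>)"
      by (simp add: powr_add mult_ac mult_right_mono)
    also have "\<dots> \<le> 2 * \<dots>" by simp
    finally show ?thesis by (simp add: mult_ac)
  qed
qed

lemma integral_powr_abs_le:
  fixes T e :: real
  assumes "T > 0" "e > 0"
  shows "(\<lambda>t. (2 + \<bar>t\<bar>) powr (-1 - e)) integrable_on {-T..T}"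
    and "integral {-T..T} (\<lambda>t. (2 + \<bar>t\<bar>) powr (-1 - e)) \<le> 2 / e"
proof -
  let ?h = "\<lambda>t. (2 + \<bar>t\<bar>) powr (-1 - e)" and ?H = "\<lambda>t. - ((2 + t) powr (-e)) / e"
  define I where "I = ?H T - ?H 0"
  have "((\<lambda>t. (2 + t) powr (-1 - e)) has_integral I) {0..T}"
    unfolding I_def
  proof (rule fundamental_theorem_of_calculus)
    fix x assume "x \<in> {0..T}"
    then have "((\<lambda>z. z powr (-e)) has_real_derivative (-e) * (2 + x) powr (-e - 1)) (at (2 + x))"
      by (intro has_real_derivative_powr) auto
    then have "((\<lambda>x. (2 + x) powr (-e)) has_real_derivative (-e) * (2 + x) powr (-e - 1)) (at x within {0..T})"
      by (rule DERIV_chain2[where g = "\<lambda>x. 2 + x" and Db = 1, simplified]) (auto intro!: derivative_eq_intros)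
    then have "(?H has_real_derivative - ((-e) * (2 + x) powr (-e - 1)) / e) (at x within {0..T})"
      by (intro DERIV_cdivide DERIV_minus)
    moreover have "- ((-e) * (2 + x) powr (-e - 1)) / e = (2 + x) powr (-1 - e)"
      using assms(2) by (simp add: diff_commute minus_diff_commute)
    ultimately show "(?H has_vector_derivative (2 + x) powr (-1 - e)) (at x within {0..T})"
      by (simp only: has_real_derivative_iff_has_vector_derivative)
  qed (use assms in auto)
  then have 1: "(?h has_integral I) {0..T}"
    by (rule has_integral_eq[rotated]) auto
  have 2: "(?h has_integral I) {-T..0}"
    using has_integral_reflect_real[where f = ?h and i = I and a = 0 and b = T] 1 by simp
  have 3: "(?h has_integral (I + I)) {-T..T}"
    using assms by (intro has_integral_combine[OF _ _ 2 1]) auto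
  then show "?h integrable_on {-T..T}" by blast
  have "I \<le> 1 / e"
  proof -
    have "I \<le> 2 powr (-e) / e" using assms by (simp add: I_def)
    also have "\<dots> \<le> 1 / e" using assms powr_mono[of "-e" 0 "2::real"] by (intro divide_right_mono) auto
    finally show ?thesis .
  qed
  then show "integral {-T..T} ?h \<le> 2 / e" using 3 by (simp add: integral_unique)
qed

lemma mertens_bound_RH:
  assumes RH: "riemann_hypothesis" and e: "0 < e" "e < 1/2"
  obtains C where "\<And>N. norm (\<Sum>k<N. complex_of_int (moebius_mu (Suc k))) \<le> C * real N powr (1/2 + e)"
proof -
  \<comment> \<open>One half of \<open>e\<close> pays for the distance of the line from 1/2, the
    other for the interpolation. The growth of 1/zeta is allowed the exponent \<eta>/2, so the
    integrand still decays like |t|^(-1-\<eta>/2).\<close>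
  define \<eta> where "\<eta> = e / 2"
  have \<eta>: "0 < \<eta>" "\<eta> < 1/4" "\<eta> + \<eta> = e" using e by (auto simp: \<eta>_def)
  define \<sigma> where "\<sigma> = 1/2 + \<eta>"
  define F where "F = (\<lambda>s. (s - 1) / zeta_reg s)"
  obtain C0 where C0: "\<And>s. \<sigma> \<le> Re s \<Longrightarrow> Re s \<le> 2 \<Longrightarrow> norm (F s) \<le> C0 * (2 + \<bar>Im s\<bar>) powr (\<eta> / 2)"
    using inverse_zeta_growth_RH[OF RH, of \<eta> "\<eta> / 2"] \<eta> unfolding \<sigma>_def F_def by auto
  have "0 \<le> C0 * 2 powr (\<eta> / 2)"
    using order_trans[OF norm_ge_zero C0[of 2]] \<eta> by (simp add: \<sigma>_def)
  then have C0_pos: "C0 \<ge> 0" by (simp add: zero_le_mult_iff)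
  let ?H = "{s. Re s > 1/2}"
  have F_hol: "F holomorphic_on ?H"
    unfolding F_def using zeta_reg_nonzero_RH[OF RH]
    by (intro holomorphic_intros holomorphic_on_subset[OF zeta_reg_holomorphic]) auto
  have F_2: "F s = inverse (zeta s)" if "Re s = 2" for s
  proof -
    have "s \<noteq> 1" using that by auto
    then show ?thesis using zeta_eq_zeta_reg[of s] by (simp add: F_def)
  qed
  have main: "norm (\<Sum>k<N. complex_of_int (moebius_mu (Suc k))) \<le> (400 * C0 / \<eta>) * real N powr (1/2 + e)"
    if N: "N > 0" for N
  proof -
    let ?X = "real (Suc N)"
    define f where "f = (\<lambda>X s. complex_of_nat X powr (s + 1) / (s * (s + 1)) * F s)"
    define P where "P = (\<lambda>s. f (Suc N) s - f N s)"
    have f_hol: "f X holomorphic_on ?H" if "X > 0" for X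
    proof -
      have "s \<noteq> 0" "s + 1 \<noteq> 0" if "s \<in> ?H" for s using that by (auto simp: complex_eq_iff)
      then have "s * (s + 1) \<noteq> 0" if "s \<in> ?H" for s using that by simp
      then show ?thesis unfolding f_def using that by (intro holomorphic_intros F_hol) auto
    qed
    have P_hol: "P holomorphic_on ?H" unfolding P_def using N by (intro holomorphic_intros f_hol) auto
    have P_bound: "norm (P s) \<le> 50 * C0 * ?X powr (Re s + \<eta>) * (2 + \<bar>Im s\<bar>) powr (-1 - \<eta>/2)"
      if s: "\<sigma> \<le> Re s" "Re s \<le> 2" for s
    proof -
      define u where "u = 2 + \<bar>Im s\<bar>"
      have u: "u \<ge> 2" by (simp add: u_def)
      have Re: "Re s \<ge> 1/2" using s \<eta> by (simp add: \<sigma>_def)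
      \<comment> \<open>|s| is at least both 1/2 and |Im s|, hence at least (2 + |Im s|) /
        5.\<close>
      have n1: "u / 5 \<le> norm s" using Re complex_Re_le_cmod[of s] abs_Im_le_cmod[of s] unfolding u_def by simp
      have n2: "u / 5 \<le> norm (s + 1)"
        using Re complex_Re_le_cmod[of "s + 1"] abs_Im_le_cmod[of "s + 1"] unfolding u_def by simp
      have pos: "norm s > 0" "norm (s + 1) > 0" using n1 n2 u by linarith+
      have "(u / 5) powr (1 + \<eta>) = (u / 5) * (u / 5) powr \<eta>" using u by (simp add: powr_add)
      also have "\<dots> \<le> norm s * norm (s + 1) powr \<eta>"
        using n1 n2 u \<eta> by (intro mult_mono powr_mono2) auto
      finally have den: "(u / 5) powr (1 + \<eta>) \<le> norm s * norm (s + 1) powr \<eta>" .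
      let ?A = "2 * C0 * ?X powr (Re s + \<eta>) * u powr (\<eta> / 2)"
      have "norm (P s) = norm (of_nat (Suc N) powr (s + 1) - complex_of_nat N powr (s + 1)) / (norm s * norm (s + 1)) * norm (F s)"
        by (simp add: P_def f_def norm_mult norm_divide flip: left_diff_distrib diff_divide_distrib)
      also have "\<dots> \<le> (2 * ?X powr (Re s + \<eta>) * norm (s + 1) powr (1 - \<eta>)) / (norm s * norm (s + 1)) * (C0 * u powr (\<eta> / 2))"
        using Re \<eta> N C0[OF s] unfolding u_def
        by (intro mult_mono divide_right_mono norm_powr_diff_interpolated) auto
      also have "norm (s + 1) powr (1 - \<eta>) = norm (s + 1) / norm (s + 1) powr \<eta>"
        using pos by (simp add: powr_diff)
      also have "(2 * ?X powr (Re s + \<eta>) * (norm (s + 1) / norm (s + 1) powr \<eta>)) / (norm s * norm (s + 1)) * (C0 * u powr (\<eta> / 2))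
          = ?A / (norm s * norm (s + 1) powr \<eta>)"
        using pos by (simp add: field_simps)
      also have "\<dots> \<le> ?A / (u / 5) powr (1 + \<eta>)"
        using den u C0_pos pos by (intro divide_left_mono mult_pos_pos) auto
      also have "\<dots> = ?A * (5 powr (1 + \<eta>) * u powr (-(1 + \<eta>)))"
      proof -
        have "u powr (-(1 + \<eta>)) = 1 / u powr (1 + \<eta>)" by (rule powr_minus_divide)
        moreover have "(u / 5) powr (1 + \<eta>) = u powr (1 + \<eta>) / 5 powr (1 + \<eta>)" by (intro powr_divide)
        ultimately show ?thesis by simp
      qed
      also have "\<dots> \<le> ?A * (25 * u powr (-(1 + \<eta>)))"
      proof (intro mult_left_mono mult_right_mono)
        have "5 powr (1 + \<eta>) \<le> 5 powr (2::real)" using \<eta> by (intro powr_mono) auto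
        then show "5 powr (1 + \<eta>) \<le> (25::real)" by (simp add: powr_numeral)
      qed (use C0_pos in auto)
      also have "\<dots> = 50 * C0 * ?X powr (Re s + \<eta>) * (u powr (\<eta> / 2) * u powr (-(1 + \<eta>)))" by simp
      also have "u powr (\<eta> / 2) * u powr (-(1 + \<eta>)) = u powr (-1 - \<eta>/2)"
        unfolding powr_add[symmetric] by (rule arg_cong[of _ _ "(powr) u"]) simp
      finally show ?thesis by (simp add: u_def)
    qed
    have seg2: "path_image (vline 2 T) \<subseteq> ?H" if "T \<ge> 4" for T
      by (auto dest!: closed_segment_vertical)
    let ?J = "\<lambda>T. contour_integral (vline 2 T) P"
    have J_lim: "(?J \<longlongrightarrow> 2 * pi * \<i> * (\<Sum>k<N. of_int (moebius_mu (Suc k)))) at_top"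
    proof (rule Lim_transform_eventually)
      let ?G = "\<lambda>X T. contour_integral (vline 2 T)
            (\<lambda>s. of_nat X powr (s + 1) / (s * (s + 1)) * inverse (zeta s))"
      \<comment> \<open>The weights N + 1 - k and N - k differ by 1 for k \<le> N, and the extra
        term k = N + 1 has weight 0.\<close>
      have "(\<Sum>n<Suc N. of_int (moebius_mu (Suc n)) * (of_nat (Suc N) - of_nat (Suc n)))
          - (\<Sum>n<N. of_int (moebius_mu (Suc n)) * (of_nat N - of_nat (Suc n))) = (\<Sum>k<N. complex_of_int (moebius_mu (Suc k)))"
        by (simp add: sum_subtractf[symmetric] algebra_simps)
      then show "((\<lambda>T. ?G (Suc N) T - ?G N T) \<longlongrightarrow> 2 * pi * \<i> * (\<Sum>k<N. of_int (moebius_mu (Suc k)))) at_top"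
        using tendsto_diff[OF perron_moebius_mu[of "Suc N"] perron_moebius_mu[of N]] N
        by (simp only: right_diff_distrib[symmetric] zero_less_Suc)
      show "\<forall>\<^sub>F T in at_top. ?G (Suc N) T - ?G N T = ?J T"
        using eventually_ge_at_top[of 4]
      proof eventually_elim
        case (elim T)
        let ?g = "vline 2 T"
        have "?G X T = contour_integral ?g (f X)" for X
          by (rule contour_integral_cong)
             (auto dest!: closed_segment_vertical simp: f_def F_2)
        moreover have "f X contour_integrable_on ?g" if "X > 0" for X
          using holomorphic_on_imp_continuous_on[OF f_hol[OF that]] seg2[OF elim]
          by (intro contour_integrable_continuous_linepath) (auto elim: continuous_on_subset)
        ultimately show ?case unfolding P_def using N by (simp add: contour_integral_diff del: of_nat_Suc)
      qed
    qed
    have J_bound: "norm (?J T) \<le> 200 * C0 * ?X powr 3 / T + 200 * C0 / \<eta> * ?X powr (1/2 + e)" if T: "T \<ge> 4" for T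
    proof -
      let ?R = "rectpath (Complex \<sigma> (-T)) (Complex 2 T)"
      have sigma: "\<sigma> > 1/2" "\<sigma> \<le> 2" using \<eta> by (auto simp: \<sigma>_def)
      have sub: "path_image ?R \<subseteq> ?H"
        using path_image_rectpath_subset_cbox[of "Complex \<sigma> (-T)" "Complex 2 T"] T sigma
        by (auto simp: in_cbox_complex_iff)
      have "(P has_contour_integral 0) ?R"
        using Cauchy_theorem_convex_simple[OF P_hol convex_halfspace_Re_gt _ sub] by auto
      then have tot: "contour_integral ?R P = 0" by (rule contour_integral_unique)
      have cont: "continuous_on A P" if "A \<subseteq> ?H" for A
        using holomorphic_on_imp_continuous_on[OF P_hol] that by (rule continuous_on_subset)
      let ?I1 = "contour_integral (linepath (Complex \<sigma> (-T)) (Complex 2 (-T))) P"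
      let ?I3 = "contour_integral (linepath (Complex 2 T) (Complex \<sigma> T)) P"
      let ?I4 = "contour_integral (vline \<sigma> T) P"
      have sv: "closed_segment (Complex \<sigma> (-T)) (Complex \<sigma> T) \<subseteq> ?H"
        using sigma by (auto dest!: closed_segment_vertical)
      have rev: "contour_integral (linepath (Complex \<sigma> T) (Complex \<sigma> (-T))) P = - ?I4"
        using contour_integral_reverse_linepath[OF cont[OF sv]] by simp
      have eq: "?J T = - ?I1 - ?I3 + ?I4"
        using contour_integral_rectpath[OF cont[OF sub]] tot rev by (simp add: algebra_simps eq_neg_iff_add_eq_0)
      have hor: "norm (P s) \<le> 50 * C0 * ?X powr 3 / T" if "\<bar>Im s\<bar> = T" "\<sigma> \<le> Re s" "Re s \<le> 2" for s
      proof -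
        have "(2 + T) powr (-1 - \<eta>/2) \<le> (2 + T) powr (-1)" using T \<eta> by (intro powr_mono) auto
        also have "\<dots> \<le> 1 / T" using T by (simp add: powr_minus_divide frac_le)
        finally have 1: "(2 + T) powr (-1 - \<eta>/2) \<le> 1 / T" .
        have "norm (P s) \<le> 50 * C0 * ?X powr (Re s + \<eta>) * (2 + T) powr (-1 - \<eta>/2)"
          using P_bound[of s] that by simp
        also have "\<dots> \<le> 50 * C0 * ?X powr 3 * (1 / T)"
          using that \<eta> C0_pos T by (intro mult_mono powr_mono 1) auto
        finally show ?thesis by simp
      qed
      have h1: "norm ?I1 \<le> 50 * C0 * ?X powr 3 / T * 2"
        by (rule contour_integral_linepath_bound[OF cont _ hor])
           (use C0_pos T sigma in \<open>auto dest!: closed_segment_horizontal simp: min_def max_def split: if_splits\<close>)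
      have h3: "norm ?I3 \<le> 50 * C0 * ?X powr 3 / T * 2"
        by (rule contour_integral_linepath_bound[OF cont _ hor])
           (use C0_pos T sigma in \<open>auto dest!: closed_segment_horizontal simp: min_def max_def split: if_splits\<close>)
      have "?I4 = \<i> * integral {-T..T} (\<lambda>t. P (Complex \<sigma> t))"
        using T by (intro contour_integral_linepath_same_Re) auto
      then have "norm ?I4 = norm (integral {-T..T} (\<lambda>t. P (Complex \<sigma> t)))" by (simp add: norm_mult)
      also have "\<dots> \<le> integral {-T..T} (\<lambda>t. 50 * C0 * ?X powr (1/2 + e) * (2 + \<bar>t\<bar>) powr (-1 - \<eta>/2))"
      proof (rule integral_norm_bound_integral)
        have "continuous_on {-T..T} (\<lambda>t. P (Complex \<sigma> t))"
        proof (rule continuous_on_compose2[OF cont[OF order_refl]])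
          have "continuous_on {-T..T} (\<lambda>t. of_real \<sigma> + \<i> * of_real t)" by (intro continuous_intros)
          then show "continuous_on {-T..T} (\<lambda>t. Complex \<sigma> t)" by (simp add: Complex_eq)
        qed (use sigma in auto)
        then show "(\<lambda>t. P (Complex \<sigma> t)) integrable_on {-T..T}" by (rule integrable_continuous_real)
        show "(\<lambda>t. 50 * C0 * ?X powr (1/2 + e) * (2 + \<bar>t\<bar>) powr (-1 - \<eta>/2)) integrable_on {-T..T}"
          using integral_powr_abs_le(1)[of T "\<eta>/2"] T \<eta> by (intro integrable_on_mult_right) auto
        show "norm (P (Complex \<sigma> t)) \<le> 50 * C0 * ?X powr (1/2 + e) * (2 + \<bar>t\<bar>) powr (-1 - \<eta>/2)" for t
        proof -
          have "\<sigma> + \<eta> = 1/2 + e" using \<eta>(3) by (simp add: \<sigma>_def)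
          then show ?thesis using P_bound[of "Complex \<sigma> t"] sigma by simp
        qed
      qed
      also have "\<dots> = 50 * C0 * ?X powr (1/2 + e) * integral {-T..T} (\<lambda>t. (2 + \<bar>t\<bar>) powr (-1 - \<eta>/2))"
        by (rule integral_mult_right)
      also have "\<dots> \<le> 50 * C0 * ?X powr (1/2 + e) * (2 / (\<eta>/2))"
        using integral_powr_abs_le(2)[of T "\<eta>/2"] T \<eta> C0_pos by (intro mult_left_mono) auto
      finally have h4: "norm ?I4 \<le> 200 * C0 / \<eta> * ?X powr (1/2 + e)" by simp
      have "norm (?J T) \<le> norm ?I1 + norm ?I3 + norm ?I4"
        unfolding eq by (intro order_trans[OF norm_triangle_ineq] order_trans[OF norm_triangle_ineq4] add_mono) auto
      also have "\<dots> \<le> 50 * C0 * ?X powr 3 / T * 2 + 50 * C0 * ?X powr 3 / T * 2 + 200 * C0 / \<eta> * ?X powr (1/2 + e)"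
        by (intro add_mono h1 h3 h4)
      finally show ?thesis by (simp add: field_simps)
    qed
    have "norm (2 * pi * \<i> * (\<Sum>k<N. complex_of_int (moebius_mu (Suc k)))) \<le> 0 + 200 * C0 / \<eta> * ?X powr (1/2 + e)"
    proof (rule tendsto_le[OF _ _ tendsto_norm[OF J_lim]])
      show "((\<lambda>T. 200 * C0 * ?X powr 3 / T + 200 * C0 / \<eta> * ?X powr (1/2 + e)) \<longlongrightarrow> 0 + 200 * C0 / \<eta> * ?X powr (1/2 + e)) at_top"
        by (intro tendsto_add tendsto_const tendsto_divide_0[OF tendsto_const] filterlim_at_top_imp_at_infinity filterlim_ident)
      show "\<forall>\<^sub>F T in at_top. norm (?J T) \<le> 200 * C0 * ?X powr 3 / T + 200 * C0 / \<eta> * ?X powr (1/2 + e)"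
        using eventually_ge_at_top[of 4] by eventually_elim (rule J_bound)
    qed simp
    then have 1: "2 * pi * norm (\<Sum>k<N. complex_of_int (moebius_mu (Suc k))) \<le> 200 * C0 / \<eta> * ?X powr (1/2 + e)"
      by (simp add: norm_mult)
    have "norm (\<Sum>k<N. complex_of_int (moebius_mu (Suc k))) \<le> 2 * pi * norm (\<Sum>k<N. complex_of_int (moebius_mu (Suc k)))"
      using pi_gt3 by (intro mult_right_le_one_le[THEN order_trans, of _ 1] mult_le_cancel_right1[THEN iffD2]) auto
    also note 1
    \<comment> \<open>N + 1 \<le> 2 N as N > 0; the case N = 0 is added at the end.\<close>
    also have "?X powr (1/2 + e) \<le> (2 * real N) powr (1/2 + e)" using N e by (intro powr_mono2) auto
    also have "\<dots> = 2 powr (1/2 + e) * real N powr (1/2 + e)" by (simp add: powr_mult)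
    also have "\<dots> \<le> 2 * real N powr (1/2 + e)"
      using e powr_mono[of "1/2 + e" 1 "2::real"] by (intro mult_right_mono) auto
    finally show ?thesis using \<eta> C0_pos by (simp add: mult_left_mono divide_right_mono)
  qed
  show ?thesis
  proof (rule that)
    fix N show "norm (\<Sum>k<N. complex_of_int (moebius_mu (Suc k))) \<le> (400 * C0 / \<eta>) * real N powr (1/2 + e)"
      using main[of N] by (cases "N = 0") auto
  qed
qed

section \<open>The functional equation\<close>

text \<open>Logarithmic derivative of \<Gamma>(z) \<Gamma>(1 - z) sin(\<pi> z) = \<pi>.\<close>

lemma Digamma_reflection:
  fixes z :: complex
  assumes "z \<notin> \<int>"
  shows "Digamma (1 - z) - Digamma z = pi * cos (pi * z) / sin (pi * z)"
proof -
  have nz: "w \<notin> \<int>\<^sub>\<le>\<^sub>0" "1 - w \<notin> \<int>\<^sub>\<le>\<^sub>0" "sin (pi * w) \<noteq> 0" if "w \<notin> \<int>" for w :: complex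
  proof -
    show "w \<notin> \<int>\<^sub>\<le>\<^sub>0" using that by auto
    show "1 - w \<notin> \<int>\<^sub>\<le>\<^sub>0"
    proof
      assume "1 - w \<in> \<int>\<^sub>\<le>\<^sub>0"
      then have "1 - (1 - w) \<in> \<int>" by (intro Ints_diff) auto
      then show False using that by simp
    qed
    show "sin (pi * w) \<noteq> 0" using that by (auto simp: sin_eq_0)
  qed
  let ?G = "\<lambda>w::complex. Gamma w * Gamma (1 - w) * sin (pi * w)"
  have "(?G has_field_derivative (Gamma z * Digamma z) * Gamma (1 - z) * sin (pi * z)
      + Gamma z * (- Gamma (1 - z) * Digamma (1 - z)) * sin (pi * z) + Gamma z * Gamma (1 - z) * (pi * cos (pi * z))) (at z)"
    using nz[OF assms] by (auto intro!: derivative_eq_intros simp: algebra_simps)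
  moreover have "(?G has_field_derivative 0) (at z)"
  proof (rule has_field_derivative_transform_within_open[where f = "\<lambda>_. of_real pi" and S = "- \<int>"])
    show "open (- \<int> :: complex set)" by (simp add: closed_Ints open_Compl)
    show "of_real pi = ?G w" if "w \<in> - \<int>" for w
      using nz[of w] that Gamma_reflection_complex[of w] by simp
  qed (use assms in auto)
  ultimately have "(Gamma z * Digamma z) * Gamma (1 - z) * sin (pi * z)
      + Gamma z * (- Gamma (1 - z) * Digamma (1 - z)) * sin (pi * z) + Gamma z * Gamma (1 - z) * (pi * cos (pi * z)) = 0"
    by (rule DERIV_unique)
  then have "Gamma z * Gamma (1 - z) * (pi * cos (pi * z) - (Digamma (1 - z) - Digamma z) * sin (pi * z)) = 0"
    by (simp add: algebra_simps)
  then have "pi * cos (pi * z) - (Digamma (1 - z) - Digamma z) * sin (pi * z) = 0"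
    using nz[OF assms] by (auto simp: Gamma_eq_zero_iff)
  then show ?thesis using nz(3)[OF assms] by (simp add: field_simps)
qed

text \<open>In the difference of the series for \<open>Digamma\<close> at 1 + z and 1 - z, Euler's
  constant and the terms 1/(k + 1) cancel; \<open>Digamma_reflection\<close> evaluates it.\<close>

lemma cot_partial_fractions:
  fixes z :: complex
  assumes "z \<notin> \<int>"
  shows "(\<lambda>k. 2 * z / (of_nat (Suc k) ^ 2 - z ^ 2)) sums (1 / z - pi * cos (pi * z) / sin (pi * z))"
proof -
  have z0: "z \<noteq> 0" using assms by auto
  have nz: "of_nat (Suc k) + z \<noteq> 0" "of_nat (Suc k) - z \<noteq> 0" for k
  proof -
    show "of_nat (Suc k) + z \<noteq> 0"
      using assms by (metis Ints_minus Ints_of_nat add_eq_0_iff)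
    show "of_nat (Suc k) - z \<noteq> 0"
      using assms by (metis Ints_of_nat eq_iff_diff_eq_0)
  qed
  have D: "(\<lambda>k. inverse (of_nat (Suc k)) - inverse (w + of_nat k)) sums (Digamma w + euler_mascheroni)" if "w \<noteq> 0" for w :: complex
    using summable_sums[OF summable_Digamma[OF that]] by (simp add: Digamma_def)
  have ne: "1 + z \<noteq> 0" "1 - z \<noteq> 0" using nz[of 0] by auto
  have "(\<lambda>k. (inverse (of_nat (Suc k)) - inverse (1 + z + of_nat k)) - (inverse (of_nat (Suc k)) - inverse (1 - z + of_nat k)))
      sums ((Digamma (1 + z) + euler_mascheroni) - (Digamma (1 - z) + euler_mascheroni))"
    by (intro sums_diff D ne)
  moreover have "(inverse (of_nat (Suc k)) - inverse (1 + z + of_nat k)) - (inverse (of_nat (Suc k)) - inverse (1 - z + of_nat k))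
      = 2 * z / (of_nat (Suc k) ^ 2 - z ^ 2)" for k
  proof -
    have e: "1 + z + of_nat k = of_nat (Suc k) + z" "1 - z + of_nat k = of_nat (Suc k) - z" by simp_all
    have "inverse (of_nat (Suc k) - z) - inverse (of_nat (Suc k) + z) =
        ((of_nat (Suc k) + z) - (of_nat (Suc k) - z)) / ((of_nat (Suc k) - z) * (of_nat (Suc k) + z))"
      using nz[of k] by (simp add: inverse_eq_divide diff_frac_eq del: of_nat_Suc)
    also have "\<dots> = 2 * z / (of_nat (Suc k) ^ 2 - z ^ 2)"
      by (simp add: power2_eq_square algebra_simps del: of_nat_Suc)
    finally show ?thesis unfolding e by simp
  qed
  moreover have "(Digamma (1 + z) + euler_mascheroni) - (Digamma (1 - z) + euler_mascheroni) =
      1 / z - pi * cos (pi * z) / sin (pi * z)"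
    using Digamma_plus1[OF z0] Digamma_reflection[OF assms] by (simp add: add.commute algebra_simps)
  ultimately show ?thesis by simp
qed

text \<open>At z = i x / (2 \<pi>) the cotangent becomes, up to a constant factor, coth(x / 2) = 1 +
  2/(exp x - 1).\<close>

lemma planck_partial_fractions:
  fixes x :: real
  assumes x: "x > 0"
  shows "(\<lambda>n. 2 * x / (x\<^sup>2 + (2 * pi * real (Suc n))\<^sup>2)) sums (1 / (exp x - 1) - 1 / x + 1 / 2)"
proof -
  define y where "y = x / (2 * pi)"
  define z where "z = \<i> * complex_of_real y"
  have y: "y > 0" using x by (simp add: y_def)
  have zI: "z \<notin> \<int>"
    using y by (auto simp: z_def Ints_def complex_eq_iff)
  define E where "E = exp (x / 2)"
  have E: "E > 1" using x by (simp add: E_def)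
  have pz: "\<i> * (complex_of_real pi * z) = of_real (- x / 2)"
    by (simp add: z_def y_def)
  have e1: "exp (\<i> * (complex_of_real pi * z)) = of_real (1 / E)"
    unfolding pz exp_of_real E_def by (simp add: exp_minus field_simps)
  have e2: "exp (- (\<i> * (complex_of_real pi * z))) = of_real E"
    using e1 by (simp add: exp_minus)
  have cs: "cos (pi * z) = of_real ((1 / E + E) / 2)" "sin (pi * z) = of_real (1 / E - E) / (2 * \<i>)"
    unfolding cos_exp_eq sin_exp_eq e1 e2 by simp_all
  have "(\<lambda>k. 2 * z / (of_nat (Suc k) ^ 2 - z ^ 2)) sums (1 / z - pi * cos (pi * z) / sin (pi * z))"
    by (rule cot_partial_fractions[OF zI])
  then have "(\<lambda>k. (1 / (2 * pi * \<i>)) * (2 * z / (of_nat (Suc k) ^ 2 - z ^ 2))) sums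
      ((1 / (2 * pi * \<i>)) * (1 / z - pi * cos (pi * z) / sin (pi * z)))"
    by (rule sums_mult)
  moreover have "(1 / (2 * pi * \<i>)) * (2 * z / (of_nat (Suc k) ^ 2 - z ^ 2)) =
      of_real (2 * x / (x\<^sup>2 + (2 * pi * real (Suc k))\<^sup>2))" for k
  proof -
    have "z ^ 2 = - of_real (y\<^sup>2)" by (simp add: z_def power_mult_distrib)
    then have "(1 / (2 * pi * \<i>)) * (2 * z / (of_nat (Suc k) ^ 2 - z ^ 2)) = of_real ((1 / pi) * y / ((real (Suc k))\<^sup>2 + y\<^sup>2))"
      by (simp add: z_def)
    also have "(1 / pi) * y / ((real (Suc k))\<^sup>2 + y\<^sup>2) = 2 * x / (x\<^sup>2 + (2 * pi * real (Suc k))\<^sup>2)"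
    proof -
      have "x = 2 * pi * y" by (simp add: y_def)
      moreover have "(real (Suc k))\<^sup>2 + y\<^sup>2 > 0" using y by (intro add_nonneg_pos) auto
      moreover have "(2 * pi * y)\<^sup>2 + (2 * pi * real (Suc k))\<^sup>2 = 4 * pi\<^sup>2 * ((real (Suc k))\<^sup>2 + y\<^sup>2)"
        by (simp add: power2_eq_square algebra_simps)
      ultimately show ?thesis by (simp add: power2_eq_square divide_simps del: of_nat_Suc)
    qed
    finally show ?thesis .
  qed
  moreover have "(1 / (2 * pi * \<i>)) * (1 / z - pi * cos (pi * z) / sin (pi * z)) = of_real (1 / (exp x - 1) - 1 / x + 1 / 2)"
  proof -
    have "(1 / (2 * pi * \<i>)) * (1 / z) = of_real (- 1 / x)" using y x by (simp add: z_def y_def field_simps)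
    moreover have "(1 / (2 * pi * \<i>)) * (pi * cos (pi * z) / sin (pi * z)) = of_real (((1 / E + E) / 2) / (1 / E - E))"
    proof -
      have "(1 / (2 * pi * \<i>)) * (pi * p / (q / (2 * \<i>))) = p / q" for p q :: complex
        by (cases "q = 0") (auto simp: field_simps)
      then show ?thesis unfolding cs by (simp only: of_real_divide)
    qed
    moreover have "((1 / E + E) / 2) / (1 / E - E) = - (1 / (exp x - 1) + 1 / 2)"
    proof -
      have ex: "exp x = E\<^sup>2" by (simp add: E_def power2_eq_square flip: exp_add)
      have "E\<^sup>2 > 1" using E by simp
      moreover have "1 / E - E \<noteq> 0" using E calculation by (simp add: field_simps power2_eq_square)
      ultimately show ?thesis unfolding ex using E by (simp add: divide_simps) (simp add: power2_eq_square algebra_simps)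
    qed
    ultimately show ?thesis by (simp only: right_diff_distrib) simp
  qed
  ultimately show ?thesis by (simp only: sums_of_real_iff)
qed

section \<open>The Mellin transform of 1/(exp x - 1)\<close>

definition planck :: "real \<Rightarrow> real" where
  "planck x = 1 / (exp x - 1)"

text \<open>The terms 1/x - 1/2 of the expansion at 0 are removed, so this is O(x) at 0; at infinity
  it tends to 1/2.\<close>

definition planck_reg :: "real \<Rightarrow> real" where
  "planck_reg x = planck x - 1 / x + 1 / 2"

definition planck_cut :: "real \<Rightarrow> real" where
  "planck_cut x = (if x \<le> 1 then planck_reg x else planck x)"

text \<open>The Mellin transform of \<open>planck_cut\<close> converges for \<open>Re s > -1\<close>; it differs by elementary terms from
  that of \<open>planck\<close> for \<open>Re s > 1\<close> and from that of \<open>planck_reg\<close> for \<open>-1 < Re s < 0\<close>.\<close>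

lemma planck_measurable [measurable]:
  "planck \<in> borel_measurable borel" "planck_reg \<in> borel_measurable borel" "planck_cut \<in> borel_measurable borel"
  unfolding planck_cut_def[abs_def] planck_reg_def[abs_def] planck_def[abs_def] by measurable

text \<open>exp x \<ge> (x/k)^k; the exponent is left free so that integrability at infinity holds
  for every s.\<close>

lemma planck_bound:
  assumes x: "x \<ge> 1" and k: "k > 0"
  shows "\<bar>planck x\<bar> \<le> (2 * real k ^ k) * x powr (- real k)"
proof -
  have e: "exp x \<ge> 2" using exp_ge_add_one_self[of x] x by linarith
  have "(x / k) ^ k \<le> (1 + x / k) ^ k" using x by (intro power_mono) auto
  also have "\<dots> \<le> exp x" using x k by (intro exp_ge_one_plus_x_over_n_power_n) auto
  finally have "x ^ k / real k ^ k \<le> exp x" by (simp only: power_divide)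
  then have "inverse (exp x) \<le> inverse (x ^ k / real k ^ k)"
    using x k by (intro le_imp_inverse_le) auto
  then have "inverse (exp x) \<le> real k ^ k * inverse (x ^ k)"
    unfolding inverse_divide unfolding divide_inverse .
  moreover have "\<bar>planck x\<bar> \<le> 2 * inverse (exp x)"
  proof -
    have p: "0 < exp x - 1" "0 < exp x / 2" "exp x / 2 \<le> exp x - 1" using e by linarith+
    have "1 / (exp x - 1) \<le> 1 / (exp x / 2)" by (rule frac_le[OF _ order_refl p(2,3)]) simp
    also have "\<dots> = 2 * inverse (exp x)" by (simp add: inverse_eq_divide)
    finally show ?thesis unfolding planck_def using p(1) by (subst abs_of_pos) (rule divide_pos_pos zero_less_one | assumption)+
  qed
  ultimately have "\<bar>planck x\<bar> \<le> 2 * (real k ^ k * inverse (x ^ k))" by linarith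
  also have "inverse (x ^ k) = x powr (- real k)" using x by (simp add: powr_minus powr_realpow)
  finally show ?thesis by simp
qed

lemma planck_reg_sums:
  "x > 0 \<Longrightarrow> (\<lambda>n. 2 * x / (x\<^sup>2 + (2 * pi * real (Suc n))\<^sup>2)) sums planck_reg x"
  using planck_partial_fractions[of x] by (simp add: planck_reg_def planck_def)

text \<open>Term by term from the partial fractions: all terms are positive, and each is at most x /
  (n + 1)^2.\<close>

lemma planck_reg_bounds:
  assumes x: "x > 0"
  shows "planck_reg x \<ge> 0" and "planck_reg x \<le> (\<Sum>n. 1 / real (Suc n) powr 2) * x"
proof -
  show "planck_reg x \<ge> 0"
    by (rule sums_le[OF _ sums_zero planck_reg_sums[OF x]]) (use x in auto)
  have S: "(\<lambda>n. 1 / real (Suc n) powr 2 * x) sums ((\<Sum>n. 1 / real (Suc n) powr 2) * x)"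
    by (intro sums_mult2 summable_sums summable_Suc_powr) auto
  show "planck_reg x \<le> (\<Sum>n. 1 / real (Suc n) powr 2) * x"
  proof (rule sums_le[OF _ planck_reg_sums[OF x] S])
    fix n
    have "2\<^sup>2 \<le> (2 * pi)\<^sup>2" using pi_gt3 by (intro power_mono) auto
    then have "2 * (real (Suc n))\<^sup>2 \<le> (2 * pi)\<^sup>2 * (real (Suc n))\<^sup>2"
      by (intro mult_right_mono) auto
    then have "2 * (real (Suc n))\<^sup>2 \<le> x\<^sup>2 + (2 * pi * real (Suc n))\<^sup>2"
      using zero_le_power2[of x] unfolding power_mult_distrib[of "2 * pi" "real (Suc n)"] by linarith
    moreover have "0 < x\<^sup>2 + (2 * pi * real (Suc n))\<^sup>2" using x by (intro add_pos_nonneg) auto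
    ultimately have "2 * x / (x\<^sup>2 + (2 * pi * real (Suc n))\<^sup>2) \<le> 2 * x / (2 * (real (Suc n))\<^sup>2)"
      using x by (intro divide_left_mono mult_pos_pos) auto
    then show "2 * x / (x\<^sup>2 + (2 * pi * real (Suc n))\<^sup>2) \<le> 1 / real (Suc n) powr 2 * x"
      by (simp add: powr_numeral del: of_nat_Suc)
  qed
qed

lemma planck_cut_integrable:
  assumes "Re s > -2"
  shows "(\<lambda>x. complex_of_real (planck_cut x) * of_real x powr s) absolutely_integrable_on {0<..}"
proof -
  obtain k0 where "real k0 > Re s + 1" using reals_Archimedean2 by blast
  then have k: "Suc k0 > 0" "real (Suc k0) > Re s + 1" by auto
  define k where "k = Suc k0"
  note k = k[folded k_def]
  show ?thesis
  proof (rule mellin_absolutely_integrableI)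
    show "(\<lambda>x. complex_of_real (planck_cut x)) \<in> borel_measurable borel" by measurable
    show "norm (complex_of_real (planck_cut x)) \<le> (\<Sum>n. 1 / real (Suc n) powr 2) * x powr 1"
      if "0 < x" "x \<le> 1" for x
      using planck_reg_bounds[OF that(1)] that by (simp add: planck_cut_def)
    show "1 + Re s > -1" using assms by simp
    show "norm (complex_of_real (planck_cut x)) \<le> (2 * real k ^ k) * x powr (- real k)" if "1 \<le> x" for x
    proof -
      \<comment> \<open>At x = 1 \<open>planck_cut\<close> still takes the value of
        \<open>planck_reg\<close>, so this point is compared separately.\<close>
      have "\<bar>planck_cut x\<bar> \<le> \<bar>planck x\<bar>"
      proof (cases "x = 1")
        case True
        have "planck 1 \<ge> 0" by (simp add: planck_def)
        moreover have "planck_reg 1 \<le> planck 1" by (simp add: planck_reg_def)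
        ultimately show ?thesis using True planck_reg_bounds(1)[of 1] by (simp add: planck_cut_def)
      qed (use that in \<open>auto simp: planck_cut_def\<close>)
      then show ?thesis using planck_bound[OF that k(1)] by simp
    qed
    show "- real k + Re s < -1" using k by simp
  qed
qed

definition planck_mellin :: "complex \<Rightarrow> complex" where
  "planck_mellin s = integral {0<..} (\<lambda>x. complex_of_real (planck_cut x) * of_real x powr (s - 1))"

lemma planck_mellin_holomorphic: "planck_mellin holomorphic_on {s. Re s > -1}"
proof -
  have *: "(\<lambda>w. integral {0<..} (\<lambda>x. complex_of_real (planck_cut x) * of_real x powr w)) holomorphic_on {w. Re w \<in> {-2<..}}"
      (is "?F holomorphic_on _")
    by (intro mellin_holomorphic planck_cut_integrable) auto
  have "(?F \<circ> (\<lambda>s. s - 1)) holomorphic_on {s. Re s > -1}"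
    by (intro holomorphic_on_compose_gen[OF _ *] holomorphic_intros) auto
  then show ?thesis by (simp add: o_def planck_mellin_def[abs_def])
qed

text \<open>Common part of two evaluations: \<open>P\<close> is \<open>planck\<close> or
  \<open>planck_reg\<close>, and \<open>d\<close> collects the powers by which it departs from
  \<open>planck_cut\<close> on one side of 1.\<close>

lemma integral_planck_mellin:
  assumes s: "Re s > -1" and S: "S \<subseteq> {0<..}" and d: "(d has_integral I) S"
    and in_S: "\<And>x. x \<in> S \<Longrightarrow> P x * of_real x powr (s - 1) = of_real (planck_cut x) * of_real x powr (s - 1) + d x"
    and not_in_S: "\<And>x. x \<in> {0<..} - S \<Longrightarrow> P x = of_real (planck_cut x)"
  shows "integral {0<..} (\<lambda>x. P x * of_real x powr (s - 1)) = planck_mellin s + I"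
proof -
  let ?d = "\<lambda>x. if x \<in> S then d x else 0"
  have C_int: "(\<lambda>x. complex_of_real (planck_cut x) * of_real x powr (s - 1)) absolutely_integrable_on {0<..}"
    using s by (intro planck_cut_integrable) auto
  have d_int: "(?d has_integral I) {0<..}" using d S by (subst has_integral_restrict) auto
  have "integral {0<..} (\<lambda>x. P x * of_real x powr (s - 1)) =
      integral {0<..} (\<lambda>x. complex_of_real (planck_cut x) * of_real x powr (s - 1) + ?d x)"
    by (rule integral_cong) (use in_S not_in_S in auto)
  also have "\<dots> = planck_mellin s + I"
    unfolding planck_mellin_def using C_int d_int
    by (subst integral_add) (auto simp: absolutely_integrable_on_def integral_unique)
  finally show ?thesis .
qed

text \<open>The dilations exp(-n x) contribute n^(-s) \<Gamma>(s). On (0, 1] \<open>planck\<close>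
  exceeds \<open>planck_cut\<close> by 1/x - 1/2, which integrates to 1/(s - 1) - 1/(2 s).\<close>

lemma Gamma_mult_zeta:
  assumes s: "Re s > 1"
  shows "Gamma s * zeta s = planck_mellin s + 1 / (s - 1) - 1 / (2 * s)"
proof -
  let ?h = "\<lambda>x::real. complex_of_real (exp (- x))"
  have h_eq: "?h x * of_real x powr (s - 1) = of_real x powr (s - 1) / of_real (exp x)" for x
    by (simp add: exp_minus field_simps)
  have int: "(\<lambda>x. ?h x * of_real x powr (s - 1)) absolutely_integrable_on {0<..}"
    unfolding h_eq using s by (intro absolutely_integrable_Gamma_integral') auto
  have val: "integral {0<..} (\<lambda>x. ?h x * of_real x powr (s - 1)) = Gamma s"
    unfolding h_eq using s by (intro integral_unique Gamma_integral_complex') auto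
  have geo: "(\<lambda>n. 1 * ?h (real (Suc n) * x)) sums complex_of_real (planck x)"
    "summable (\<lambda>n. norm (1 * ?h (real (Suc n) * x)))" if x: "x > 0" for x
  proof -
    let ?q = "exp (- x)"
    have q: "norm ?q < 1" using x by simp
    have e: "exp (- (real (Suc n) * x)) = ?q * ?q ^ n" for n
      by (simp add: exp_of_nat_mult[symmetric] exp_add[symmetric] algebra_simps)
    have "(\<lambda>n. ?q * ?q ^ n) sums (?q * (1 / (1 - ?q)))"
      by (intro sums_mult geometric_sums q)
    also have "?q * (1 / (1 - ?q)) = planck x"
      using x by (simp add: planck_def exp_minus field_simps)
    finally have "(\<lambda>n. exp (- (real (Suc n) * x))) sums planck x" unfolding e .
    then show "(\<lambda>n. 1 * ?h (real (Suc n) * x)) sums complex_of_real (planck x)"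
      and "summable (\<lambda>n. norm (1 * ?h (real (Suc n) * x)))"
      by (simp_all only: mult_1 sums_of_real_iff norm_of_real abs_exp_cancel sums_summable)
  qed
  have "summable (\<lambda>n. norm (1::complex) * real (Suc n) powr (- Re (s - 1) - 1))"
    using summable_Suc_powr[OF s] by (simp add: powr_minus_divide)
  note D = mellin_dilation_series[where h = ?h and b = "\<lambda>_. 1" and c = "\<lambda>n. real (Suc n)" and w = "s - 1"
      and H = "\<lambda>x. complex_of_real (planck x)", OF _ int _ this geo(2) geo(1)]
  have "(\<lambda>n. 1 * complex_of_real (real (Suc n)) powr (- (s - 1) - 1) * Gamma s) sums
      integral {0<..} (\<lambda>x. complex_of_real (planck x) * of_real x powr (s - 1))"
    using D unfolding val by auto
  moreover have "1 * complex_of_real (real (Suc n)) powr (- (s - 1) - 1) * Gamma s = 1 / of_nat (Suc n) powr s * Gamma s" for n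
    by (simp add: powr_minus_divide del: of_nat_Suc)
  ultimately have "(\<lambda>n. 1 / of_nat (Suc n) powr s * Gamma s) sums
      integral {0<..} (\<lambda>x. complex_of_real (planck x) * of_real x powr (s - 1))" by simp
  then have I: "integral {0<..} (\<lambda>x. complex_of_real (planck x) * of_real x powr (s - 1)) = zeta s * Gamma s"
    using sums_mult2[OF zeta_sums[OF s], of "Gamma s"] sums_unique2 by blast
  have "((\<lambda>x::real. complex_of_real x powr (s - 2) - of_real x powr (s - 1) / 2) has_integral (1 / (s - 2 + 1) - (1 / (s - 1 + 1)) / 2)) {0<..1}"
    using s by (intro has_integral_diff has_integral_divide has_integral_powr_0_1) auto
  then have "integral {0<..} (\<lambda>x. complex_of_real (planck x) * of_real x powr (s - 1)) =
      planck_mellin s + (1 / (s - 2 + 1) - (1 / (s - 1 + 1)) / 2)"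
  proof (intro integral_planck_mellin)
    fix x :: real assume x: "x \<in> {0<..1}"
    have "complex_of_real x powr (s - 1) = of_real x * of_real x powr (s - 2)"
      using x powr_add[of "complex_of_real x" 1 "s - 2"] by simp
    then show "complex_of_real (planck x) * of_real x powr (s - 1) = of_real (planck_cut x) * of_real x powr (s - 1) +
        (of_real x powr (s - 2) - of_real x powr (s - 1) / 2)"
      using x by (simp add: planck_cut_def planck_reg_def algebra_simps)
  qed (use s in \<open>auto simp: planck_cut_def\<close>)
  then show ?thesis unfolding I by (simp add: mult.commute)
qed

text \<open>For -1 < Re s < 1 this is the classical integral with value \<pi> / cos(\<pi> s / 2),
  the trigonometric factor of the functional equation. It enters through its holomorphy, not through
  this value.\<close>

definition sine_kernel_mellin :: "complex \<Rightarrow> complex" where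
  "sine_kernel_mellin s = integral {0<..} (\<lambda>x. complex_of_real (2 * x / (x\<^sup>2 + 1)) * of_real x powr (s - 1))"

lemma sine_kernel_integrable:
  assumes "-2 < Re w" "Re w < 0"
  shows "(\<lambda>x. complex_of_real (2 * x / (x\<^sup>2 + 1)) * of_real x powr w) absolutely_integrable_on {0<..}"
proof (rule mellin_absolutely_integrableI)
  show "norm (complex_of_real (2 * x / (x\<^sup>2 + 1))) \<le> 2 * x powr 1" if "0 < x" "x \<le> 1" for x
    using that by (simp add: divide_le_eq add_pos_pos mult_left_mono del: of_real_divide of_real_mult)
  show "norm (complex_of_real (2 * x / (x\<^sup>2 + 1))) \<le> 2 * x powr (-1)" if "1 \<le> x" for x
  proof -
    have "2 * x / (x\<^sup>2 + 1) \<le> 2 * x / (x\<^sup>2)" using that by (intro divide_left_mono) (auto simp: add_pos_pos)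
    also have "\<dots> = 2 * x powr (-1)" using that by (simp add: powr_minus_divide power2_eq_square)
    finally show ?thesis using that by (simp add: abs_of_nonneg del: of_real_divide of_real_mult)
  qed
qed (use assms in auto)

lemma sine_kernel_mellin_holomorphic: "sine_kernel_mellin holomorphic_on {s. -1 < Re s \<and> Re s < 1}"
proof -
  have *: "(\<lambda>w. integral {0<..} (\<lambda>x. complex_of_real (2 * x / (x\<^sup>2 + 1)) * of_real x powr w)) holomorphic_on {w. Re w \<in> {-2<..<0}}"
      (is "?F holomorphic_on _")
    by (intro mellin_holomorphic sine_kernel_integrable) auto
  have "(?F \<circ> (\<lambda>s. s - 1)) holomorphic_on {s. -1 < Re s \<and> Re s < 1}"
    by (intro holomorphic_on_compose_gen[OF _ *] holomorphic_intros) auto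
  then show ?thesis by (simp only: o_def sine_kernel_mellin_def[abs_def])
qed

text \<open>The partial fractions are \<Sum> c h(c x) with c = 1/(2 \<pi> n), so the dilations
  contribute c^(1-s), with sum (2 \<pi>)^(s-1) zeta(1 - s) as Re s < 0. The elementary terms, now
  integrated over (1, \<infinity>), give the same 1/(s - 1) - 1/(2 s) as in
  \<open>Gamma_mult_zeta\<close>.\<close>

lemma zeta_reflected:
  assumes s: "-1 < Re s" "Re s < 0"
  shows "of_real (2 * pi) powr (s - 1) * zeta (1 - s) * sine_kernel_mellin s =
    planck_mellin s + 1 / (s - 1) - 1 / (2 * s)"
proof -
  let ?h = "\<lambda>x::real. complex_of_real (2 * x / (x\<^sup>2 + 1))"
  define c where "c = (\<lambda>n. 1 / (2 * pi * real (Suc n)))"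
  have c: "c n > 0" for n by (simp add: c_def)
  have int: "(\<lambda>x. ?h x * of_real x powr (s - 1)) absolutely_integrable_on {0<..}"
    using s by (intro sine_kernel_integrable) auto
  have term_eq: "complex_of_real (c n) * ?h (c n * x) = of_real (2 * x / (x\<^sup>2 + (2 * pi * real (Suc n))\<^sup>2))" if "x > 0" for n x
  proof -
    have "c n * (2 * (c n * x) / ((c n * x)\<^sup>2 + 1)) = 2 * x / (x\<^sup>2 + (1 / c n)\<^sup>2)"
      using c[of n] that by (simp add: divide_simps add_pos_pos power2_eq_square) (simp add: algebra_simps)
    then have "c n * (2 * (c n * x) / ((c n * x)\<^sup>2 + 1)) = 2 * x / (x\<^sup>2 + (2 * pi * real (Suc n))\<^sup>2)"
      by (simp add: c_def)
    then show ?thesis by (simp only: of_real_mult[symmetric])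
  qed
  have sums: "(\<lambda>n. complex_of_real (c n) * ?h (c n * x)) sums complex_of_real (planck_reg x)" if "x > 0" for x
    unfolding term_eq[OF that] sums_of_real_iff by (rule planck_reg_sums[OF that])
  have abs: "summable (\<lambda>n. norm (complex_of_real (c n) * ?h (c n * x)))" if "x > 0" for x
    unfolding term_eq[OF that] norm_of_real using planck_reg_sums[OF that] that
    by (subst abs_of_nonneg) (auto simp: sums_iff)
  have cp: "c n powr a = (2 * pi) powr (-a) * (1 / real (Suc n) powr a)" for n a
    unfolding c_def by (simp add: powr_divide powr_mult powr_minus_divide del: of_nat_Suc)
  have "norm (complex_of_real (c n)) * c n powr (- Re (s - 1) - 1) = (2 * pi) powr (-(1 - Re s)) * (1 / real (Suc n) powr (1 - Re s))" for n
  proof -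
    have "norm (complex_of_real (c n)) * c n powr (- Re (s - 1) - 1) = c n powr (1 - Re s)"
      using c[of n] powr_mult_base[of "c n" "- Re s"] by simp
    then show ?thesis by (simp only: cp)
  qed
  then have "summable (\<lambda>n. norm (complex_of_real (c n)) * c n powr (- Re (s - 1) - 1))"
    using s by (simp only:) (intro summable_mult summable_Suc_powr, auto)
  note D = mellin_dilation_series[where h = ?h and b = "\<lambda>n. complex_of_real (c n)" and c = c and w = "s - 1"
      and H = "\<lambda>x. complex_of_real (planck_reg x)", OF _ int c this abs sums]
  have "(\<lambda>n. complex_of_real (c n) * complex_of_real (c n) powr (- (s - 1) - 1) * sine_kernel_mellin s) sums
      integral {0<..} (\<lambda>x. complex_of_real (planck_reg x) * of_real x powr (s - 1))"
    using D unfolding sine_kernel_mellin_def by auto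
  moreover have "complex_of_real (c n) * complex_of_real (c n) powr (- (s - 1) - 1) =
      of_real (2 * pi) powr (s - 1) * (1 / of_nat (Suc n) powr (1 - s))" for n
  proof -
    have "complex_of_real (c n) * complex_of_real (c n) powr (- (s - 1) - 1) = of_real (c n) powr (1 - s)"
      using c[of n] powr_add[of "complex_of_real (c n)" 1 "-s"] by simp
    moreover have 1: "complex_of_real (c n) powr (1 - s) * (of_real (2 * pi) powr (1 - s) * of_nat (Suc n) powr (1 - s)) = 1"
    proof -
      have "complex_of_real (c n) powr (1 - s) * (of_real (2 * pi) powr (1 - s) * of_nat (Suc n) powr (1 - s))
        = (of_real (c n) * (of_real (2 * pi) * of_nat (Suc n))) powr (1 - s)"
        using c[of n] by (simp add: powr_times_real del: of_nat_Suc of_real_mult)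
      also have "complex_of_real (c n) * (of_real (2 * pi) * of_nat (Suc n)) = 1"
        by (simp add: c_def del: of_nat_Suc)
      finally show ?thesis by simp
    qed
    have 2: "complex_of_real (2 * pi) powr (s - 1) * of_real (2 * pi) powr (1 - s) = 1"
      by (simp flip: powr_add)
    have "complex_of_real (c n) powr (1 - s) = of_real (2 * pi) powr (s - 1) * (1 / of_nat (Suc n) powr (1 - s))"
    proof -
      have "C = P * (1 / R)" if "C * (Q * R) = 1" "P * Q = 1" for C P Q R :: complex
      proof -
        have "R \<noteq> 0" "Q \<noteq> 0" using that by auto
        then have "C = 1 / (Q * R)" "P = 1 / Q" using that by (auto simp: eq_divide_eq)
        then show ?thesis by simp
      qed
      then show ?thesis using 1 2 by blast
    qed
    ultimately show ?thesis by simp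
  qed
  ultimately have "(\<lambda>n. of_real (2 * pi) powr (s - 1) * (1 / of_nat (Suc n) powr (1 - s)) * sine_kernel_mellin s) sums
      integral {0<..} (\<lambda>x. complex_of_real (planck_reg x) * of_real x powr (s - 1))" by simp
  moreover have "(\<lambda>n. of_real (2 * pi) powr (s - 1) * (1 / of_nat (Suc n) powr (1 - s)) * sine_kernel_mellin s) sums
      (of_real (2 * pi) powr (s - 1) * zeta (1 - s) * sine_kernel_mellin s)"
    using s by (intro sums_mult sums_mult2 zeta_sums) auto
  ultimately have I: "integral {0<..} (\<lambda>x. complex_of_real (planck_reg x) * of_real x powr (s - 1)) =
      of_real (2 * pi) powr (s - 1) * zeta (1 - s) * sine_kernel_mellin s"
    by (rule sums_unique2)
  have "((\<lambda>x::real. complex_of_real x powr (s - 1) / 2 - of_real x powr (s - 2)) has_integral ((- 1 / (s - 1 + 1)) / 2 - (- 1 / (s - 2 + 1)))) {1<..}"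
    using s by (intro has_integral_diff has_integral_divide has_integral_powr_1_inf) auto
  then have "integral {0<..} (\<lambda>x. complex_of_real (planck_reg x) * of_real x powr (s - 1)) =
      planck_mellin s + ((- 1 / (s - 1 + 1)) / 2 - (- 1 / (s - 2 + 1)))"
  proof (intro integral_planck_mellin)
    fix x :: real assume x: "x \<in> {1<..}"
    have "complex_of_real x powr (s - 1) = of_real x * of_real x powr (s - 2)"
      using x powr_add[of "complex_of_real x" 1 "s - 2"] by simp
    then show "complex_of_real (planck_reg x) * of_real x powr (s - 1) = of_real (planck_cut x) * of_real x powr (s - 1) +
        (of_real x powr (s - 1) / 2 - of_real x powr (s - 2))"
      using x by (simp add: planck_cut_def planck_reg_def algebra_simps)
  qed (use s in \<open>auto simp: planck_cut_def\<close>)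
  then show ?thesis unfolding I by (simp add: mult.commute)
qed

section \<open>The functional equation in the critical strip\<close>

lemma Re_pos_not_nonpos_Ints:
  assumes "Re s > 0"
  shows "s \<notin> \<int>\<^sub>\<le>\<^sub>0"
proof
  assume "s \<in> \<int>\<^sub>\<le>\<^sub>0"
  then obtain n :: int where n: "s = of_int n" "n \<le> 0" by (auto elim!: nonpos_Ints_cases)
  then have "Re s \<le> 0" unfolding n(1) by simp
  then show False using assms by simp
qed

text \<open>Both sides continue one function \<Phi>: the left side from Re s > 1 down to Re s > 0,
  the right side from -1 < Re s < 0 up to Re s < 1. They meet in the critical strip.\<close>

lemma zeta_functional_equation:
  assumes "0 < Re s" "Re s < 1"
  shows "s * Gamma s * zeta_reg s = (1 - s) * of_real (2 * pi) powr (s - 1) * sine_kernel_mellin s * zeta_reg (1 - s)"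
proof -
  \<comment> \<open>The common right side of \<open>Gamma_mult_zeta\<close> and
    \<open>zeta_reflected\<close>, multiplied by s (s - 1) to clear the poles at 0 and 1.\<close>
  define \<Phi> where "\<Phi> = (\<lambda>s. s * (s - 1) * planck_mellin s + s - (s - 1) / 2)"
  have Phi: "\<Phi> s = s * (s - 1) * (planck_mellin s + 1 / (s - 1) - 1 / (2 * s))" if "s \<noteq> 0" "s \<noteq> 1" for s
    using that by (simp add: \<Phi>_def field_simps)
  have Phi_hol: "\<Phi> holomorphic_on A" if "A \<subseteq> {s. Re s > -1}" for A
    unfolding \<Phi>_def using holomorphic_on_subset[OF planck_mellin_holomorphic that] by (intro holomorphic_intros) auto
  have "s * Gamma s * zeta_reg s = \<Phi> s"
  proof (rule analytic_continuation_open[where f = "\<lambda>s. s * Gamma s * zeta_reg s" and g = \<Phi> and z = s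
        and s = "{s. Re s > 1}" and s' = "{s. Re s > 0}"])
    show "{s::complex. Re s > 1} \<noteq> {}" by (auto intro!: exI[of _ 2])
    show "connected {s. Re s > 0}" by (intro convex_connected convex_halfspace_Re_gt)
    show "(\<lambda>s. s * Gamma s * zeta_reg s) holomorphic_on {s. Re s > 0}"
      by (intro holomorphic_intros zeta_reg_holomorphic) (auto dest: Re_pos_not_nonpos_Ints)
    show "z * Gamma z * zeta_reg z = \<Phi> z" if "z \<in> {s. Re s > 1}" for z
    proof -
      have z: "z \<noteq> 0" "z \<noteq> 1" "Re z > 1" using that by auto
      have "\<Phi> z = z * (z - 1) * (Gamma z * zeta z)" unfolding Phi[OF z(1,2)] Gamma_mult_zeta[OF z(3)] ..
      then show ?thesis using zeta_eq_zeta_reg[OF z(2)] z by simp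
    qed
    show "open {s. Re s > 1}" "open {s. Re s > 0}" by (rule open_halfspace_Re_gt)+
    show "\<Phi> holomorphic_on {s. Re s > 0}" by (rule Phi_hol) auto
  qed (use assms in auto)
  moreover have "(1 - s) * of_real (2 * pi) powr (s - 1) * sine_kernel_mellin s * zeta_reg (1 - s) = \<Phi> s"
  proof (rule analytic_continuation_open[where z = s and g = \<Phi>
        and f = "\<lambda>s. (1 - s) * of_real (2 * pi) powr (s - 1) * sine_kernel_mellin s * zeta_reg (1 - s)"
        and s = "{s. -1 < Re s} \<inter> {s. Re s < 0}" and s' = "{s. -1 < Re s} \<inter> {s. Re s < 1}"])
    have "-1/2 \<in> {s::complex. -1 < Re s} \<inter> {s. Re s < 0}" by simp
    then show "{s::complex. -1 < Re s} \<inter> {s. Re s < 0} \<noteq> {}" by blast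
    show "connected ({s. -1 < Re s} \<inter> {s. Re s < 1})"
      by (intro convex_connected convex_Int convex_halfspace_Re_gt convex_halfspace_Re_lt)
    have "(zeta_reg \<circ> (\<lambda>s. 1 - s)) holomorphic_on {s. -1 < Re s} \<inter> {s. Re s < 1}"
      by (intro holomorphic_on_compose_gen[OF _ zeta_reg_holomorphic] holomorphic_intros) auto
    moreover have "sine_kernel_mellin holomorphic_on {s. -1 < Re s} \<inter> {s. Re s < 1}"
      by (rule holomorphic_on_subset[OF sine_kernel_mellin_holomorphic]) auto
    ultimately show "(\<lambda>s. (1 - s) * of_real (2 * pi) powr (s - 1) * sine_kernel_mellin s * zeta_reg (1 - s))
        holomorphic_on {s. -1 < Re s} \<inter> {s. Re s < 1}"
      unfolding o_def by (intro holomorphic_intros) auto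
    show "(1 - z) * of_real (2 * pi) powr (z - 1) * sine_kernel_mellin z * zeta_reg (1 - z) = \<Phi> z"
      if "z \<in> {s. -1 < Re s} \<inter> {s. Re s < 0}" for z
    proof -
      have z: "z \<noteq> 0" "z \<noteq> 1" "1 - z \<noteq> 1" "-1 < Re z" "Re z < 0" using that by auto
      have "\<Phi> z = z * (z - 1) * (of_real (2 * pi) powr (z - 1) * zeta (1 - z) * sine_kernel_mellin z)"
        unfolding Phi[OF z(1,2)] zeta_reflected[OF z(4,5)] ..
      also have "zeta (1 - z) = - zeta_reg (1 - z) / z" using zeta_eq_zeta_reg[OF z(3)] z by simp
      also have "z * (z - 1) * (P * (- R / z) * K) = (1 - z) * P * K * R" for P R K
        using z(1) by (simp add: field_simps)
      finally show ?thesis by simp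
    qed
    show "open ({s. -1 < Re s} \<inter> {s. Re s < 0})" "open ({s. -1 < Re s} \<inter> {s. Re s < 1})"
      by (intro open_Int open_halfspace_Re_gt open_halfspace_Re_lt)+
    show "\<Phi> holomorphic_on {s. -1 < Re s} \<inter> {s. Re s < 1}" by (rule Phi_hol) auto
  qed (use assms in auto)
  ultimately show ?thesis by simp
qed

text \<open>The functional equation at 1 - s has \<open>zeta_reg s\<close> on its right side and the
  zero-free factor \<Gamma>(1 - s) on its left. Read in this direction, it asks nothing about zeros
  of \<open>sine_kernel_mellin\<close>.\<close>

lemma zeta_zero_reflect:
  assumes "0 < Re s" "Re s < 1" "zeta s = 0"
  shows "zeta (1 - s) = 0"
proof -
  have s: "s \<noteq> 1" "1 - s \<noteq> 1" "1 - s \<noteq> 0" using assms by auto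
  have "zeta_reg s = 0" using zeta_eq_zeta_reg[OF s(1)] assms(3) s by simp
  then have "(1 - s) * Gamma (1 - s) * zeta_reg (1 - s) = 0"
    using zeta_functional_equation[of "1 - s"] assms by simp
  moreover have "1 - s \<notin> \<int>\<^sub>\<le>\<^sub>0" using assms by (intro Re_pos_not_nonpos_Ints) auto
  then have "Gamma (1 - s) \<noteq> 0" by (simp add: Gamma_eq_zero_iff)
  ultimately show ?thesis using zeta_eq_zeta_reg[OF s(2)] s by simp
qed

section \<open>The main equivalence\<close>

text \<open>The bound for the partial sums gives convergence and holomorphy on a half-plane
  containing s; the value is continued from Re s > 1.\<close>

lemma moebius_mu_sums_RH:
  assumes RH: "riemann_hypothesis" and s: "Re s > 1/2"
  shows "(\<lambda>n. of_int (moebius_mu (Suc n)) / of_nat (Suc n) powr s) sums ((s - 1) / zeta_reg s)"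
proof -
  \<comment> \<open>Half the distance to 1/2 puts \<open>s\<close> strictly inside the half-plane;
    the cap 1/4 secures \<open>e < 1/2\<close>.\<close>
  define e where "e = min (1/4) ((Re s - 1/2) / 2)"
  have "e \<le> (Re s - 1/2) / 2" unfolding e_def by (rule min.cobounded2)
  then have "1/2 + e < Re s" using s by (simp add: field_simps)
  then have e: "0 < e" "e < 1/2" "1/2 + e < Re s" using s by (simp_all add: e_def)
  obtain C where C: "\<And>N. norm (\<Sum>k<N. complex_of_int (moebius_mu (Suc k))) \<le> C * real N powr (1/2 + e)"
    using mertens_bound_RH[OF RH e(1,2)] by blast
  define G where "G = (\<lambda>s. \<Sum>k. complex_of_int (moebius_mu (Suc k)) / of_nat (Suc k) powr s)"
  have hol: "G holomorphic_on {s. Re s > 1/2 + e}"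
    unfolding G_def using e by (intro dirichlet_series_holomorphic[OF C]) auto
  have "G s = (s - 1) / zeta_reg s"
  proof (rule analytic_continuation_open[where f = G and g = "\<lambda>s. (s - 1) / zeta_reg s" and z = s
        and s = "{s. Re s > 1}" and s' = "{s. Re s > 1/2 + e}"])
    have "2 \<in> {s::complex. Re s > 1}" by simp
    then show "{s::complex. Re s > 1} \<noteq> {}" by blast
    show "connected {s. Re s > 1/2 + e}" by (intro convex_connected convex_halfspace_Re_gt)
    show "open {s. Re s > 1}" "open {s. Re s > 1/2 + e}" by (rule open_halfspace_Re_gt)+
    show "(\<lambda>s. (s - 1) / zeta_reg s) holomorphic_on {s. Re s > 1/2 + e}"
      using e zeta_reg_nonzero_RH[OF RH]
      by (intro holomorphic_intros holomorphic_on_subset[OF zeta_reg_holomorphic]) auto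
    show "G z = (z - 1) / zeta_reg z" if "z \<in> {s. Re s > 1}" for z
    proof -
      have z: "Re z > 1" "z \<noteq> 1" using that by auto
      have "G z = inverse (zeta z)" unfolding G_def using moebius_mu_sums[OF z(1)] by (simp add: sums_iff)
      then show ?thesis using zeta_eq_zeta_reg[OF z(2)] by simp
    qed
  qed (use e hol in auto)
  moreover have "summable (\<lambda>k. complex_of_int (moebius_mu (Suc k)) / of_nat (Suc k) powr s)"
    by (rule dirichlet_series_summable[OF C _ e(3)]) (use e in auto)
  ultimately show ?thesis unfolding G_def by (simp add: sums_iff)
qed

section \<open>Dirichlet series of the Ramanujan sums\<close>

lemma sum_divisors_reflect:
  fixes h :: "nat \<Rightarrow> nat \<Rightarrow> 'a :: comm_monoid_add"
  assumes "q > 0"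
  shows "(\<Sum>d | d dvd q. h d (q div d)) = (\<Sum>d | d dvd q. h (q div d) d)"
  by (rule sum.reindex_bij_witness[where i = "\<lambda>d. q div d" and j = "\<lambda>d. q div d"])
     (use assms in \<open>auto elim!: dvdE\<close>)

lemma gen_sigma_eq:
  assumes "b > 0"
  shows "gen_sigma b (1 - s / of_nat b) n = (\<Sum>d | 0 < d \<and> d ^ b dvd n. of_nat d powr (of_nat b - s))"
  using assms by (simp add: gen_sigma_def right_diff_distrib)

text \<open>With q = d e each pair contributes \<mu>(d) d^(-s) e^(b-s), and only e with e^b | n
  occur; these satisfy e \<le> n \<le> Q, so none is cut off.\<close>

lemma gen_ramanujan_sum_partial_sum:
  assumes b: "b > 0" and n: "n > 0" and Q: "n \<le> Q"
  shows "(\<Sum>q<Q. gen_ramanujan_sum b (Suc q) n / of_nat (Suc q) powr s) =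
    (\<Sum>e | 0 < e \<and> e ^ b dvd n. of_nat e powr (of_nat b - s) *
       (\<Sum>d<Q div e. of_int (moebius_mu (Suc d)) / of_nat (Suc d) powr s))"
proof -
  define h where "h = (\<lambda>e d. (if e ^ b dvd n then of_nat e powr (of_nat b - s) else 0) *
      (complex_of_int (moebius_mu d) / of_nat d powr s))"
  have "(\<Sum>q<Q. gen_ramanujan_sum b (Suc q) n / of_nat (Suc q) powr s) =
      (\<Sum>q=1..Q. gen_ramanujan_sum b q n / of_nat q powr s)"
    by (rule sum_from_1_eq[symmetric])
  also have "\<dots> = (\<Sum>q=1..Q. \<Sum>e | e dvd q. h e (q div e))"
  proof (rule sum.cong)
    fix q assume "q \<in> {1..Q}"
    then have q: "q > 0" by simp
    have "gen_ramanujan_sum b q n / of_nat q powr s = (\<Sum>d | d dvd q. h (q div d) d)"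
      unfolding gen_ramanujan_sum_eq[OF q b] sum_divide_distrib
    proof (rule sum.cong)
      fix d assume "d \<in> {d. d dvd q}"
      then obtain e where e: "q = d * e" by auto
      have de: "d > 0" "e > 0" using q e by auto
      have eq: "complex_of_nat (e ^ b) / of_nat q powr s = of_nat e powr (of_nat b - s) / of_nat d powr s"
        using de by (simp add: e of_nat_powr_mult powr_diff powr_nat' del: of_nat_mult)
      have "of_int (moebius_mu d) * complex_of_nat (e ^ b) / of_nat q powr s =
          of_nat e powr (of_nat b - s) * (of_int (moebius_mu d) / of_nat d powr s)"
        unfolding times_divide_eq_right[symmetric] eq by simp
      moreover have "q div d = e" using e de by simp
      ultimately show "of_int (moebius_mu d) * (if (q div d) ^ b dvd n then of_nat ((q div d) ^ b) else 0) / of_nat q powr s =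
          h (q div d) d"
        by (simp add: h_def del: of_nat_power)
    qed simp
    also have "\<dots> = (\<Sum>e | e dvd q. h e (q div e))" by (rule sum_divisors_reflect[OF q, symmetric])
    finally show "gen_ramanujan_sum b q n / of_nat q powr s = (\<Sum>e | e dvd q. h e (q div e))" .
  qed simp
  also have "\<dots> = (\<Sum>e=1..Q. \<Sum>d=1..Q div e. h e d)" by (rule sum_divisors_hyperbola)
  also have "\<dots> = (\<Sum>e | 0 < e \<and> e ^ b dvd n. \<Sum>d=1..Q div e. h e d)"
  proof (rule sum.mono_neutral_right)
    show "{e. 0 < e \<and> e ^ b dvd n} \<subseteq> {1..Q}"
    proof
      fix e assume e: "e \<in> {e. 0 < e \<and> e ^ b dvd n}"
      have "e \<le> e ^ b" using e b by (intro self_le_power) auto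
      also have "\<dots> \<le> n" using e n by (intro dvd_imp_le) auto
      finally show "e \<in> {1..Q}" using e Q by auto
    qed
  qed (auto simp: h_def)
  also have "\<dots> = (\<Sum>e | 0 < e \<and> e ^ b dvd n. of_nat e powr (of_nat b - s) *
       (\<Sum>d<Q div e. of_int (moebius_mu (Suc d)) / of_nat (Suc d) powr s))"
    unfolding sum_from_1_eq by (intro sum.cong) (simp_all add: h_def sum_distrib_left)
  finally show ?thesis .
qed

text \<open>Finitely many e occur, each with its own upper limit \<open>Q div e\<close> tending to
  infinity, so conditional convergence of the Moebius series suffices.\<close>

lemma gen_ramanujan_sum_sums:
  assumes b: "b > 0" and n: "n > 0"
    and m: "(\<lambda>k. of_int (moebius_mu (Suc k)) / of_nat (Suc k) powr s) sums m"
  shows "(\<lambda>q. gen_ramanujan_sum b (Suc q) n / of_nat (Suc q) powr s) sums (gen_sigma b (1 - s / of_nat b) n * m)"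
  unfolding sums_def
proof (rule Lim_transform_eventually)
  let ?M = "\<lambda>N. \<Sum>d<N. of_int (moebius_mu (Suc d)) / of_nat (Suc d) powr s"
  have M: "?M \<longlonglongrightarrow> m" using m by (simp add: sums_def)
  show "(\<lambda>Q. \<Sum>e | 0 < e \<and> e ^ b dvd n. of_nat e powr (of_nat b - s) * ?M (Q div e)) \<longlonglongrightarrow>
      gen_sigma b (1 - s / of_nat b) n * m"
    unfolding gen_sigma_eq[OF b] sum_distrib_right
    by (intro tendsto_sum tendsto_mult tendsto_const filterlim_compose[OF M] filterlim_div_nat) auto
  show "\<forall>\<^sub>F Q in sequentially. (\<Sum>e | 0 < e \<and> e ^ b dvd n. of_nat e powr (of_nat b - s) * ?M (Q div e)) =
      (\<Sum>q<Q. gen_ramanujan_sum b (Suc q) n / of_nat (Suc q) powr s)"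
    using eventually_ge_at_top[of n]
    by eventually_elim (rule gen_ramanujan_sum_partial_sum[OF b n, symmetric])
qed

text \<open>The d with d^b | n are the divisors of a single m, and the exponent b - s has positive
  real part.\<close>

lemma gen_sigma_nonzero:
  assumes b: "b > 0" and n: "n > 0" and s: "Re s < real b"
  shows "gen_sigma b (1 - s / of_nat b) n \<noteq> 0"
proof -
  obtain m where m: "m > 0" "\<And>d. d dvd n \<and> d ^ b dvd n \<longleftrightarrow> d dvd m"
    using power_dvd_set_eq_divisors[OF n] by blast
  have "{d. 0 < d \<and> d ^ b dvd n} = {d. d dvd m}"
  proof -
    have "0 < d \<and> d ^ b dvd n \<longleftrightarrow> d dvd n \<and> d ^ b dvd n" for d
    proof
      assume "0 < d \<and> d ^ b dvd n"
      moreover have "d dvd d ^ b" using b by simp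
      ultimately show "d dvd n \<and> d ^ b dvd n" using dvd_trans by blast
    next
      assume "d dvd n \<and> d ^ b dvd n"
      then show "0 < d \<and> d ^ b dvd n" using n by (cases "d = 0") auto
    qed
    then show ?thesis using m(2) by blast
  qed
  then show ?thesis
    using sum_divisors_powr_nonzero[of "of_nat b - s" m] s m(1) by (simp add: gen_sigma_eq[OF b])
qed

text \<open>Convergence at a real point r between 1/2 and Re s0 bounds the partial sums of the terms
  twisted by q^(-r); summation by parts with \<theta> = 0 then yields a holomorphic sum for Re s >
  r.\<close>

lemma zeta_nonzero_if_convergent:
  assumes b: "b > 0" and n: "n > 0"
    and conv: "\<And>s. Re s > 1/2 \<Longrightarrow> summable (\<lambda>q. gen_ramanujan_sum b (Suc q) n / of_nat (Suc q) powr s)"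
    and s0: "1/2 < Re s0" "Re s0 < 1"
  shows "zeta s0 \<noteq> 0"
proof
  assume zero: "zeta s0 = 0"
  define r where "r = (Re s0 + 1/2) / 2"
  have r: "1/2 < r" "r < Re s0" using s0 by (auto simp: r_def)
  define a where "a = (\<lambda>q. gen_ramanujan_sum b (Suc q) n / of_nat (Suc q) powr (of_real r))"
  have "summable a" unfolding a_def using r by (intro conv) auto
  then have "convergent (\<lambda>N. \<Sum>k<N. a k)" by (simp add: summable_iff_convergent)
  then obtain C where C: "\<And>N. norm (\<Sum>k<N. a k) \<le> C" using convergent_imp_Bseq BseqE by metis
  \<comment> \<open>N = 0 is separate because \<open>0 powr 0 = 0\<close>.\<close>
  have C': "norm (\<Sum>k<N. a k) \<le> C * real N powr 0" for N using C[of N] by (cases "N = 0") auto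
  define G where "G = (\<lambda>s. \<Sum>k. a k / of_nat (Suc k) powr (s - of_real r))"
  have "((\<lambda>s. \<Sum>k. a k / of_nat (Suc k) powr s) \<circ> (\<lambda>s. s - of_real r)) holomorphic_on {s. Re s > r}"
    by (intro holomorphic_on_compose_gen[OF _ dirichlet_series_holomorphic[OF C']] holomorphic_intros) auto
  then have hol: "G holomorphic_on {s. Re s > r}" by (simp add: G_def o_def)
  have a_eq: "a k / of_nat (Suc k) powr (s - of_real r) = gen_ramanujan_sum b (Suc k) n / of_nat (Suc k) powr s" for k s
    by (simp add: a_def powr_diff del: of_nat_Suc)
  define \<sigma> where "\<sigma> = (\<lambda>s. gen_sigma b (1 - s / of_nat b) n)"
  \<comment> \<open>Cleared of denominators, since \<open>zeta_reg\<close> is assumed to vanish at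
    \<open>s0\<close>; the factor \<open>s - 1\<close> accounts for the pole.\<close>
  have "G s0 * zeta_reg s0 = \<sigma> s0 * (s0 - 1)"
  proof (rule analytic_continuation_open[where f = "\<lambda>s. G s * zeta_reg s" and g = "\<lambda>s. \<sigma> s * (s - 1)" and z = s0
        and s = "{s. Re s > 1}" and s' = "{s. Re s > r}"])
    have "2 \<in> {s::complex. Re s > 1}" by simp
    then show "{s::complex. Re s > 1} \<noteq> {}" by blast
    show "connected {s. Re s > r}" by (intro convex_connected convex_halfspace_Re_gt)
    show "open {s. Re s > 1}" "open {s. Re s > r}" by (rule open_halfspace_Re_gt)+
    show "(\<lambda>s. G s * zeta_reg s) holomorphic_on {s. Re s > r}"
      using r by (intro holomorphic_intros hol holomorphic_on_subset[OF zeta_reg_holomorphic]) auto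
    show "(\<lambda>s. \<sigma> s * (s - 1)) holomorphic_on {s. Re s > r}"
      unfolding \<sigma>_def gen_sigma_eq[OF b] by (intro holomorphic_intros) auto
    show "G z * zeta_reg z = \<sigma> z * (z - 1)" if "z \<in> {s. Re s > 1}" for z
    proof -
      have z: "Re z > 1" "z \<noteq> 1" using that by auto
      have "G z = \<sigma> z * inverse (zeta z)"
        unfolding G_def a_eq \<sigma>_def using gen_ramanujan_sum_sums[OF b n moebius_mu_sums[OF z(1)]] by (simp add: sums_iff)
      then show ?thesis using zeta_eq_zeta_reg[OF z(2)] zeta_nonzero_Re_gt_1[OF z(1)] z(2) by auto
    qed
  qed (use r s0 in auto)
  moreover have "s0 \<noteq> 1" using s0 by auto
  moreover have "zeta_reg s0 = 0" using zeta_eq_zeta_reg[OF \<open>s0 \<noteq> 1\<close>] zero \<open>s0 \<noteq> 1\<close> by simp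
  moreover have "\<sigma> s0 \<noteq> 0"
    unfolding \<sigma>_def using s0 b by (intro gen_sigma_nonzero b n) linarith
  ultimately show False by simp
qed

text \<open>At s = 1 division by 0 gives the formula for \<open>zeta\<close> an accidental value in
  place of the pole; the right side therefore reads 1/zeta as 0 there.\<close>

theorem theorem3:
  fixes \<beta> n :: nat
  assumes "\<beta> \<ge> 1" and "n \<ge> 1"
  shows "riemann_hypothesis \<longleftrightarrow>
    (\<forall>s::complex. Re s > 1/2 \<longrightarrow>
       (\<lambda>q. gen_ramanujan_sum \<beta> (Suc q) n / (of_nat (Suc q) :: complex) powr s)
         sums (gen_sigma \<beta> (1 - s / of_nat \<beta>) n * (if s = 1 then 0 else inverse (zeta s))))"
proof (intro iffI allI impI)
  fix s :: complex assume RH: "riemann_hypothesis" and s: "Re s > 1/2"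
  \<comment> \<open>At s = 1 the left side is 0 because \<open>zeta_reg 1 = 1\<close>.\<close>
  have "(s - 1) / zeta_reg s = (if s = 1 then 0 else inverse (zeta s))"
    using zeta_eq_zeta_reg[of s] by auto
  then show "(\<lambda>q. gen_ramanujan_sum \<beta> (Suc q) n / (of_nat (Suc q) :: complex) powr s)
         sums (gen_sigma \<beta> (1 - s / of_nat \<beta>) n * (if s = 1 then 0 else inverse (zeta s)))"
    using gen_ramanujan_sum_sums[OF _ _ moebius_mu_sums_RH[OF RH s], of \<beta> n] assms by simp
next
  assume conv: "\<forall>s::complex. Re s > 1/2 \<longrightarrow>
       (\<lambda>q. gen_ramanujan_sum \<beta> (Suc q) n / (of_nat (Suc q) :: complex) powr s)
         sums (gen_sigma \<beta> (1 - s / of_nat \<beta>) n * (if s = 1 then 0 else inverse (zeta s)))"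
  have nz: "zeta s \<noteq> 0" if "1/2 < Re s" "Re s < 1" for s
  proof (rule zeta_nonzero_if_convergent[of \<beta> n])
    show "summable (\<lambda>q. gen_ramanujan_sum \<beta> (Suc q) n / of_nat (Suc q) powr s)" if "Re s > 1/2" for s
      using conv that by (auto intro: sums_summable)
  qed (use assms that in auto)
  show "riemann_hypothesis"
    unfolding riemann_hypothesis_def
  proof (intro allI impI)
    fix s assume s: "0 < Re s \<and> Re s < 1 \<and> zeta s = 0"
    then have "zeta (1 - s) = 0" by (intro zeta_zero_reflect) auto
    moreover have "\<not> 1/2 < Re s" using nz[of s] s by blast
    moreover have "\<not> Re s < 1/2" using nz[of "1 - s"] s calculation(1) by auto
    ultimately show "Re s = 1/2" by linarith
  qed
qed

end
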